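(* Let $(X,dx)$ and $(Y,dy)$ be sigma-finite measure spaces and let $\mathcal H$ and $\mathcal G$ be separable Hilbert spaces. Let $\Phi: L_2(X,\mathcal H)\to L_2(Y,\mathcal G)$ be a unitary operator which maps $L_1(X,\mathcal H)$ boundedly into $L_\infty(Y,\mathcal G)$. Let $q>2$. If $f\in L_{q}(X,\mathfrak{S}_q(\mathcal H))$ and $g\in L_{q,w}(Y,\mathfrak{B}(\mathcal G))$, then $f\,\Phi^*\,g\in\mathfrak{S}_{q,w}( L_2(Y,\mathcal G),L_2(X,\mathcal H) )$ with $$ \| f\, \Phi^* \, g \|_{q,w}^q \le \frac{q}{2} \left( \frac{q}{q-2} \right)^{q-1} C^2 \ \| f \|_{L_{q}(\mathfrak{S}_q)}^{q} \ \| g\|_{L_{q,w}(\mathfrak{B})}^q , $$ where $C = \|\Phi\|_{L_1(X,\mathcal H)\to L_\infty(Y,\mathcal G)}$.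
   Context: $\mathfrak{B}(\mathcal G)$ denotes the bounded operators on $\mathcal G$ with operator norm, and $\mathfrak{S}_q(\mathcal H)$ the Schatten class with norm $\|K\|_{\mathfrak{S}_q(\mathcal H)}=(\operatorname{Tr}(K^*K)^{q/2})^{1/q}$. $L_{q}(X,\mathfrak{S}_q(\mathcal H))$ is the space of all measurable functions $f$ on $X$ with values in the compact operators in $\mathcal H$ such that $\| f\|_{L_q(\mathfrak{S}_q)}^q = \int_X \| f(x)\|_{\mathfrak{S}_q(\mathcal H)}^q \,dx <\infty$. $L_{q,w}(Y,\mathfrak{B}(\mathcal G))$ is the space of all measurable functions $g$ on $Y$ with values in the bounded operators on $\mathcal G$ such that $\| g\|_{L_{q,w}(\mathfrak{B})}^q = \sup_{\tau>0} \tau^q \, |\{ y\in Y:\ \|g(y)\|_{\mathfrak{B}(\mathcal G)} >\tau \} |$ is finite, where $|\cdot|$ is the measure on $Y$. The functions $f$ and $g$ are identified with the corresponding pointwise multiplication operators $(fu)(x)=f(x)u(x)$ and $(gv)(y)=g(y)v(y)$ on $L_2(X,\mathcal H)$ and $L_2(Y,\mathcal G)$. That $\Phi$ maps $L_1(X,\mathcal H)$ boundedly into $L_\infty(Y,\mathcal G)$ means that $\|\Phi u\|_{L_\infty(Y,\mathcal G)}\le C\|u\|_{L_1(X,\mathcal H)}$ for all $u\in L_1(X,\mathcal H)\cap L_2(X,\mathcal H)$ with some $C<\infty$, and $\|\Phi\|_{L_1\to L_\infty}$ is the smallest such $C$. For Hilbert spaces $\mathcal H_1,\mathcal H_2$,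 $\mathfrak{S}_{q,w}(\mathcal H_1,\mathcal H_2)$ is the space of compact operators $K:\mathcal H_1\to\mathcal H_2$ satisfying $\|K\|_{q,w}^q=\sup_{\kappa>0}\kappa^q\, n(\kappa,(K^*K)^{1/2})<\infty$, where $n(\kappa,(K^*K)^{1/2})$ denotes the number of eigenvalues of $(K^*K)^{1/2}$ larger than $\kappa$, counting multiplicities. *)

theory Defs
  imports "HOL-Analysis.Analysis" "HOL-Probability.Essential_Supremum"
begin

section \<open>Complex Hilbert spaces as types\<close>

text \<open>The inner product is antilinear in its first argument. Separability is the additional
  sort constraint \<open>second_countable_topology\<close>.\<close>

class complex_hilbert_space = banach +
  fixes scaleC :: "complex \<Rightarrow> 'a \<Rightarrow> 'a" (infixr "*\<^sub>C" 75)
    and cinner :: "'a \<Rightarrow> 'a \<Rightarrow> complex"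
  assumes scaleR_scaleC: "scaleR r x = complex_of_real r *\<^sub>C x"
    and scaleC_add_right: "c *\<^sub>C (x + y) = c *\<^sub>C x + c *\<^sub>C y"
    and scaleC_add_left: "(c + d) *\<^sub>C x = c *\<^sub>C x + d *\<^sub>C x"
    and scaleC_scaleC: "c *\<^sub>C d *\<^sub>C x = (c * d) *\<^sub>C x"
    and cinner_commute: "cinner x y = cnj (cinner y x)"
    and cinner_add_right: "cinner x (y + z) = cinner x y + cinner x z"
    and cinner_scaleC_right: "cinner x (c *\<^sub>C y) = c * cinner x y"
    and cinner_self: "cinner x x = complex_of_real ((norm x)\<^sup>2)"


section \<open>Hilbert spaces on carrier sets, and their operators\<close>

text \<open>The space \<open>L\<^sub>2\<close> depends on a measure and hence is not a type. Operator-theoretic notions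
  are therefore defined for Hilbert spaces given by a carrier and operations. An operator is a
  function whose values off the carrier are irrelevant; where an operator is defined by its unique
  characterization, it is made unique as a function by \<^const>\<open>extensional\<close>.\<close>

record 'v hspace =
  hcarrier :: "'v set"
  hadd :: "'v \<Rightarrow> 'v \<Rightarrow> 'v"
  hscale :: "complex \<Rightarrow> 'v \<Rightarrow> 'v"
  hinner :: "'v \<Rightarrow> 'v \<Rightarrow> complex"

definition type_hspace :: "'h::complex_hilbert_space hspace" where
  "type_hspace = \<lparr>hcarrier = UNIV, hadd = (+), hscale = scaleC, hinner = cinner\<rparr>"

definition hnorm :: "'v hspace \<Rightarrow> 'v \<Rightarrow> real" where
  "hnorm E x = sqrt (Re (hinner E x x))"

definition hdist :: "'v hspace \<Rightarrow> 'v \<Rightarrow> 'v \<Rightarrow> real" where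
  "hdist E x y = hnorm E (hadd E x (hscale E (-1) y))"

definition hdense :: "'v hspace \<Rightarrow> 'v set \<Rightarrow> bool" where
  "hdense E D \<longleftrightarrow> D \<subseteq> hcarrier E \<and> (\<forall>x\<in>hcarrier E. \<forall>\<epsilon>>0. \<exists>d\<in>D. hdist E x d < \<epsilon>)"

definition linear_op :: "'v hspace \<Rightarrow> 'w hspace \<Rightarrow> ('v \<Rightarrow> 'w) \<Rightarrow> bool" where
  "linear_op E F T \<longleftrightarrow>
     T \<in> hcarrier E \<rightarrow> hcarrier F \<and>
     (\<forall>x\<in>hcarrier E. \<forall>y\<in>hcarrier E. T (hadd E x y) = hadd F (T x) (T y)) \<and>
     (\<forall>c. \<forall>x\<in>hcarrier E. T (hscale E c x) = hscale F c (T x))"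

definition bounded_op :: "'v hspace \<Rightarrow> 'w hspace \<Rightarrow> ('v \<Rightarrow> 'w) \<Rightarrow> bool" where
  "bounded_op E F T \<longleftrightarrow>
     linear_op E F T \<and> (\<exists>B. \<forall>x\<in>hcarrier E. hnorm F (T x) \<le> B * hnorm E x)"

definition unitary_op :: "'v hspace \<Rightarrow> 'w hspace \<Rightarrow> ('v \<Rightarrow> 'w) \<Rightarrow> bool" where
  "unitary_op E F U \<longleftrightarrow>
     linear_op E F U \<and> U ` hcarrier E = hcarrier F \<and>
     (\<forall>x\<in>hcarrier E. \<forall>y\<in>hcarrier E. hinner F (U x) (U y) = hinner E x y)"

definition compact_op :: "'v hspace \<Rightarrow> 'w hspace \<Rightarrow> ('v \<Rightarrow> 'w) \<Rightarrow> bool" where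
  "compact_op E F T \<longleftrightarrow>
     bounded_op E F T \<and>
     (\<forall>x :: nat \<Rightarrow> 'v. (\<forall>n. x n \<in> hcarrier E) \<and> (\<exists>B. \<forall>n. hnorm E (x n) \<le> B) \<longrightarrow>
        (\<exists>r. strict_mono r \<and> (\<exists>y\<in>hcarrier F. (\<lambda>n. hdist F (T (x (r n))) y) \<longlonglongrightarrow> 0)))"

definition adjoint_op :: "'v hspace \<Rightarrow> 'w hspace \<Rightarrow> ('v \<Rightarrow> 'w) \<Rightarrow> 'w \<Rightarrow> 'v" where
  "adjoint_op E F T =
     (THE S. S \<in> extensional (hcarrier F) \<and> bounded_op F E S \<and>
       (\<forall>x\<in>hcarrier E. \<forall>y\<in>hcarrier F. hinner F (T x) y = hinner E x (S y)))"

text \<open>The power \<open>A\<^sup>s\<close>, \<open>s > 0\<close>, of a compact operator \<open>A \<ge> 0\<close> in the sense of the functional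
  calculus: as the eigenvectors of \<open>A\<close> span a dense subspace, it is the only bounded operator which
  acts as \<open>\<mu>\<^sup>s\<close> on the eigenspace of each eigenvalue \<open>\<mu>\<close>. The kernel is included, since
  \<open>0 powr s = 0\<close>.\<close>

definition powr_op :: "'v hspace \<Rightarrow> ('v \<Rightarrow> 'v) \<Rightarrow> real \<Rightarrow> 'v \<Rightarrow> 'v" where
  "powr_op E A s =
     (THE B. B \<in> extensional (hcarrier E) \<and> bounded_op E E B \<and>
       (\<forall>\<mu>\<ge>0. \<forall>x\<in>hcarrier E. A x = hscale E (complex_of_real \<mu>) x \<longrightarrow>
          B x = hscale E (complex_of_real (\<mu> powr s)) x))"

text \<open>\<open>(K\<^sup>*K)\<^sup>s\<close> for a compact operator \<open>K\<close>\<close>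

definition gram_powr :: "'v hspace \<Rightarrow> 'w hspace \<Rightarrow> ('v \<Rightarrow> 'w) \<Rightarrow> real \<Rightarrow> 'v \<Rightarrow> 'v" where
  "gram_powr E F K s = powr_op E (\<lambda>x. adjoint_op E F K (K x)) s"

definition orthonormal :: "'v hspace \<Rightarrow> 'v set \<Rightarrow> bool" where
  "orthonormal E S \<longleftrightarrow>
     S \<subseteq> hcarrier E \<and> (\<forall>x\<in>S. \<forall>y\<in>S. hinner E x y = (if x = y then 1 else 0))"

definition orthonormal_basis :: "'v hspace \<Rightarrow> 'v set \<Rightarrow> bool" where
  "orthonormal_basis E S \<longleftrightarrow>
     orthonormal E S \<and> (\<forall>x\<in>hcarrier E. (\<forall>e\<in>S. hinner E e x = 0) \<longrightarrow> hnorm E x = 0)"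

text \<open>Trace of a nonnegative operator, possibly infinite. It does not depend on the basis.\<close>

definition trace_op :: "'v hspace \<Rightarrow> ('v \<Rightarrow> 'v) \<Rightarrow> ennreal" where
  "trace_op E T =
     (let S = (SOME S. orthonormal_basis E S) in \<Sum>\<^sub>\<infinity>e\<in>S. ennreal (Re (hinner E e (T e))))"

text \<open>Dimension of a subspace, with value \<open>\<infinity>\<close> for every infinite dimension\<close>

definition hdim :: "'v hspace \<Rightarrow> 'v set \<Rightarrow> ennreal" where
  "hdim E V = (SUP S\<in>{S. finite S \<and> orthonormal E S \<and> S \<subseteq> V}. of_nat (card S))"

definition eigenspace :: "'v hspace \<Rightarrow> ('v \<Rightarrow> 'v) \<Rightarrow> real \<Rightarrow> 'v set" where
  "eigenspace E T \<mu> = {x \<in> hcarrier E. T x = hscale E (complex_of_real \<mu>) x}"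

text \<open>The number \<open>n(\<kappa>,T)\<close> of eigenvalues of a selfadjoint operator \<open>T\<close> that exceed \<open>\<kappa>\<close>, with
  multiplicities. Those \<open>\<mu>\<close> that are not eigenvalues contribute dimension zero.\<close>

definition eigenvalue_count :: "'v hspace \<Rightarrow> real \<Rightarrow> ('v \<Rightarrow> 'v) \<Rightarrow> ennreal" where
  "eigenvalue_count E \<kappa> T = (\<Sum>\<^sub>\<infinity>\<mu>\<in>{\<kappa><..}. hdim E (eigenspace E T \<mu>))"


section \<open>Schatten classes\<close>

definition ennpowr :: "ennreal \<Rightarrow> real \<Rightarrow> ennreal" where \<comment> \<open>for exponents \<open>p > 0\<close>\<close>
  "ennpowr x p = (if x = top then top else ennreal (enn2real x powr p))"

definition schatten_norm :: "real \<Rightarrow> 'v hspace \<Rightarrow> ('v \<Rightarrow> 'v) \<Rightarrow> ennreal" where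
  "schatten_norm q E K = ennpowr (trace_op E (gram_powr E E K (q / 2))) (1 / q)"

definition weak_schatten_norm :: "real \<Rightarrow> 'v hspace \<Rightarrow> 'w hspace \<Rightarrow> ('v \<Rightarrow> 'w) \<Rightarrow> ennreal" where
  "weak_schatten_norm q E F K =
     ennpowr (SUP \<kappa>\<in>{0<..}. ennreal (\<kappa> powr q) * eigenvalue_count E \<kappa> (gram_powr E F K (1 / 2)))
       (1 / q)"

definition weak_schatten :: "real \<Rightarrow> 'v hspace \<Rightarrow> 'w hspace \<Rightarrow> ('v \<Rightarrow> 'w) set" where
  "weak_schatten q E F = {K. compact_op E F K \<and> weak_schatten_norm q E F K < top}"


section \<open>The Hilbert space of square-integrable functions modulo equality almost everywhere\<close>

definition L2_fun :: "'x measure \<Rightarrow> ('x \<Rightarrow> 'h::complex_hilbert_space) set" where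
  "L2_fun M = {u \<in> borel_measurable M. (\<integral>\<^sup>+x. ennreal ((norm (u x))\<^sup>2) \<partial>M) < top}"

definition L2_rel :: "'x measure \<Rightarrow> (('x \<Rightarrow> 'h) \<times> ('x \<Rightarrow> 'h::complex_hilbert_space)) set" where
  "L2_rel M = {(u, v). u \<in> L2_fun M \<and> v \<in> L2_fun M \<and> (AE x in M. u x = v x)}"

definition L2_class :: "'x measure \<Rightarrow> ('x \<Rightarrow> 'h::complex_hilbert_space) \<Rightarrow> ('x \<Rightarrow> 'h) set" where
  "L2_class M u = L2_rel M `` {u}"

definition L2_rep :: "('x \<Rightarrow> 'h) set \<Rightarrow> 'x \<Rightarrow> 'h" where
  "L2_rep a = (SOME u. u \<in> a)"

definition L2 :: "'x measure \<Rightarrow> ('x \<Rightarrow> 'h::complex_hilbert_space) set hspace" where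
  "L2 M =
     \<lparr>hcarrier = L2_fun M // L2_rel M,
      hadd = (\<lambda>a b. L2_class M (\<lambda>x. L2_rep a x + L2_rep b x)),
      hscale = (\<lambda>c a. L2_class M (\<lambda>x. c *\<^sub>C L2_rep a x)),
      hinner = (\<lambda>a b. \<integral>x. cinner (L2_rep a x) (L2_rep b x) \<partial>M)\<rparr>"


section \<open>Boundedness from \<open>L\<^sub>1\<close> to \<open>L\<^sub>\<infinity>\<close>\<close>

definition L1_norm :: "'x measure \<Rightarrow> ('x \<Rightarrow> 'h::real_normed_vector) \<Rightarrow> ennreal" where
  "L1_norm M u = (\<integral>\<^sup>+x. ennreal (norm (u x)) \<partial>M)"

definition Linf_norm :: "'y measure \<Rightarrow> ('y \<Rightarrow> 'g::real_normed_vector) \<Rightarrow> ennreal" where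
  "Linf_norm N v = esssup N (\<lambda>y. ennreal (norm (v y)))"

definition L1_Linf_constants ::
  "'x measure \<Rightarrow> 'y measure \<Rightarrow>
   (('x \<Rightarrow> 'h::complex_hilbert_space) set \<Rightarrow> ('y \<Rightarrow> 'g::complex_hilbert_space) set) \<Rightarrow> real set"
  where
  "L1_Linf_constants M N \<Phi> =
     {C. 0 \<le> C \<and> (\<forall>u\<in>L2_fun M. L1_norm M u < top \<longrightarrow>
        Linf_norm N (L2_rep (\<Phi> (L2_class M u))) \<le> ennreal C * L1_norm M u)}"

definition L1_Linf_bounded ::
  "'x measure \<Rightarrow> 'y measure \<Rightarrow>
   (('x \<Rightarrow> 'h::complex_hilbert_space) set \<Rightarrow> ('y \<Rightarrow> 'g::complex_hilbert_space) set) \<Rightarrow> bool"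
  where
  "L1_Linf_bounded M N \<Phi> \<longleftrightarrow> L1_Linf_constants M N \<Phi> \<noteq> {}"

definition L1_Linf_norm ::
  "'x measure \<Rightarrow> 'y measure \<Rightarrow>
   (('x \<Rightarrow> 'h::complex_hilbert_space) set \<Rightarrow> ('y \<Rightarrow> 'g::complex_hilbert_space) set) \<Rightarrow> real"
  where
  "L1_Linf_norm M N \<Phi> = Inf (L1_Linf_constants M N \<Phi>)"


section \<open>Operator-valued functions\<close>

text \<open>Measurability is meant in the strong operator topology. For values in the compact operators on
  a separable space it coincides with measurability with respect to the norm.\<close>

definition op_measurable ::
  "'x measure \<Rightarrow> ('x \<Rightarrow> 'h \<Rightarrow> 'h::complex_hilbert_space) \<Rightarrow> bool" where
  "op_measurable M f \<longleftrightarrow> (\<forall>h. (\<lambda>x. f x h) \<in> borel_measurable M)"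

definition Lq_schatten_norm ::
  "real \<Rightarrow> 'x measure \<Rightarrow> ('x \<Rightarrow> 'h \<Rightarrow> 'h::complex_hilbert_space) \<Rightarrow> ennreal" where
  "Lq_schatten_norm q M f =
     ennpowr (\<integral>\<^sup>+x. ennpowr (schatten_norm q type_hspace (f x)) q \<partial>M) (1 / q)"

definition Lq_schatten ::
  "real \<Rightarrow> 'x measure \<Rightarrow> ('x \<Rightarrow> 'h \<Rightarrow> 'h::complex_hilbert_space) set" where
  "Lq_schatten q M =
     {f. op_measurable M f \<and> (\<forall>x\<in>space M. compact_op type_hspace type_hspace (f x)) \<and>
         Lq_schatten_norm q M f < top}"

definition weak_Lq_norm ::
  "real \<Rightarrow> 'y measure \<Rightarrow> ('y \<Rightarrow> 'g \<Rightarrow> 'g::complex_hilbert_space) \<Rightarrow> ennreal" where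
  "weak_Lq_norm q N g =
     ennpowr (SUP \<tau>\<in>{0<..}. ennreal (\<tau> powr q) * emeasure N {y \<in> space N. onorm (g y) > \<tau>})
       (1 / q)"

definition weak_Lq ::
  "real \<Rightarrow> 'y measure \<Rightarrow> ('y \<Rightarrow> 'g \<Rightarrow> 'g::complex_hilbert_space) set" where
  "weak_Lq q N =
     {g. op_measurable N g \<and> (\<forall>y\<in>space N. bounded_op type_hspace type_hspace (g y)) \<and>
         weak_Lq_norm q N g < top}"

text \<open>Pointwise multiplication by \<open>f\<close>, as a possibly unbounded operator on its maximal domain\<close>

definition mult_dom ::
  "'x measure \<Rightarrow> ('x \<Rightarrow> 'h \<Rightarrow> 'h::complex_hilbert_space) \<Rightarrow> ('x \<Rightarrow> 'h) set set" where
  "mult_dom M f = {a \<in> hcarrier (L2 M). (\<lambda>x. f x (L2_rep a x)) \<in> L2_fun M}"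

definition mult_op ::
  "'x measure \<Rightarrow> ('x \<Rightarrow> 'h \<Rightarrow> 'h::complex_hilbert_space) \<Rightarrow> ('x \<Rightarrow> 'h) set \<Rightarrow> ('x \<Rightarrow> 'h) set" where
  "mult_op M f a = L2_class M (\<lambda>x. f x (L2_rep a x))"

text \<open>The product \<open>f \<Phi>\<^sup>* g\<close> on its maximal domain\<close>

definition sandwich_dom ::
  "'x measure \<Rightarrow> 'y measure \<Rightarrow>
   (('x \<Rightarrow> 'h::complex_hilbert_space) set \<Rightarrow> ('y \<Rightarrow> 'g::complex_hilbert_space) set) \<Rightarrow>
   ('x \<Rightarrow> 'h \<Rightarrow> 'h) \<Rightarrow> ('y \<Rightarrow> 'g \<Rightarrow> 'g) \<Rightarrow> ('y \<Rightarrow> 'g) set set" where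
  "sandwich_dom M N \<Phi> f g =
     {v \<in> mult_dom N g. adjoint_op (L2 M) (L2 N) \<Phi> (mult_op N g v) \<in> mult_dom M f}"

definition sandwich_op ::
  "'x measure \<Rightarrow> 'y measure \<Rightarrow>
   (('x \<Rightarrow> 'h::complex_hilbert_space) set \<Rightarrow> ('y \<Rightarrow> 'g::complex_hilbert_space) set) \<Rightarrow>
   ('x \<Rightarrow> 'h \<Rightarrow> 'h) \<Rightarrow> ('y \<Rightarrow> 'g \<Rightarrow> 'g) \<Rightarrow> ('y \<Rightarrow> 'g) set \<Rightarrow> ('x \<Rightarrow> 'h) set" where
  "sandwich_op M N \<Phi> f g v = mult_op M f (adjoint_op (L2 M) (L2 N) \<Phi> (mult_op N g v))"

text \<open>\<open>K\<close> is the bounded operator denoted by \<open>f \<Phi>\<^sup>* g\<close>: the product is densely defined and \<open>K\<close> is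
  its bounded extension, which by density is unique on the carrier of \<open>L\<^sub>2\<close>.\<close>

definition is_sandwich ::
  "'x measure \<Rightarrow> 'y measure \<Rightarrow>
   (('x \<Rightarrow> 'h::complex_hilbert_space) set \<Rightarrow> ('y \<Rightarrow> 'g::complex_hilbert_space) set) \<Rightarrow>
   ('x \<Rightarrow> 'h \<Rightarrow> 'h) \<Rightarrow> ('y \<Rightarrow> 'g \<Rightarrow> 'g) \<Rightarrow> (('y \<Rightarrow> 'g) set \<Rightarrow> ('x \<Rightarrow> 'h) set) \<Rightarrow> bool" where
  "is_sandwich M N \<Phi> f g K \<longleftrightarrow>
     hdense (L2 N) (sandwich_dom M N \<Phi> f g) \<and> bounded_op (L2 N) (L2 M) K \<and>
     (\<forall>v\<in>sandwich_dom M N \<Phi> f g. K v = sandwich_op M N \<Phi> f g v)"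

end

theory Submission
  imports Defs "HOL-Library.Diagonal_Subsequence"
begin

text \<open>The argument is Rumin's. Let \<open>v\<^sub>1, \<dots>, v\<^sub>n\<close> be orthonormal with \<open>\<parallel>f \<Phi>\<^sup>* g v\<^sub>j\<parallel> > \<kappa>\<close>, and put
  \<open>u\<^sub>j = \<Phi>\<^sup>* g v\<^sub>j\<close>. For a level \<open>E > 0\<close> split \<open>g\<close> into its parts on \<open>|g|\<^sup>2 \<le> 1/E\<close> and on
  \<open>|g|\<^sup>2 > 1/E\<close>, and \<open>u\<^sub>j = a\<^sub>j + b\<^sub>j\<close> accordingly. Since \<open>\<Phi>\<^sup>*\<close> is unitary, the sum over \<open>j\<close> of the
  integral of \<open>\<parallel>a\<^sub>j\<parallel>\<^sup>2\<close> over all levels is at most \<open>n\<close>. Since \<open>\<Phi>\<^sup>*\<close> maps \<open>L\<^sub>1\<close> to \<open>L\<^sub>\<infinity>\<close> and \<open>g\<close> is in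
  weak \<open>L\<^sub>q\<close>, the sum over \<open>j\<close> of \<open>|\<langle>e, b\<^sub>j(x)\<rangle>|\<^sup>2\<close>, where \<open>|e| = 1\<close>, is at most a constant times
  \<open>E\<close> to the power \<open>q/2 - 1\<close>. For an eigenvector \<open>e\<close> of \<open>f(x)\<^sup>*f(x)\<close> with eigenvalue \<open>\<sigma>\<close> one averages
  \<open>|\<langle>e, u\<^sub>j\<rangle>|\<^sup>2 \<le> (1 + d) |\<langle>e, a\<^sub>j\<rangle>|\<^sup>2 + (1 + 1/d) |\<langle>e, b\<^sub>j\<rangle>|\<^sup>2\<close> over the levels \<open>E < l \<sigma>\<close>; summation over \<open>e\<close>
  and integration over \<open>x\<close> bound \<open>n \<kappa>\<^sup>2\<close>, and optimizing over \<open>d\<close> and \<open>l\<close> gives the constant. To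
  avoid measurability in the level, the levels run through the multiples of a mesh size \<open>h\<close>, which
  tends to zero at the end.\<close>

section \<open>Hilbert spaces on carrier sets\<close>

text \<open>Unbounded \<open>f\<close> and \<open>g\<close> make f \<Phi>^* g only densely defined,
  so boundedness has to come out of the estimate that counts eigenvalues. With n = 1 it bounds the
  product on the domain of \<open>g\<close>; for general n it bounds the size of orthonormal
  families on which the extension exceeds \<kappa>, and this gives both compactness and the weak
  norm. Members of such a family may lie outside the domain of \<open>g\<close> and are truncated
  where |g| is large. Truncation destroys orthonormality, so the estimate asks only that c |-> sum
  c_j v_j be a contraction. The family has to be treated jointly: the L_1 to L_\<infinity> bound
  applied to all combinations controls the sum of |<e, b_j(x)>|^2 independently of n. With r =
  q/(q-2), the weak L_q tail contributes one factor r and l^(q/2-1) contributes r^(q-2)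
  \<kappa>^(2-q). The term n (1+d)/l = n \<kappa>^2/r is absorbed on the left, leaving the factor 1
  - 1/r = 2/q, whence the q/2 of the constant.\<close>

locale hilbert =
  fixes E :: "'v hspace"
  assumes carrier_nonempty: "hcarrier E \<noteq> {}"
    and add_closed [simp]: "\<lbrakk>x \<in> hcarrier E; y \<in> hcarrier E\<rbrakk> \<Longrightarrow> hadd E x y \<in> hcarrier E"
    and scale_closed [simp]: "x \<in> hcarrier E \<Longrightarrow> hscale E c x \<in> hcarrier E"
    and inner_commute: "\<lbrakk>x \<in> hcarrier E; y \<in> hcarrier E\<rbrakk> \<Longrightarrow> hinner E x y = cnj (hinner E y x)"
    and inner_add_right: "\<lbrakk>x \<in> hcarrier E; y \<in> hcarrier E; z \<in> hcarrier E\<rbrakk>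
      \<Longrightarrow> hinner E x (hadd E y z) = hinner E x y + hinner E x z"
    and inner_scale_right: "\<lbrakk>x \<in> hcarrier E; y \<in> hcarrier E\<rbrakk>
      \<Longrightarrow> hinner E x (hscale E c y) = c * hinner E x y"
    and inner_self_nonneg: "x \<in> hcarrier E \<Longrightarrow> 0 \<le> Re (hinner E x x)"
    and dist_eq_0: "\<lbrakk>x \<in> hcarrier E; y \<in> hcarrier E; hdist E x y = 0\<rbrakk> \<Longrightarrow> x = y"
    and complete: "\<lbrakk>\<And>n. s n \<in> hcarrier E;
        \<And>e. 0 < e \<Longrightarrow> \<exists>k::nat. \<forall>m\<ge>k. \<forall>n\<ge>k. hdist E (s m) (s n) < e\<rbrakk>
      \<Longrightarrow> \<exists>l\<in>hcarrier E. (\<lambda>n. hdist E (s n) l) \<longlonglongrightarrow> 0"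
begin

abbreviation V where "V \<equiv> hcarrier E"

text \<open>The record has no zero vector. The zero multiple of an arbitrary carrier element serves;
  its inner products all vanish, which determines it.\<close>

definition hzero where "hzero = hscale E 0 (SOME x. x \<in> V)"

lemma zero_closed [simp]: "hzero \<in> V"
  unfolding hzero_def by (meson carrier_nonempty ex_in_conv scale_closed someI_ex)

lemma inner_add_left:
  "\<lbrakk>x \<in> V; y \<in> V; z \<in> V\<rbrakk> \<Longrightarrow> hinner E (hadd E x y) z = hinner E x z + hinner E y z"
  by (metis add_closed complex_cnj_add inner_add_right inner_commute)

lemma inner_scale_left:
  "\<lbrakk>x \<in> V; z \<in> V\<rbrakk> \<Longrightarrow> hinner E (hscale E c x) z = cnj c * hinner E x z"
  by (metis complex_cnj_mult inner_commute inner_scale_right scale_closed)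

lemma inner_zero_right [simp]: "x \<in> V \<Longrightarrow> hinner E x hzero = 0"
  unfolding hzero_def
  by (metis carrier_nonempty ex_in_conv inner_scale_right mult_zero_left someI_ex)

lemma inner_zero_left [simp]: "x \<in> V \<Longrightarrow> hinner E hzero x = 0"
  using inner_commute[of hzero x] by simp

lemmas ip_simps = inner_add_left inner_add_right inner_scale_left inner_scale_right

lemma norm_nonneg [simp]: "x \<in> V \<Longrightarrow> 0 \<le> hnorm E x"
  by (simp add: hnorm_def inner_self_nonneg)

lemma norm_sq: "x \<in> V \<Longrightarrow> (hnorm E x)\<^sup>2 = Re (hinner E x x)"
  by (simp add: hnorm_def inner_self_nonneg)

lemma inner_self: "x \<in> V \<Longrightarrow> hinner E x x = complex_of_real ((hnorm E x)\<^sup>2)"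
  using inner_commute[of x x] by (simp add: complex_eq_iff norm_sq)

lemma Re_inner_commute: "\<lbrakk>x \<in> V; y \<in> V\<rbrakk> \<Longrightarrow> Re (hinner E y x) = Re (hinner E x y)"
  using inner_commute[of x y] by simp

lemma cmod_inner_commute: "\<lbrakk>x \<in> V; y \<in> V\<rbrakk> \<Longrightarrow> cmod (hinner E y x) = cmod (hinner E x y)"
  using inner_commute[of x y] by simp

lemma norm_sq_add: "\<lbrakk>x \<in> V; y \<in> V\<rbrakk> \<Longrightarrow>
    (hnorm E (hadd E x y))\<^sup>2 = (hnorm E x)\<^sup>2 + 2 * Re (hinner E x y) + (hnorm E y)\<^sup>2"
  using Re_inner_commute[of x y] by (simp add: norm_sq ip_simps)

lemma norm_scale [simp]: "x \<in> V \<Longrightarrow> hnorm E (hscale E c x) = cmod c * hnorm E x"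
proof -
  assume x: "x \<in> V"
  have "c * (cnj c * hinner E x x) = complex_of_real ((cmod c)\<^sup>2) * hinner E x x"
    by (simp only: complex_norm_square mult.assoc)
  hence "hinner E (hscale E c x) (hscale E c x) = complex_of_real ((cmod c * hnorm E x)\<^sup>2)"
    using x by (simp add: inner_scale_left inner_scale_right inner_self[OF x] power_mult_distrib)
  thus ?thesis
    using x by (simp add: hnorm_def[of E "hscale E c x"])
qed

lemma norm_zero [simp]: "hnorm E hzero = 0"
  by (simp add: hnorm_def)

lemma norm_sq_sub: "\<lbrakk>x \<in> V; y \<in> V\<rbrakk> \<Longrightarrow>
    (hdist E x y)\<^sup>2 = (hnorm E x)\<^sup>2 - 2 * Re (hinner E x y) + (hnorm E y)\<^sup>2"
  by (simp add: hdist_def norm_sq_add ip_simps)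

lemma norm_eq_0: "\<lbrakk>x \<in> V; hnorm E x = 0\<rbrakk> \<Longrightarrow> x = hzero"
  using norm_sq_sub[of x hzero] by (intro dist_eq_0) auto

text \<open>The locale lists no vector space axioms. Algebraic laws such as composition of scalars
  are obtained by testing with inner products: applied to x - y itself, equal inner products give
  distance 0, and \<open>dist_eq_0\<close> gives equality.\<close>

lemma vec_eqI:
  assumes "x \<in> V" "y \<in> V" "\<And>z. z \<in> V \<Longrightarrow> hinner E z x = hinner E z y"
  shows "x = y"
proof (rule dist_eq_0)
  have "hinner E (hadd E x (hscale E (-1) y)) (hadd E x (hscale E (-1) y)) = 0"
    using assms by (subst inner_add_right) (auto simp: inner_scale_right)
  thus "hdist E x y = 0" by (simp add: hdist_def hnorm_def)
qed (use assms in auto)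

lemma vec_eqI_left:
  assumes "x \<in> V" "y \<in> V" "\<And>z. z \<in> V \<Longrightarrow> hinner E x z = hinner E y z"
  shows "x = y"
  using assms inner_commute[of _ x] inner_commute[of _ y] by (intro vec_eqI) auto

lemma cauchy_schwarz:
  assumes "x \<in> V" "y \<in> V"
  shows "cmod (hinner E x y) \<le> hnorm E x * hnorm E y"
proof (cases "hnorm E x = 0")
  case True
  thus ?thesis using assms norm_eq_0[of x] by simp
next
  case False
  define a where "a = (hnorm E x)\<^sup>2"
  define b where "b = hinner E x y"
  have a: "a > 0" using False by (simp add: a_def)
  have bb: "b * cnj b = complex_of_real ((cmod b)\<^sup>2)"
    by (rule complex_norm_square[symmetric])
  \<comment> \<open>The component of y orthogonal to x, multiplied by a = |x|^2 to clear the
    denominator.\<close>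
  let ?z = "hadd E (hscale E (of_real a) y) (hscale E (- b) x)"
  have yx: "hinner E y x = cnj b" using assms inner_commute[of y x] by (simp add: b_def)
  have sx: "hinner E x x = complex_of_real a" and sy: "hinner E y y = complex_of_real ((hnorm E y)\<^sup>2)"
    using assms inner_self by (auto simp: a_def)
  have "hinner E ?z ?z = complex_of_real a * (complex_of_real a * hinner E y y) -
      complex_of_real a * (b * cnj b)"
    using assms by (simp add: ip_simps yx sx flip: b_def) (simp add: algebra_simps)
  hence "hinner E ?z ?z = complex_of_real (a * (a * (hnorm E y)\<^sup>2 - (cmod b)\<^sup>2))"
    by (simp add: bb sy right_diff_distrib)
  moreover have "0 \<le> Re (hinner E ?z ?z)" using assms by (intro inner_self_nonneg) auto
  ultimately have "0 \<le> a * (a * (hnorm E y)\<^sup>2 - (cmod b)\<^sup>2)" by simp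
  hence "(cmod b)\<^sup>2 \<le> (hnorm E x * hnorm E y)\<^sup>2"
    using a by (simp add: zero_le_mult_iff a_def power_mult_distrib)
  hence "cmod b \<le> hnorm E x * hnorm E y"
    by (rule power2_le_imp_le) (use assms in simp)
  thus ?thesis by (simp only: b_def)
qed

lemma norm_triangle:
  assumes "x \<in> V" "y \<in> V"
  shows "hnorm E (hadd E x y) \<le> hnorm E x + hnorm E y"
proof (rule power2_le_imp_le)
  have "Re (hinner E x y) \<le> hnorm E x * hnorm E y"
    using cauchy_schwarz[OF assms] complex_Re_le_cmod[of "hinner E x y"] by linarith
  thus "(hnorm E (hadd E x y))\<^sup>2 \<le> (hnorm E x + hnorm E y)\<^sup>2"
    using assms by (simp add: norm_sq_add power2_sum)
qed (use assms in auto)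

lemma dist_nonneg [simp]: "\<lbrakk>x \<in> V; y \<in> V\<rbrakk> \<Longrightarrow> 0 \<le> hdist E x y"
  by (simp add: hdist_def)

lemma dist_commute: "\<lbrakk>x \<in> V; y \<in> V\<rbrakk> \<Longrightarrow> hdist E x y = hdist E y x"
  by (rule power2_eq_imp_eq) (auto simp: norm_sq_sub Re_inner_commute)

lemma dist_triangle:
  assumes "x \<in> V" "y \<in> V" "z \<in> V"
  shows "hdist E x z \<le> hdist E x y + hdist E y z"
proof -
  have "hadd E x (hscale E (-1) z) =
      hadd E (hadd E x (hscale E (-1) y)) (hadd E y (hscale E (-1) z))"
    using assms by (intro vec_eqI) (auto simp: ip_simps)
  thus ?thesis using assms by (simp add: hdist_def norm_triangle)
qed

lemma dist_zero_right: "x \<in> V \<Longrightarrow> hdist E x hzero = hnorm E x"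
  by (rule power2_eq_imp_eq) (auto simp: norm_sq_sub)

lemma norm_le_dist: "\<lbrakk>x \<in> V; y \<in> V\<rbrakk> \<Longrightarrow> hnorm E x \<le> hnorm E y + hdist E x y"
  using dist_triangle[of x y hzero] by (simp add: dist_zero_right)

lemma inner_diff_le:
  assumes "x \<in> V" "y \<in> V" "z \<in> V"
  shows "cmod (hinner E z x - hinner E z y) \<le> hnorm E z * hdist E x y"
  using cauchy_schwarz[of z "hadd E x (hscale E (-1) y)"] assms by (simp add: ip_simps hdist_def)

lemma tendsto_inner_right:
  assumes "\<And>n. s n \<in> V" "l \<in> V" "z \<in> V" "(\<lambda>n. hdist E (s n) l) \<longlonglongrightarrow> 0"
  shows "(\<lambda>n. hinner E z (s n)) \<longlonglongrightarrow> hinner E z l"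
proof (rule Lim_transform_bound[THEN LIM_zero_cancel])
  show "\<forall>\<^sub>F n in sequentially. norm (hinner E z (s n) - hinner E z l) \<le> norm (hnorm E z * hdist E (s n) l)"
    using inner_diff_le[of "s _" l z] assms
    by (intro always_eventually) (auto intro: order_trans[OF _ abs_ge_self])
  show "(\<lambda>n. hnorm E z * hdist E (s n) l) \<longlonglongrightarrow> 0"
    using tendsto_mult_left[OF assms(4), of "hnorm E z"] by simp
qed

lemma tendsto_norm:
  assumes "\<And>n. s n \<in> V" "l \<in> V" "(\<lambda>n. hdist E (s n) l) \<longlonglongrightarrow> 0"
  shows "(\<lambda>n. hnorm E (s n)) \<longlonglongrightarrow> hnorm E l"
proof (rule Lim_transform_bound[THEN LIM_zero_cancel, OF _ assms(3)])
  have "\<bar>hnorm E (s n) - hnorm E l\<bar> \<le> hdist E (s n) l" for n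
    using norm_le_dist[of "s n" l] norm_le_dist[of l "s n"] assms dist_commute[of l "s n"] by force
  thus "\<forall>\<^sub>F n in sequentially. norm (hnorm E (s n) - hnorm E l) \<le> norm (hdist E (s n) l)"
    by (intro always_eventually) (auto intro: order_trans[OF _ abs_ge_self])
qed

text \<open>The representing vector is the limit of a minimizing sequence for
  \<open>x \<mapsto> \<parallel>x\<parallel>\<^sup>2 - 2 Re (\<phi> x)\<close>, which is Cauchy by the parallelogram law.\<close>

lemma riesz:
  assumes add: "\<And>x y. \<lbrakk>x \<in> V; y \<in> V\<rbrakk> \<Longrightarrow> \<phi> (hadd E x y) = \<phi> x + \<phi> y"
    and scale: "\<And>c x. x \<in> V \<Longrightarrow> \<phi> (hscale E c x) = c * \<phi> x"
    and bound: "\<And>x. x \<in> V \<Longrightarrow> cmod (\<phi> x) \<le> B * hnorm E x"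
  shows "\<exists>z\<in>V. \<forall>x\<in>V. \<phi> x = hinner E z x"
proof -
  define J where "J x = (hnorm E x)\<^sup>2 - 2 * Re (\<phi> x)" for x
  have Jb: "- B\<^sup>2 \<le> J x" if "x \<in> V" for x
  proof -
    have "Re (\<phi> x) \<le> B * hnorm E x"
      using bound[OF that] complex_Re_le_cmod[of "\<phi> x"] by linarith
    moreover have "0 \<le> (hnorm E x - B)\<^sup>2" by simp
    ultimately show ?thesis by (simp add: J_def power2_diff algebra_simps)
  qed
  define m where "m = (INF x\<in>V. J x)"
  have bdd: "bdd_below (J ` V)" using Jb by (auto intro!: bdd_belowI)
  have mle: "m \<le> J x" if "x \<in> V" for x
    unfolding m_def using that bdd by (rule cINF_lower[rotated])
  have "\<exists>x\<in>V. J x < m + inverse (real (Suc n))" for n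
  proof -
    have "Inf (J ` V) < m + inverse (real (Suc n))" by (simp add: m_def)
    thus ?thesis using carrier_nonempty bdd by (subst (asm) cInf_less_iff) auto
  qed
  then obtain s where s: "\<And>n. s n \<in> V" "\<And>n. J (s n) < m + inverse (real (Suc n))"
    by metis
  \<comment> \<open>The linear part of J cancels, so J inherits the parallelogram law of the norm.
    Since J is at least m at the midpoint, the distance is controlled by the excess of J x and J y
    over m.\<close>
  have par: "(hdist E x y)\<^sup>2 = 2 * J x + 2 * J y - 4 * J (hscale E (1/2) (hadd E x y))"
    if "x \<in> V" "y \<in> V" for x y
  proof -
    have "(hnorm E (hscale E (1/2) (hadd E x y)))\<^sup>2 = (hnorm E (hadd E x y))\<^sup>2 / 4"
      using that by (simp add: power_divide norm_divide)
    thus ?thesis using that by (simp add: J_def norm_sq_sub add scale norm_sq_add algebra_simps)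
  qed
  have "\<exists>l\<in>V. (\<lambda>n. hdist E (s n) l) \<longlonglongrightarrow> 0"
  proof (rule complete)
    fix e :: real assume e: "0 < e"
    obtain k where k: "inverse (real (Suc k)) < e\<^sup>2 / 4"
      using reals_Archimedean[of "e\<^sup>2 / 4"] e by auto
    have "hdist E (s a) (s b) < e" if ab: "a \<ge> k" "b \<ge> k" for a b
    proof (rule power2_less_imp_less)
      have "inverse (real (Suc a)) \<le> inverse (real (Suc k))" "inverse (real (Suc b)) \<le> inverse (real (Suc k))"
        using ab by (auto intro!: le_imp_inverse_le)
      moreover have "m \<le> J (hscale E (1/2) (hadd E (s a) (s b)))"
        using s(1) by (intro mle) simp
      ultimately show "(hdist E (s a) (s b))\<^sup>2 < e\<^sup>2"
        using par[OF s(1) s(1), of a b] s(2)[of a] s(2)[of b] k by linarith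
    qed (use e in auto)
    thus "\<exists>k. \<forall>m\<ge>k. \<forall>n\<ge>k. hdist E (s m) (s n) < e" by blast
  qed (rule s)
  then obtain z where z: "z \<in> V" "(\<lambda>n. hdist E (s n) z) \<longlonglongrightarrow> 0" by blast
  have re: "Re (hinner E z x) = Re (\<phi> x)" if x: "x \<in> V" for x
  proof -
    define d where "d n = Re (hinner E x (s n)) - Re (\<phi> x)" for n
    \<comment> \<open>First variation at an approximate minimizer: J (s n) exceeds m by less than
      1/(n+1), so this quadratic in t is nonnegative up to that error.\<close>
    have var: "0 \<le> t\<^sup>2 * (hnorm E x)\<^sup>2 + 2 * t * d n + inverse (real (Suc n))" for t n
    proof -
      have "J (hadd E (s n) (hscale E (of_real t) x)) =
          J (s n) + t\<^sup>2 * (hnorm E x)\<^sup>2 + 2 * t * d n"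
        using s(1)[of n] x
        by (simp add: J_def norm_sq_add add scale ip_simps d_def Re_inner_commute power_mult_distrib algebra_simps)
      thus ?thesis using mle[of "hadd E (s n) (hscale E (of_real t) x)"] s[of n] x by simp
    qed
    \<comment> \<open>The added 1 lets the step t = -d n / N be taken also when x has norm
      0.\<close>
    define N where "N = (hnorm E x)\<^sup>2 + 1"
    have N: "N > 0" by (simp add: N_def add_nonneg_pos)
    have "(d n)\<^sup>2 \<le> N * inverse (real (Suc n))" for n
    proof -
      have "0 \<le> (d n / N)\<^sup>2 * (hnorm E x)\<^sup>2 - 2 * (d n / N) * d n + inverse (real (Suc n))"
        using var[of "- (d n / N)" n] by simp
      also have "\<dots> \<le> (d n / N)\<^sup>2 * N - 2 * (d n / N) * d n + inverse (real (Suc n))"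
        by (simp add: N_def mult_left_mono)
      also have "\<dots> = inverse (real (Suc n)) - (d n)\<^sup>2 / N"
        using N by (simp add: field_simps power2_eq_square)
      finally have "(d n)\<^sup>2 / N \<le> inverse (real (Suc n))" by simp
      thus ?thesis using N by (simp only: pos_divide_le_eq mult.commute)
    qed
    moreover have "(\<lambda>n. N * inverse (real (Suc n))) \<longlonglongrightarrow> N * 0"
      by (intro tendsto_mult_left LIMSEQ_inverse_real_of_nat)
    ultimately have "(\<lambda>n. (d n)\<^sup>2) \<longlonglongrightarrow> 0"
      by (intro tendsto_sandwich[of "\<lambda>_. 0" "\<lambda>n. (d n)\<^sup>2" _ "\<lambda>n. N * inverse (real (Suc n))" 0]) auto
    moreover have "d \<longlonglongrightarrow> Re (hinner E x z) - Re (\<phi> x)"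
      unfolding d_def
      by (rule tendsto_diff[OF tendsto_Re[OF tendsto_inner_right[OF s(1) z(1) x z(2)]] tendsto_const])
    hence "(\<lambda>n. (d n)\<^sup>2) \<longlonglongrightarrow> (Re (hinner E x z) - Re (\<phi> x))\<^sup>2"
      by (rule tendsto_power)
    ultimately have "(Re (hinner E x z) - Re (\<phi> x))\<^sup>2 = 0" using LIMSEQ_unique by blast
    thus ?thesis using Re_inner_commute[OF x z(1)] by simp
  qed
  have "\<phi> x = hinner E z x" if x: "x \<in> V" for x
  proof (rule complex_eqI)
    \<comment> \<open>Real parts agree at all vectors; at -i x they are the imaginary parts at
      x.\<close>
    have "Re (- \<i> * \<phi> x) = Re (- \<i> * hinner E z x)"
      using re[of "hscale E (-\<i>) x"] x z by (simp only: scale scale_closed inner_scale_right)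
    thus "Im (\<phi> x) = Im (hinner E z x)" by simp
  qed (simp add: re x)
  thus ?thesis using z by blast
qed

end

section \<open>Adjoints and the Bessel inequality\<close>

lemma linear_op_closed: "\<lbrakk>linear_op E F T; x \<in> hcarrier E\<rbrakk> \<Longrightarrow> T x \<in> hcarrier F"
  by (auto simp: linear_op_def)

lemma linear_op_add:
  "\<lbrakk>linear_op E F T; x \<in> hcarrier E; y \<in> hcarrier E\<rbrakk> \<Longrightarrow> T (hadd E x y) = hadd F (T x) (T y)"
  by (auto simp: linear_op_def)

lemma linear_op_scale:
  "\<lbrakk>linear_op E F T; x \<in> hcarrier E\<rbrakk> \<Longrightarrow> T (hscale E c x) = hscale F c (T x)"
  by (auto simp: linear_op_def)

lemma bounded_op_linear: "bounded_op E F T \<Longrightarrow> linear_op E F T"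
  by (simp add: bounded_op_def)

lemma orthonormal_subset: "\<lbrakk>orthonormal E S; T \<subseteq> S\<rbrakk> \<Longrightarrow> orthonormal E T"
  unfolding orthonormal_def by blast

lemma orthonormal_carrier: "\<lbrakk>orthonormal E S; e \<in> S\<rbrakk> \<Longrightarrow> e \<in> hcarrier E"
  by (auto simp: orthonormal_def)

lemma infsum_eq_single:
  fixes f :: "'a \<Rightarrow> 'b::{comm_monoid_add, t2_space}"
  assumes "i \<in> A" "\<And>j. j \<in> A \<Longrightarrow> j \<noteq> i \<Longrightarrow> f j = 0"
  shows "infsum f A = f i"
proof -
  have "infsum f A = infsum f {i}"
    using assms by (intro infsum_cong_neutral) auto
  thus ?thesis by simp
qed

lemma Cauchy_Schwarz_sum_le:
  fixes a b :: "'a \<Rightarrow> real"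
  assumes "\<And>i. i \<in> I \<Longrightarrow> 0 \<le> a i" "\<And>i. i \<in> I \<Longrightarrow> 0 \<le> b i"
    and "(\<Sum>i\<in>I. (a i)\<^sup>2) \<le> A\<^sup>2" "(\<Sum>i\<in>I. (b i)\<^sup>2) \<le> B\<^sup>2" "0 \<le> A" "0 \<le> B"
  shows "(\<Sum>i\<in>I. a i * b i) \<le> A * B"
proof (rule power2_le_imp_le)
  have "(\<Sum>i\<in>I. a i * b i)\<^sup>2 \<le> (\<Sum>i\<in>I. (a i)\<^sup>2) * (\<Sum>i\<in>I. (b i)\<^sup>2)"
    by (rule Cauchy_Schwarz_ineq_sum)
  also have "\<dots> \<le> A\<^sup>2 * B\<^sup>2" using assms by (intro mult_mono) (auto intro: sum_nonneg)
  finally show "(\<Sum>i\<in>I. a i * b i)\<^sup>2 \<le> (A * B)\<^sup>2" by (simp add: power_mult_distrib)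
qed (use assms in auto)

locale hilbert_pair = E: hilbert E + F: hilbert F
  for E :: "'v hspace" and F :: "'w hspace"
begin

lemma bounded_op_bound:
  assumes "bounded_op E F T"
  obtains B where "0 \<le> B" "\<And>x. x \<in> hcarrier E \<Longrightarrow> hnorm F (T x) \<le> B * hnorm E x"
proof -
  obtain B where B: "\<And>x. x \<in> hcarrier E \<Longrightarrow> hnorm F (T x) \<le> B * hnorm E x"
    using assms by (auto simp: bounded_op_def)
  have "hnorm F (T x) \<le> max B 0 * hnorm E x" if "x \<in> hcarrier E" for x
    using B[OF that] mult_right_mono[OF max.cobounded1[of B 0] E.norm_nonneg[OF that]] by linarith
  thus ?thesis using that[of "max B 0"] by simp
qed

lemma linear_dist:
  assumes "linear_op E F T" "x \<in> hcarrier E" "y \<in> hcarrier E"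
  shows "hdist F (T x) (T y) = hnorm F (T (hadd E x (hscale E (-1) y)))"
  using assms by (simp add: hdist_def linear_op_add linear_op_scale)

text \<open>For fixed y the form is a bounded functional of x, represented by a vector S y;
  uniqueness of that vector makes S linear. Adjoints and diagonal operators both arise in this way,
  so no convergence of series of vectors has to be discussed.\<close>

lemma sesquilinear_form_op:
  assumes add_right: "\<And>y x x'. \<lbrakk>y \<in> hcarrier E; x \<in> hcarrier F; x' \<in> hcarrier F\<rbrakk>
      \<Longrightarrow> \<beta> y (hadd F x x') = \<beta> y x + \<beta> y x'"
    and scale_right: "\<And>c y x. \<lbrakk>y \<in> hcarrier E; x \<in> hcarrier F\<rbrakk> \<Longrightarrow> \<beta> y (hscale F c x) = c * \<beta> y x"
    and add_left: "\<And>y y' x. \<lbrakk>y \<in> hcarrier E; y' \<in> hcarrier E; x \<in> hcarrier F\<rbrakk>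
      \<Longrightarrow> \<beta> (hadd E y y') x = \<beta> y x + \<beta> y' x"
    and scale_left: "\<And>c y x. \<lbrakk>y \<in> hcarrier E; x \<in> hcarrier F\<rbrakk> \<Longrightarrow> \<beta> (hscale E c y) x = cnj c * \<beta> y x"
    and bound: "\<And>y x. \<lbrakk>y \<in> hcarrier E; x \<in> hcarrier F\<rbrakk> \<Longrightarrow> cmod (\<beta> y x) \<le> B * hnorm E y * hnorm F x"
    and "0 \<le> B"
  shows "\<exists>S. S \<in> extensional (hcarrier E) \<and> bounded_op E F S \<and>
    (\<forall>y\<in>hcarrier E. \<forall>x\<in>hcarrier F. \<beta> y x = hinner F (S y) x)"
proof -
  have "\<exists>z\<in>hcarrier F. \<forall>x\<in>hcarrier F. \<beta> y x = hinner F z x" if "y \<in> hcarrier E" for y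
    using F.riesz[of "\<beta> y" "B * hnorm E y"] add_right[OF that] scale_right[OF that] bound[OF that]
    by simp
  then obtain S0 where S0: "\<And>y. y \<in> hcarrier E \<Longrightarrow> S0 y \<in> hcarrier F"
    "\<And>y x. \<lbrakk>y \<in> hcarrier E; x \<in> hcarrier F\<rbrakk> \<Longrightarrow> \<beta> y x = hinner F (S0 y) x"
    by metis
  define S where "S = restrict S0 (hcarrier E)"
  have S: "\<And>y. y \<in> hcarrier E \<Longrightarrow> S y \<in> hcarrier F"
    "\<And>y x. \<lbrakk>y \<in> hcarrier E; x \<in> hcarrier F\<rbrakk> \<Longrightarrow> \<beta> y x = hinner F (S y) x"
    using S0 by (auto simp: S_def)
  have eq: "S y = z" if "y \<in> hcarrier E" "z \<in> hcarrier F" "\<And>x. x \<in> hcarrier F \<Longrightarrow> \<beta> y x = hinner F z x"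
    for y z
    using that by (intro F.vec_eqI_left) (simp_all add: S(1) flip: S(2))
  have "linear_op E F S"
    unfolding linear_op_def
    using S add_left scale_left
    by (auto intro!: eq simp: F.ip_simps)
  moreover have "hnorm F (S y) \<le> B * hnorm E y" if y: "y \<in> hcarrier E" for y
  proof (cases "hnorm F (S y) = 0")
    case True
    thus ?thesis using y \<open>0 \<le> B\<close> by simp
  next
    case False
    hence pos: "0 < hnorm F (S y)" using F.norm_nonneg[OF S(1)[OF y]] by (simp add: less_le)
    have "(hnorm F (S y))\<^sup>2 = cmod (\<beta> y (S y))"
      using y by (simp only: S F.inner_self norm_of_real abs_power2)
    also have "\<dots> \<le> B * hnorm E y * hnorm F (S y)" using S y by (intro bound) auto
    finally show ?thesis using pos by (simp add: power2_eq_square)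
  qed
  ultimately have "bounded_op E F S" by (auto simp: bounded_op_def)
  thus ?thesis using S(2) by (intro exI[of _ S]) (auto simp: S_def)
qed

lemma adjoint_exists:
  assumes "bounded_op E F T"
  shows "\<exists>S. S \<in> extensional (hcarrier F) \<and> bounded_op F E S \<and>
    (\<forall>x\<in>hcarrier E. \<forall>y\<in>hcarrier F. hinner F (T x) y = hinner E x (S y))"
proof -
  interpret FE: hilbert_pair F E ..
  obtain B where B: "0 \<le> B" "\<And>x. x \<in> hcarrier E \<Longrightarrow> hnorm F (T x) \<le> B * hnorm E x"
    using bounded_op_bound[OF assms] by blast
  note lin = bounded_op_linear[OF assms]
  note [simp] = linear_op_closed[OF lin]
  have "\<exists>S. S \<in> extensional (hcarrier F) \<and> bounded_op F E S \<and>
    (\<forall>y\<in>hcarrier F. \<forall>x\<in>hcarrier E. hinner F y (T x) = hinner E (S y) x)"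
  proof (rule FE.sesquilinear_form_op)
    fix y x assume *: "y \<in> hcarrier F" "x \<in> hcarrier E"
    have "cmod (hinner F y (T x)) \<le> hnorm F y * hnorm F (T x)"
      using * by (intro F.cauchy_schwarz) auto
    also have "\<dots> \<le> hnorm F y * (B * hnorm E x)"
      using * B by (intro mult_left_mono) auto
    finally show "cmod (hinner F y (T x)) \<le> B * hnorm F y * hnorm E x" by (simp add: mult_ac)
  qed (use B in \<open>auto simp: linear_op_add[OF lin] linear_op_scale[OF lin] F.ip_simps\<close>)
  then obtain S where S: "S \<in> extensional (hcarrier F)" "bounded_op F E S"
    "\<And>y x. \<lbrakk>y \<in> hcarrier F; x \<in> hcarrier E\<rbrakk> \<Longrightarrow> hinner F y (T x) = hinner E (S y) x"
    by blast
  have "hinner F (T x) y = hinner E x (S y)" if "x \<in> hcarrier E" "y \<in> hcarrier F" for x y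
  proof -
    have "hinner F (T x) y = cnj (hinner F y (T x))" using that by (intro F.inner_commute) auto
    also have "\<dots> = hinner E x (S y)"
      using that linear_op_closed[OF bounded_op_linear[OF S(2)]] E.inner_commute[of x "S y"]
      by (simp add: S(3))
    finally show ?thesis .
  qed
  thus ?thesis using S by blast
qed

text \<open>Two solutions of the defining condition agree on the carrier by \<open>E.vec_eqI\<close>
  and off it by extensionality, which justifies the definite description in
  \<open>adjoint_op\<close>.\<close>

lemma adjoint:
  assumes "bounded_op E F T"
  shows adjoint_extensional: "adjoint_op E F T \<in> extensional (hcarrier F)"
    and adjoint_bounded: "bounded_op F E (adjoint_op E F T)"
    and adjoint_inner: "\<And>x y. \<lbrakk>x \<in> hcarrier E; y \<in> hcarrier F\<rbrakk> \<Longrightarrow>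
      hinner F (T x) y = hinner E x (adjoint_op E F T y)"
proof -
  let ?P = "\<lambda>S. S \<in> extensional (hcarrier F) \<and> bounded_op F E S \<and>
    (\<forall>x\<in>hcarrier E. \<forall>y\<in>hcarrier F. hinner F (T x) y = hinner E x (S y))"
  obtain S where S: "?P S" using adjoint_exists[OF assms] by blast
  have "S' = S" if "?P S'" for S'
  proof (rule extensionalityI)
    fix y assume y: "y \<in> hcarrier F"
    have "S y \<in> hcarrier E" "S' y \<in> hcarrier E"
      using S that y by (auto intro: linear_op_closed bounded_op_linear)
    thus "S' y = S y" using S that y by (intro E.vec_eqI) auto
  qed (use S that in auto)
  hence "?P (adjoint_op E F T)" unfolding adjoint_op_def using S by (intro theI[of ?P]) auto
  thus "adjoint_op E F T \<in> extensional (hcarrier F)" "bounded_op F E (adjoint_op E F T)"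
    "\<And>x y. \<lbrakk>x \<in> hcarrier E; y \<in> hcarrier F\<rbrakk> \<Longrightarrow>
      hinner F (T x) y = hinner E x (adjoint_op E F T y)"
    by auto
qed

lemma adjoint_closed:
  "\<lbrakk>bounded_op E F T; y \<in> hcarrier F\<rbrakk> \<Longrightarrow> adjoint_op E F T y \<in> hcarrier E"
  using adjoint_bounded bounded_op_linear linear_op_closed by metis

lemma adjoint_inner_left:
  "\<lbrakk>bounded_op E F T; x \<in> hcarrier E; y \<in> hcarrier F\<rbrakk> \<Longrightarrow>
    hinner E (adjoint_op E F T y) x = hinner F y (T x)"
  using adjoint_inner[of T x y] adjoint_closed[of T y] linear_op_closed[OF bounded_op_linear, of E F T x]
    E.inner_commute[of "adjoint_op E F T y" x] F.inner_commute[of y "T x"] by simp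

end

context hilbert
begin

text \<open>The record has no finite sums of vectors, so the projection onto the span of S is built
  by induction and recorded only through its inner products.\<close>

lemma finite_projection:
  assumes "finite S" "orthonormal E S" "x \<in> V"
  shows "\<exists>p\<in>V. \<forall>z\<in>V. hinner E z p = (\<Sum>e\<in>S. hinner E z e * hinner E e x)"
  using assms(1,2)
proof (induction S)
  case empty
  show ?case by (intro bexI[of _ hzero]) auto
next
  case (insert e S)
  have "orthonormal E S" using insert.prems by (rule orthonormal_subset) auto
  then obtain p where "p \<in> V" "\<forall>z\<in>V. hinner E z p = (\<Sum>e\<in>S. hinner E z e * hinner E e x)"
    using insert.IH by blast
  moreover have "e \<in> V" using insert.prems by (rule orthonormal_carrier) simp
  ultimately show ?case
    using insert.hyps assms(3)
    by (intro bexI[of _ "hadd E (hscale E (hinner E e x) e) p"]) (auto simp: ip_simps mult.commute)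
qed

text \<open>For the projection p both |p|^2 and <x, p> equal the sum on the left, hence |x - p|^2 is
  |x|^2 minus that sum, and it is nonnegative.\<close>

lemma bessel:
  assumes "finite S" "orthonormal E S" "x \<in> V"
  shows "(\<Sum>e\<in>S. (cmod (hinner E e x))\<^sup>2) \<le> (hnorm E x)\<^sup>2"
proof -
  obtain p where p: "p \<in> V" "\<And>z. z \<in> V \<Longrightarrow> hinner E z p = (\<Sum>e\<in>S. hinner E z e * hinner E e x)"
    using finite_projection[OF assms] by blast
  define \<sigma> where "\<sigma> = (\<Sum>e\<in>S. (cmod (hinner E e x))\<^sup>2)"
  have S: "e \<in> V" if "e \<in> S" for e using assms(2) that by (rule orthonormal_carrier)
  have sq: "hinner E x e * hinner E e x = complex_of_real ((cmod (hinner E e x))\<^sup>2)" if "e \<in> S" for e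
    using inner_commute[OF assms(3) S[OF that]] by (simp only: complex_norm_square mult.commute)
  have xp: "hinner E x p = complex_of_real \<sigma>"
    using assms(3) by (simp only: p(2) \<sigma>_def of_real_sum) (rule sum.cong[OF refl sq])
  have ep: "hinner E e p = hinner E e x" if e: "e \<in> S" for e
  proof -
    have "hinner E e p = (\<Sum>e'\<in>S. if e' = e then hinner E e x else 0)"
      using assms(2) e S[OF e] unfolding p(2)[OF S[OF e]]
      by (intro sum.cong) (auto simp: orthonormal_def)
    thus ?thesis using assms(1) e by simp
  qed
  have pe: "hinner E p e = hinner E x e" if "e \<in> S" for e
    using ep[OF that] p(1) S[OF that] assms(3) inner_commute by metis
  have "hinner E p p = hinner E x p"
    using p(1) assms(3) pe by (simp add: p(2))
  hence "(hnorm E p)\<^sup>2 = \<sigma>" using p(1) xp by (simp add: norm_sq)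
  hence "(hdist E x p)\<^sup>2 = (hnorm E x)\<^sup>2 - \<sigma>"
    using p(1) assms(3) xp by (simp add: norm_sq_sub)
  thus ?thesis using zero_le_power2[of "hdist E x p"] by (simp add: \<sigma>_def)
qed

text \<open>Cauchy-Schwarz for the coefficients together with Bessel. The bound does not depend on
  the finite set T, so it yields absolute summability over S and the bound of the resulting
  form.\<close>

lemma sum_multiplier_le:
  assumes "orthonormal E S" "finite T" "T \<subseteq> S" "x \<in> V" "z \<in> V"
    and m: "\<And>e. e \<in> S \<Longrightarrow> 0 \<le> m e \<and> m e \<le> B" and 0: "0 \<le> B"
  shows "(\<Sum>e\<in>T. cmod (complex_of_real (m e) * hinner E x e * hinner E e z)) \<le> B * (hnorm E x * hnorm E z)"
proof -
  have T: "orthonormal E T" using assms orthonormal_subset by blast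
  have carr: "e \<in> V" if "e \<in> T" for e using T that by (rule orthonormal_carrier)
  have "(\<Sum>e\<in>T. cmod (complex_of_real (m e) * hinner E x e * hinner E e z))
      \<le> (\<Sum>e\<in>T. B * (cmod (hinner E e x) * cmod (hinner E e z)))"
  proof (rule sum_mono)
    fix e assume e: "e \<in> T"
    have "cmod (hinner E x e) = cmod (hinner E e x)"
      using carr[OF e] assms by (intro cmod_inner_commute)
    thus "cmod (complex_of_real (m e) * hinner E x e * hinner E e z)
        \<le> B * (cmod (hinner E e x) * cmod (hinner E e z))"
      using m[of e] e assms(3) by (auto simp: norm_mult mult.assoc intro!: mult_right_mono)
  qed
  also have "\<dots> = B * (\<Sum>e\<in>T. cmod (hinner E e x) * cmod (hinner E e z))"
    by (rule sum_distrib_left[symmetric])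
  also have "\<dots> \<le> B * (hnorm E x * hnorm E z)"
    using assms T 0 bessel by (intro mult_left_mono Cauchy_Schwarz_sum_le) auto
  finally show ?thesis .
qed

end

section \<open>Orthonormal bases and the spectral theorem\<close>

lemma real_tendsto_zero_le:
  fixes f g :: "nat \<Rightarrow> real"
  assumes "\<And>n. 0 \<le> f n" "\<And>n. f n \<le> g n" "g \<longlonglongrightarrow> 0"
  shows "f \<longlonglongrightarrow> 0"
  by (rule real_tendsto_sandwich[OF _ _ tendsto_const assms(3)]) (simp_all add: assms)

context hilbert
begin

lemma multiplier_summable:
  assumes "orthonormal E S" "x \<in> V" "z \<in> V" "\<And>e. e \<in> S \<Longrightarrow> 0 \<le> m e \<and> m e \<le> B" "0 \<le> B"
  shows "(\<lambda>e. cmod (complex_of_real (m e) * hinner E x e * hinner E e z)) summable_on S"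
  using sum_multiplier_le[OF assms(1) _ _ assms(2-5)]
  by (intro nonneg_bdd_above_summable_on) (auto intro!: bdd_aboveI)

text \<open>The diagonal operator with entries m, given weakly by its sesquilinear form, whose
  absolute convergence replaces convergence of a series of vectors.\<close>

lemma multiplier_exists:
  assumes S: "orthonormal E S" and m: "\<And>e. e \<in> S \<Longrightarrow> 0 \<le> m e \<and> m e \<le> B" and B: "0 \<le> B"
  shows "\<exists>T. T \<in> extensional V \<and> bounded_op E E T \<and> (\<forall>x\<in>V. \<forall>z\<in>V. hinner E (T x) z =
    (\<Sum>\<^sub>\<infinity>e\<in>S. complex_of_real (m e) * hinner E x e * hinner E e z))"
proof -
  interpret EE: hilbert_pair E E ..
  let ?\<beta> = "\<lambda>x z. \<Sum>\<^sub>\<infinity>e\<in>S. complex_of_real (m e) * hinner E x e * hinner E e z"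
  note sm = abs_summable_summable[OF multiplier_summable[OF S _ _ m B]]
  note carr = orthonormal_carrier[OF S]
  have "\<exists>T. T \<in> extensional V \<and> bounded_op E E T \<and> (\<forall>x\<in>V. \<forall>z\<in>V. ?\<beta> x z = hinner E (T x) z)"
  proof (rule EE.sesquilinear_form_op)
    fix y x x' assume *: "y \<in> V" "x \<in> V" "x' \<in> V"
    show "?\<beta> y (hadd E x x') = ?\<beta> y x + ?\<beta> y x'"
      using * by (subst infsum_add[symmetric])
        (auto intro!: sm infsum_cong simp: carr ip_simps ring_distribs)
    show "?\<beta> (hadd E y x) x' = ?\<beta> y x' + ?\<beta> x x'"
      using * by (subst infsum_add[symmetric])
        (auto intro!: sm infsum_cong simp: carr ip_simps ring_distribs)
  next
    fix c y x assume *: "y \<in> V" "x \<in> V"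
    have "?\<beta> y (hscale E c x) = (\<Sum>\<^sub>\<infinity>e\<in>S. c * (complex_of_real (m e) * hinner E y e * hinner E e x))"
      using * by (intro infsum_cong) (simp add: carr ip_simps mult_ac)
    thus "?\<beta> y (hscale E c x) = c * ?\<beta> y x" by (simp only: infsum_cmult_right')
    have "?\<beta> (hscale E c y) x = (\<Sum>\<^sub>\<infinity>e\<in>S. cnj c * (complex_of_real (m e) * hinner E y e * hinner E e x))"
      using * by (intro infsum_cong) (simp add: carr ip_simps mult_ac)
    thus "?\<beta> (hscale E c y) x = cnj c * ?\<beta> y x" by (simp only: infsum_cmult_right')
    have "cmod (?\<beta> y x) \<le> (\<Sum>\<^sub>\<infinity>e\<in>S. cmod (complex_of_real (m e) * hinner E y e * hinner E e x))"
      using * by (intro norm_infsum_bound multiplier_summable[OF S _ _ m B])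
    also have "\<dots> \<le> B * (hnorm E y * hnorm E x)"
      using * by (intro infsum_le_finite_sums multiplier_summable[OF S _ _ m B]
        sum_multiplier_le[OF S _ _ _ _ m B])
    finally show "cmod (?\<beta> y x) \<le> B * hnorm E y * hnorm E x" by (simp add: mult_ac)
  qed (rule B)
  then obtain T where T: "T \<in> extensional V" "bounded_op E E T"
    "\<forall>x\<in>V. \<forall>z\<in>V. ?\<beta> x z = hinner E (T x) z" by blast
  thus ?thesis by (intro exI[of _ T]) simp
qed

lemma multiplier_coeff:
  assumes S: "orthonormal E S" "e \<in> S" and T: "bounded_op E E T" "x \<in> V"
    and form: "\<And>x z. \<lbrakk>x \<in> V; z \<in> V\<rbrakk> \<Longrightarrow> hinner E (T x) z =
      (\<Sum>\<^sub>\<infinity>e\<in>S. complex_of_real (m e) * hinner E x e * hinner E e z)"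
  shows "hinner E e (T x) = complex_of_real (m e) * hinner E e x"
proof -
  note carr = orthonormal_carrier[OF S(1)]
  have TV: "T x \<in> V" using T bounded_op_linear linear_op_closed by metis
  have "hinner E (T x) e = complex_of_real (m e) * hinner E x e * hinner E e e"
    unfolding form[OF T(2) carr[OF S(2)]] using S by (intro infsum_eq_single) (auto simp: orthonormal_def)
  also have "hinner E e e = 1" using S by (auto simp: orthonormal_def)
  finally show ?thesis
    using inner_commute[OF carr[OF S(2)] TV] inner_commute[OF carr[OF S(2)] T(2)] by simp
qed

lemma orthonormal_basis_eqI:
  assumes "orthonormal_basis E S" "x \<in> V" "y \<in> V" "\<And>e. e \<in> S \<Longrightarrow> hinner E e x = hinner E e y"
  shows "x = y"
proof (rule dist_eq_0)
  have "hinner E e (hadd E x (hscale E (-1) y)) = 0" if "e \<in> S" for e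
    using assms that orthonormal_carrier[of E S e] by (simp add: ip_simps orthonormal_basis_def)
  moreover have "\<forall>z\<in>V. (\<forall>e\<in>S. hinner E e z = 0) \<longrightarrow> hnorm E z = 0"
    using assms(1) by (simp add: orthonormal_basis_def)
  from bspec[OF this, of "hadd E x (hscale E (-1) y)"]
  have "(\<forall>e\<in>S. hinner E e (hadd E x (hscale E (-1) y)) = 0) \<longrightarrow> hdist E x y = 0"
    using assms(2,3) by (simp add: hdist_def)
  ultimately show "hdist E x y = 0" by blast
qed (use assms in auto)

text \<open>The diagonal operator with all entries 1 has the same coefficients as the identity; over
  a basis this makes them equal, and the form defining the operator is the Parseval sum.\<close>

lemma parseval_inner:
  assumes S: "orthonormal_basis E S" and x: "x \<in> V" and z: "z \<in> V"
  shows "((\<lambda>e. hinner E x e * hinner E e z) has_sum hinner E x z) S"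
proof -
  have on: "orthonormal E S" using S by (simp add: orthonormal_basis_def)
  obtain T where T: "bounded_op E E T"
    "\<And>x z. \<lbrakk>x \<in> V; z \<in> V\<rbrakk> \<Longrightarrow> hinner E (T x) z =
      (\<Sum>\<^sub>\<infinity>e\<in>S. complex_of_real 1 * hinner E x e * hinner E e z)"
    using multiplier_exists[OF on, of "\<lambda>_. 1" 1] by auto
  have "T x = x"
    using S x multiplier_coeff[OF on _ T(1) x T(2)] bounded_op_linear[OF T(1)]
    by (intro orthonormal_basis_eqI[OF S]) (auto intro: linear_op_closed)
  hence "hinner E x z = (\<Sum>\<^sub>\<infinity>e\<in>S. hinner E x e * hinner E e z)"
    using T(2)[OF x z] by simp
  moreover have "(\<lambda>e. hinner E x e * hinner E e z) summable_on S"
    using abs_summable_summable[OF multiplier_summable[OF on x z, of "\<lambda>_. 1" 1]] by simp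
  ultimately show ?thesis by (simp add: has_sum_infsum)
qed

lemma parseval:
  assumes S: "orthonormal_basis E S" and x: "x \<in> V"
  shows "((\<lambda>e. (cmod (hinner E e x))\<^sup>2) has_sum (hnorm E x)\<^sup>2) S"
proof -
  have "hinner E x e * hinner E e x = complex_of_real ((cmod (hinner E e x))\<^sup>2)" if "e \<in> S" for e
    using inner_commute[OF x, of e] orthonormal_carrier[of E S e] S that
    by (auto simp: complex_norm_square mult.commute orthonormal_basis_def simp del: of_real_power)
  hence "((\<lambda>e. complex_of_real ((cmod (hinner E e x))\<^sup>2)) has_sum hinner E x x) S"
    using parseval_inner[OF S x x] by (subst has_sum_cong) auto
  from has_sum_Re[OF this] show ?thesis using x by (simp add: norm_sq)
qed

text \<open>Moving A to the other side as an adjoint turns <z, A x> into an inner product with x,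
  whose Parseval expansion involves only the values of A on S. Hence no continuity argument along
  partial sums is made.\<close>

lemma bounded_op_basis_eqI:
  assumes S: "orthonormal_basis E S" and A: "bounded_op E E A" "A \<in> extensional V"
    and B: "bounded_op E E B" "B \<in> extensional V" and eq: "\<And>e. e \<in> S \<Longrightarrow> A e = B e"
  shows "A = B"
proof (rule extensionalityI[OF A(2) B(2)])
  fix x assume x: "x \<in> V"
  interpret EE: hilbert_pair E E ..
  note cl = linear_op_closed[OF bounded_op_linear]
  have exp: "((\<lambda>e. hinner E z (T e) * hinner E e x) has_sum hinner E z (T x)) S"
    if T: "bounded_op E E T" and z: "z \<in> V" for T z
  proof -
    have "((\<lambda>e. hinner E (adjoint_op E E T z) e * hinner E e x) has_sum
        hinner E (adjoint_op E E T z) x) S"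
      using S x EE.adjoint_closed[OF T z] by (intro parseval_inner)
    moreover have "hinner E (adjoint_op E E T z) e = hinner E z (T e)" if "e \<in> V" for e
      using EE.adjoint_inner_left[OF T that z] .
    ultimately show ?thesis
      using S x orthonormal_carrier[of E S] by (subst has_sum_cong) (auto simp: orthonormal_basis_def)
  qed
  show "A x = B x"
  proof (rule vec_eqI)
    fix z assume z: "z \<in> V"
    have "((\<lambda>e. hinner E z (A e) * hinner E e x) has_sum hinner E z (B x)) S"
      using exp[OF B(1) z] eq by (subst has_sum_cong[of _ _ "\<lambda>e. hinner E z (B e) * hinner E e x"]) auto
    thus "hinner E z (A x) = hinner E z (B x)" using exp[OF A(1) z] has_sum_unique by blast
  qed (use x cl[OF A(1)] cl[OF B(1)] in auto)
qed

text \<open>Zorn's lemma. The predicate P is always true for orthonormal bases and says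
  "eigenvector" for the spectral theorem; maximality means that a unit vector with P orthogonal to S
  could be added to S.\<close>

lemma exists_maximal_orthonormal:
  "\<exists>S. orthonormal E S \<and> (\<forall>e\<in>S. P e) \<and>
    (\<forall>x\<in>V. hnorm E x = 1 \<and> P x \<longrightarrow> (\<exists>e\<in>S. hinner E e x \<noteq> 0))"
proof -
  let ?A = "{S. orthonormal E S \<and> (\<forall>e\<in>S. P e)}"
  have "\<exists>M\<in>?A. \<forall>X\<in>?A. M \<subseteq> X \<longrightarrow> X = M"
  proof (rule subset_Zorn')
    fix C assume C: "subset.chain ?A C"
    have "hinner E x y = (if x = y then 1 else 0)" if XY: "X \<in> C" "Y \<in> C" "x \<in> X" "y \<in> Y" for x y X Y
    proof -
      have "X \<subseteq> Y \<or> Y \<subseteq> X" using C XY by (auto simp: subset_chain_def)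
      then obtain Z where "Z \<in> C" "x \<in> Z" "y \<in> Z" using XY by blast
      moreover from this C have "orthonormal E Z" by (auto simp: subset_chain_def)
      ultimately show ?thesis unfolding orthonormal_def by blast
    qed
    moreover have "X \<subseteq> V" "\<forall>e\<in>X. P e" if "X \<in> C" for X
      using C that by (auto simp: subset_chain_def orthonormal_def)
    ultimately show "\<Union>C \<in> ?A" unfolding orthonormal_def by blast
  qed
  then obtain S where "S \<in> ?A" and max: "\<forall>X\<in>?A. S \<subseteq> X \<longrightarrow> X = S" by (rule bexE)
  hence S: "orthonormal E S" "\<forall>e\<in>S. P e" by simp_all
  have nonorth: "\<exists>e\<in>S. hinner E e x \<noteq> 0" if x: "x \<in> V" "hnorm E x = 1" "P x" for x
  proof (rule ccontr)
    assume "\<not> (\<exists>e\<in>S. hinner E e x \<noteq> 0)"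
    hence 0: "\<forall>e\<in>S. hinner E e x = 0" by blast
    have right0: "hinner E x e = 0" if "e \<in> S" for e
      using inner_commute[OF x(1) orthonormal_carrier[OF S(1) that]] that 0 by simp
    have xx: "hinner E x x = 1" using x by (simp add: inner_self)
    have "orthonormal E (insert x S)"
      using S(1) 0 right0 x(1) xx unfolding orthonormal_def by auto
    hence "insert x S \<in> ?A" using S(2) x(3) by simp
    hence "insert x S = S" using max by blast
    hence "x \<in> S" by blast
    thus False using 0 xx by simp
  qed
  show ?thesis using S nonorth by (intro exI[of _ S] conjI ballI impI) auto
qed

lemma normalize:
  assumes "x \<in> V" "x \<noteq> hzero"
  shows "hnorm E (hscale E (complex_of_real (1 / hnorm E x)) x) = 1"
proof -
  have "hnorm E x \<noteq> 0" using assms norm_eq_0 by blast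
  thus ?thesis using norm_nonneg[OF assms(1)] assms(1) by (simp add: norm_divide)
qed

lemma orthonormal_basis_exists: "\<exists>S. orthonormal_basis E S"
proof -
  obtain S where S: "orthonormal E S" "\<And>x. \<lbrakk>x \<in> V; hnorm E x = 1\<rbrakk> \<Longrightarrow> \<exists>e\<in>S. hinner E e x \<noteq> 0"
    using exists_maximal_orthonormal[of "\<lambda>_. True"] by blast
  have "hnorm E x = 0" if x: "x \<in> V" and 0: "\<And>e. e \<in> S \<Longrightarrow> hinner E e x = 0" for x
  proof (rule ccontr)
    assume "hnorm E x \<noteq> 0"
    hence "x \<noteq> hzero" by auto
    from S(2)[OF _ normalize[OF x this]] obtain e where
      "e \<in> S" "hinner E e (hscale E (complex_of_real (1 / hnorm E x)) x) \<noteq> 0" using x by auto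
    thus False using 0 x orthonormal_carrier[OF S(1)] by (simp add: ip_simps)
  qed
  thus ?thesis using S(1) unfolding orthonormal_basis_def by blast
qed

section \<open>Limits with respect to the distance of a carrier\<close>

lemma tendsto_dist_le:
  assumes "\<And>n. s n \<in> V" "\<And>n. t n \<in> V" "l \<in> V"
    and "(\<lambda>n. hdist E (s n) l) \<longlonglongrightarrow> 0" "(\<lambda>n. hdist E (s n) (t n)) \<longlonglongrightarrow> 0"
  shows "(\<lambda>n. hdist E (t n) l) \<longlonglongrightarrow> 0"
proof (rule real_tendsto_zero_le)
  show "hdist E (t n) l \<le> hdist E (s n) (t n) + hdist E (s n) l" for n
    using dist_triangle[of "t n" "s n" l] dist_commute[of "t n" "s n"] assms(1-3) by simp
  show "(\<lambda>n. hdist E (s n) (t n) + hdist E (s n) l) \<longlonglongrightarrow> 0"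
    using tendsto_add[OF assms(5,4)] by simp
qed (simp add: assms(2,3))

lemma tendsto_unique_dist:
  assumes "\<And>n. s n \<in> V" "l \<in> V" "l' \<in> V"
    and "(\<lambda>n. hdist E (s n) l) \<longlonglongrightarrow> 0" "(\<lambda>n. hdist E (s n) l') \<longlonglongrightarrow> 0"
  shows "l = l'"
proof -
  have "(\<lambda>n. hdist E l' l) \<longlonglongrightarrow> 0" by (rule tendsto_dist_le[OF assms(1) _ assms(2,4,5)]) (rule assms)
  hence "hdist E l' l = 0" by (simp add: LIMSEQ_const_iff)
  thus ?thesis using assms dist_eq_0 by blast
qed

lemma dist_scale: "\<lbrakk>x \<in> V; y \<in> V\<rbrakk> \<Longrightarrow> hdist E (hscale E c x) (hscale E c y) = cmod c * hdist E x y"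
proof -
  assume xy: "x \<in> V" "y \<in> V"
  have "hadd E (hscale E c x) (hscale E (-1) (hscale E c y)) = hscale E c (hadd E x (hscale E (-1) y))"
    using xy by (intro vec_eqI) (auto simp: ip_simps algebra_simps)
  thus ?thesis using xy by (simp add: hdist_def)
qed

lemma scale_scale: "x \<in> V \<Longrightarrow> hscale E c (hscale E d x) = hscale E (c * d) x"
  by (rule vec_eqI) (auto simp: ip_simps)

lemma scale_one: "x \<in> V \<Longrightarrow> hscale E 1 x = x"
  by (rule vec_eqI) (auto simp: ip_simps)

end

context hilbert_pair
begin

lemma tendsto_bounded_op:
  assumes T: "bounded_op E F T" and s: "\<And>n. s n \<in> hcarrier E" "l \<in> hcarrier E"
    "(\<lambda>n. hdist E (s n) l) \<longlonglongrightarrow> 0"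
  shows "(\<lambda>n. hdist F (T (s n)) (T l)) \<longlonglongrightarrow> 0"
proof -
  note lin = bounded_op_linear[OF T]
  obtain B where B: "0 \<le> B" "\<And>x. x \<in> hcarrier E \<Longrightarrow> hnorm F (T x) \<le> B * hnorm E x"
    using bounded_op_bound[OF T] by blast
  have le: "hdist F (T (s n)) (T l) \<le> B * hdist E (s n) l" for n
    unfolding linear_dist[OF lin s(1,2)]
    using s(1,2) B(2)[of "hadd E (s n) (hscale E (-1) l)"] by (simp add: hdist_def)
  have "(\<lambda>n. B * hdist E (s n) l) \<longlonglongrightarrow> 0"
    using tendsto_mult_left[OF s(3), of B] by simp
  thus ?thesis
    using linear_op_closed[OF lin s(1)] linear_op_closed[OF lin s(2)]
    by (intro real_tendsto_zero_le[OF _ le]) simp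
qed

section \<open>The operator K^*K and its eigenvectors\<close>

lemma gram_bounded:
  assumes K: "bounded_op E F K"
  shows "bounded_op E E (\<lambda>x. adjoint_op E F K (K x))"
proof -
  interpret FE: hilbert_pair F E ..
  let ?A = "adjoint_op E F K"
  note lin = bounded_op_linear[OF K] and lin' = bounded_op_linear[OF adjoint_bounded[OF K]]
  obtain B where B: "0 \<le> B" "\<And>x. x \<in> hcarrier E \<Longrightarrow> hnorm F (K x) \<le> B * hnorm E x"
    using bounded_op_bound[OF K] by blast
  obtain B' where B': "0 \<le> B'" "\<And>x. x \<in> hcarrier F \<Longrightarrow> hnorm E (?A x) \<le> B' * hnorm F x"
    using FE.bounded_op_bound[OF adjoint_bounded[OF K]] by blast
  have "hnorm E (?A (K x)) \<le> (B' * B) * hnorm E x" if "x \<in> hcarrier E" for x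
    using B'(2)[OF linear_op_closed[OF lin that]] mult_left_mono[OF B(2)[OF that] B'(1)] by simp
  moreover have "linear_op E E (\<lambda>x. ?A (K x))"
    using lin lin' unfolding linear_op_def by (auto simp: Pi_iff)
  ultimately show ?thesis by (auto simp: bounded_op_def)
qed

lemma gram_inner:
  assumes K: "bounded_op E F K" and "x \<in> hcarrier E" "y \<in> hcarrier E"
  shows "hinner E x (adjoint_op E F K (K y)) = hinner F (K x) (K y)"
    and "hinner E (adjoint_op E F K (K x)) y = hinner F (K x) (K y)"
  using assms linear_op_closed[OF bounded_op_linear[OF K]] adjoint_inner[OF K, of x "K y"]
    adjoint_inner_left[OF K, of y "K x"] by auto

text \<open>Variational argument: a maximizing sequence of |K x|^2 on the unit sphere of W consists
  of approximate eigenvectors of K^*K, and compactness of K makes a subsequence converge. The set W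
  is invariant because S consists of eigenvectors and K^*K is symmetric.\<close>

lemma gram_eigenvector_in_complement:
  assumes K: "compact_op E F K" and S: "S \<subseteq> hcarrier E"
    and eig: "\<And>e. e \<in> S \<Longrightarrow> \<exists>c. adjoint_op E F K (K e) = hscale E c e"
    and W: "W = {x \<in> hcarrier E. \<forall>e\<in>S. hinner E e x = 0}"
    and x0: "x0 \<in> W" "hnorm E x0 = 1"
  shows "\<exists>x\<in>W. hnorm E x = 1 \<and>
    adjoint_op E F K (K x) = hscale E (complex_of_real ((hnorm F (K x))\<^sup>2)) x"
proof -
  interpret FE: hilbert_pair F E ..
  interpret EE: hilbert_pair E E ..
  have Kb: "bounded_op E F K" using K by (simp add: compact_op_def)
  define A where "A x = adjoint_op E F K (K x)" for x
  note Klin = bounded_op_linear[OF Kb]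
  have Ab: "bounded_op E E A" unfolding A_def by (rule gram_bounded[OF Kb])
  note Alin = bounded_op_linear[OF Ab]
  note [simp] = linear_op_closed[OF Klin] linear_op_closed[OF Alin]
  have WS: "hinner E e x = 0" if "x \<in> W" "e \<in> S" for x e using that W by simp
  have WI: "x \<in> W" if "x \<in> hcarrier E" "\<And>e. e \<in> S \<Longrightarrow> hinner E e x = 0" for x
    using that W by simp
  have WV [simp]: "x \<in> hcarrier E" if "x \<in> W" for x using that W by simp
  have SV [simp]: "e \<in> hcarrier E" if "e \<in> S" for e using that S by blast
  have W_scale: "hscale E c x \<in> W" if "x \<in> W" for c x
    using that by (intro WI) (auto simp: WS E.inner_scale_right)
  have ipA: "hinner E x (A y) = hinner F (K x) (K y)" "hinner E (A x) y = hinner F (K x) (K y)"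
    if "x \<in> hcarrier E" "y \<in> hcarrier E" for x y
    using gram_inner[OF Kb that] by (simp_all add: A_def)
  have AW: "A x \<in> W" if "x \<in> W" for x
  proof -
    have "hinner E e (A x) = 0" if e: "e \<in> S" for e
    proof -
      obtain c where "A e = hscale E c e" using eig[OF e] by (auto simp: A_def)
      moreover have "hinner E e (A x) = hinner E (A e) x"
        using e \<open>x \<in> W\<close> by (simp add: ipA)
      ultimately show ?thesis using e \<open>x \<in> W\<close> by (simp add: E.inner_scale_left WS)
    qed
    thus ?thesis using that by (intro WI) auto
  qed
  obtain B where B: "0 \<le> B" "\<And>x. x \<in> hcarrier E \<Longrightarrow> hnorm F (K x) \<le> B * hnorm E x"
    using bounded_op_bound[OF Kb] by blast
  define U where "U = {x \<in> W. hnorm E x = 1}"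
  define m where "m = (SUP x\<in>U. (hnorm F (K x))\<^sup>2)"
  have bdd: "bdd_above ((\<lambda>x. (hnorm F (K x))\<^sup>2) ` U)"
  proof (rule bdd_aboveI2)
    fix x assume "x \<in> U"
    thus "(hnorm F (K x))\<^sup>2 \<le> B\<^sup>2"
      using B(2)[of x] by (intro power_mono) (auto simp: U_def)
  qed
  have x0U: "x0 \<in> U" using x0 by (simp add: U_def)
  have Um: "(hnorm F (K x))\<^sup>2 \<le> m" if "x \<in> U" for x
    unfolding m_def using that bdd by (rule cSUP_upper)
  have m0: "0 \<le> m" using Um[OF x0U] order_trans zero_le_power2 by blast
  have Wm: "hnorm F (K x) \<le> sqrt m * hnorm E x" if x: "x \<in> W" for x
  proof (cases "x = E.hzero")
    case True
    thus ?thesis using B(2)[of x] x by simp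
  next
    case False
    define u where "u = hscale E (complex_of_real (1 / hnorm E x)) x"
    have n: "hnorm E x > 0"
      using False E.norm_eq_0[of x] E.norm_nonneg[of x] x by (force simp: less_le)
    have "u \<in> U" using x W_scale[OF x] E.normalize[of x] False by (simp add: U_def u_def)
    hence "(hnorm F (K u))\<^sup>2 \<le> m" by (rule Um)
    hence "hnorm F (K u) \<le> sqrt m" by (rule real_le_rsqrt)
    moreover have "hnorm F (K u) = hnorm F (K x) / hnorm E x"
      using x n by (simp add: u_def linear_op_scale[OF Klin] norm_divide)
    ultimately show ?thesis using n by (simp add: field_simps)
  qed
  show ?thesis
  proof (cases "m = 0")
    \<comment> \<open>If the supremum is 0 then K x0 = 0, and the given x0 is already an
      eigenvector, with eigenvalue 0. The limiting argument of the other case divides by m.\<close>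
    case True
    have K0: "hnorm F (K x0) = 0" using Um[OF x0U] True by simp
    hence "K x0 = F.hzero" using x0 by (intro F.norm_eq_0) auto
    hence "A x0 = hscale E 0 x0" using x0 by (intro E.vec_eqI) (auto simp: ipA E.ip_simps)
    thus ?thesis using x0 K0 by (intro bexI[of _ x0]) (auto simp: A_def)
  next
    case False
    hence m: "m > 0" using m0 by simp
    have "\<exists>x\<in>U. m - inverse (real (Suc n)) < (hnorm F (K x))\<^sup>2" for n
    proof -
      have "m - inverse (real (Suc n)) < Sup ((\<lambda>x. (hnorm F (K x))\<^sup>2) ` U)" by (simp add: m_def)
      thus ?thesis using x0U bdd by (subst (asm) less_cSup_iff) auto
    qed
    then obtain s where s: "\<And>n. s n \<in> U" "\<And>n. m - inverse (real (Suc n)) < (hnorm F (K (s n)))\<^sup>2"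
      by metis
    have sW [simp]: "s n \<in> W" and s1: "hnorm E (s n) = 1" for n using s by (auto simp: U_def)
    \<comment> \<open>The squared distance is |A s|^2 - 2 m |K s|^2 + m^2. Once |A s|^2 is at most m
      |K s|^2 it is bounded by m (m - |K s|^2), which is small along the maximizing
      sequence.\<close>
    have near: "(hdist E (A (s n)) (hscale E (of_real m) (s n)))\<^sup>2 \<le> m * inverse (real (Suc n))" for n
    proof -
      \<comment> \<open>Write |A s|^2 as <K s, K A s> and use the bound by m for A s, which lies in
        W again.\<close>
      have "hnorm E (A (s n)) \<le> hnorm F (K (s n)) * sqrt m"
      proof (cases "hnorm E (A (s n)) = 0")
        case False
        hence pos: "hnorm E (A (s n)) > 0" using E.norm_nonneg[of "A (s n)"] by (simp add: less_le)
        have "(hnorm E (A (s n)))\<^sup>2 = Re (hinner F (K (s n)) (K (A (s n))))"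
          by (simp add: E.norm_sq ipA F.Re_inner_commute[of "K (s n)"])
        also have "\<dots> \<le> hnorm F (K (s n)) * hnorm F (K (A (s n)))"
          using F.cauchy_schwarz[of "K (s n)" "K (A (s n))"]
          by (intro order_trans[OF complex_Re_le_cmod]) auto
        also have "\<dots> \<le> hnorm F (K (s n)) * (sqrt m * hnorm E (A (s n)))"
          using Wm[OF AW] by (intro mult_left_mono) auto
        finally show ?thesis using pos by (simp add: power2_eq_square)
      qed (use m0 in auto)
      hence "(hnorm E (A (s n)))\<^sup>2 \<le> (hnorm F (K (s n)) * sqrt m)\<^sup>2"
        by (intro power_mono) auto
      hence 1: "(hnorm E (A (s n)))\<^sup>2 \<le> (hnorm F (K (s n)))\<^sup>2 * m"
        using m0 by (simp add: power_mult_distrib)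
      have "(hdist E (A (s n)) (hscale E (of_real m) (s n)))\<^sup>2 =
          (hnorm E (A (s n)))\<^sup>2 - 2 * (m * (hnorm F (K (s n)))\<^sup>2) + m\<^sup>2"
        using m by (simp add: E.norm_sq_sub E.ip_simps ipA s1 F.norm_sq)
      also have "\<dots> \<le> m * (m - (hnorm F (K (s n)))\<^sup>2)"
        using 1 by (simp add: algebra_simps power2_eq_square)
      also have "\<dots> \<le> m * inverse (real (Suc n))"
        using s(2)[of n] m by (intro mult_left_mono) auto
      finally show ?thesis .
    qed
    have d0: "(\<lambda>n. hdist E (A (s n)) (hscale E (of_real m) (s n))) \<longlonglongrightarrow> 0"
    proof -
      have "(\<lambda>n. m * inverse (real (Suc n))) \<longlonglongrightarrow> m * 0"
        by (intro tendsto_mult_left LIMSEQ_inverse_real_of_nat)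
      hence "(\<lambda>n. (hdist E (A (s n)) (hscale E (of_real m) (s n)))\<^sup>2) \<longlonglongrightarrow> 0"
        by (intro real_tendsto_zero_le[OF zero_le_power2 near]) simp
      from tendsto_real_sqrt[OF this] show ?thesis by simp
    qed
    obtain r y where r: "strict_mono r" and y: "y \<in> hcarrier F"
      "(\<lambda>n. hdist F (K (s (r n))) y) \<longlonglongrightarrow> 0"
    proof -
      have "(\<forall>n. s n \<in> hcarrier E) \<and> (\<exists>B. \<forall>n. hnorm E (s n) \<le> B)" using s1 by auto
      thus thesis using K that unfolding compact_op_def by meson
    qed
    \<comment> \<open>Compactness supplies the limit y of K s along the subsequence; z is then the
      limit of A s. As A s and m s approach each other, s itself converges to z / m.\<close>
    define z where "z = adjoint_op E F K y"
    define x where "x = hscale E (of_real (1 / m)) z"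
    have z: "z \<in> hcarrier E" using y Kb by (simp add: z_def adjoint_closed)
    hence x [simp]: "x \<in> hcarrier E" by (simp add: x_def)
    have mx: "hscale E (of_real m) x = z"
      using m z by (simp add: x_def E.scale_scale E.scale_one)
    have Az: "(\<lambda>n. hdist E (A (s (r n))) z) \<longlonglongrightarrow> 0"
      unfolding A_def z_def using y by (intro FE.tendsto_bounded_op adjoint_bounded[OF Kb]) auto
    have "(\<lambda>n. hdist E (A (s (r n))) (hscale E (of_real m) (s (r n)))) \<longlonglongrightarrow> 0"
      using LIMSEQ_subseq_LIMSEQ[OF d0 r] by (simp only: o_def)
    hence "(\<lambda>n. hdist E (hscale E (of_real m) (s (r n))) z) \<longlonglongrightarrow> 0"
      by (intro E.tendsto_dist_le[OF _ _ z Az]) simp_all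
    moreover have "hdist E (hscale E (of_real m) (s (r n))) z = m * hdist E (s (r n)) x" for n
      using E.dist_scale[of "s (r n)" x "of_real m"] m by (simp add: mx)
    ultimately have "(\<lambda>n. m * hdist E (s (r n)) x) \<longlonglongrightarrow> 0" by simp
    from tendsto_mult_left[OF this, of "1 / m"] have sx: "(\<lambda>n. hdist E (s (r n)) x) \<longlonglongrightarrow> 0"
      using m by simp
    have "(\<lambda>n. hdist E (A (s (r n))) (A x)) \<longlonglongrightarrow> 0"
      by (rule EE.tendsto_bounded_op[OF Ab _ x sx]) simp
    hence "A x = z" by (intro E.tendsto_unique_dist[OF _ _ z _ Az]) simp_all
    hence Ax: "A x = hscale E (of_real m) x" by (simp add: mx)
    have "(\<lambda>n. hnorm E (s (r n))) \<longlonglongrightarrow> hnorm E x" by (rule E.tendsto_norm[OF _ x sx]) simp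
    hence x1: "hnorm E x = 1" using LIMSEQ_unique[OF _ tendsto_const] by (simp add: s1)
    have "hinner E e x = 0" if e: "e \<in> S" for e
    proof -
      have "(\<lambda>n. hinner E e (s (r n))) \<longlonglongrightarrow> hinner E e x"
        by (rule E.tendsto_inner_right[OF _ x SV[OF e] sx]) simp
      moreover have "hinner E e (s (r n)) = 0" for n using WS[OF sW e] .
      ultimately show ?thesis using LIMSEQ_unique[OF _ tendsto_const] by simp
    qed
    hence xW: "x \<in> W" by (intro WI) auto
    have "(hnorm F (K x))\<^sup>2 = Re (hinner E x (A x))" by (simp add: ipA F.norm_sq)
    also have "\<dots> = m" by (simp add: Ax E.ip_simps E.inner_self x1)
    finally show ?thesis using Ax xW x1 by (intro bexI[of _ x]) (auto simp: A_def)
  qed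
qed

text \<open>A maximal orthonormal family of eigenvectors is a basis: a nonzero vector orthogonal to
  it would make \<open>gram_eigenvector_in_complement\<close> produce a further eigenvector
  orthogonal to the family. Each eigenvalue is written as |K e|^2, which makes its sign
  evident.\<close>

lemma gram_eigenbasis:
  assumes K: "compact_op E F K"
  shows "\<exists>S. orthonormal_basis E S \<and>
    (\<forall>e\<in>S. adjoint_op E F K (K e) = hscale E (complex_of_real ((hnorm F (K e))\<^sup>2)) e)"
proof -
  let ?P = "\<lambda>e. adjoint_op E F K (K e) = hscale E (complex_of_real ((hnorm F (K e))\<^sup>2)) e"
  obtain S where S: "orthonormal E S" "\<forall>e\<in>S. ?P e"
    and max: "\<And>x. \<lbrakk>x \<in> hcarrier E; hnorm E x = 1; ?P x\<rbrakk> \<Longrightarrow> \<exists>e\<in>S. hinner E e x \<noteq> 0"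
    using E.exists_maximal_orthonormal[of ?P] by blast
  define W where "W = {x \<in> hcarrier E. \<forall>e\<in>S. hinner E e x = 0}"
  have carr: "S \<subseteq> hcarrier E" using S(1) by (simp add: orthonormal_def)
  have "hnorm E x = 0" if x: "x \<in> hcarrier E" and 0: "\<forall>e\<in>S. hinner E e x = 0" for x
  proof (rule ccontr)
    assume "hnorm E x \<noteq> 0"
    hence "x \<noteq> E.hzero" by auto
    define u where "u = hscale E (complex_of_real (1 / hnorm E x)) x"
    have "hnorm E u = 1" unfolding u_def using x \<open>x \<noteq> E.hzero\<close> by (rule E.normalize)
    moreover have "u \<in> W" using x 0 carr by (auto simp: W_def u_def E.ip_simps subset_iff)
    ultimately obtain v where "v \<in> W" "hnorm E v = 1" "?P v"
      using gram_eigenvector_in_complement[OF K carr _ W_def, of u] S(2) by blast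
    thus False using max[of v] by (auto simp: W_def)
  qed
  thus ?thesis using S by (intro exI[of _ S]) (auto simp: orthonormal_basis_def)
qed

end

section \<open>Powers, traces and eigenvalue counting\<close>

lemma finite_sum_le_infsum_ennreal:
  fixes f :: "'a \<Rightarrow> ennreal"
  assumes "finite T" "T \<subseteq> A"
  shows "sum f T \<le> infsum f A"
  by (subst nonneg_infsum_complete) (use assms in \<open>auto intro: SUP_upper\<close>)

context hilbert_pair
begin

lemma gram_eigenvector_coeff:
  assumes K: "bounded_op E F K" and e: "e \<in> hcarrier E"
    "adjoint_op E F K (K e) = hscale E (complex_of_real c) e" and x: "x \<in> hcarrier E"
  shows "hinner E e (adjoint_op E F K (K x)) = complex_of_real c * hinner E e x"
proof -
  have "hinner E e (adjoint_op E F K (K x)) = hinner E (adjoint_op E F K (K e)) x"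
    using gram_inner[OF K e(1) x] by simp
  thus ?thesis using e x by (simp add: E.inner_scale_left)
qed

text \<open>The diagonal operator with entries |K e|^(2 s) in an eigenbasis satisfies the
  description in \<open>powr_op\<close>, and any other solution agrees with it on the basis, each of
  whose members is an eigenvector.\<close>

lemma gram_powr:
  assumes K: "compact_op E F K" and S: "orthonormal_basis E S"
    and eig: "\<forall>e\<in>S.
      adjoint_op E F K (K e) = hscale E (complex_of_real ((hnorm F (K e))\<^sup>2)) e"
    and s: "0 < s"
  shows gram_powr_bounded: "bounded_op E E (gram_powr E F K s)"
    and gram_powr_coeff: "\<And>e x. \<lbrakk>e \<in> S; x \<in> hcarrier E\<rbrakk> \<Longrightarrow> hinner E e (gram_powr E F K s x) =
      complex_of_real ((hnorm F (K e))\<^sup>2 powr s) * hinner E e x"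
    and gram_powr_form: "\<And>x z. \<lbrakk>x \<in> hcarrier E; z \<in> hcarrier E\<rbrakk> \<Longrightarrow> hinner E (gram_powr E F K s x) z =
      (\<Sum>\<^sub>\<infinity>e\<in>S. complex_of_real ((hnorm F (K e))\<^sup>2 powr s) * hinner E x e * hinner E e z)"
proof -
  let ?A = "\<lambda>x. adjoint_op E F K (K x)"
  let ?m = "\<lambda>e. (hnorm F (K e))\<^sup>2 powr s"
  have Kb: "bounded_op E F K" using K by (simp add: compact_op_def)
  have on: "orthonormal E S" using S by (simp add: orthonormal_basis_def)
  note carr = orthonormal_carrier[OF on]
  obtain B where B: "0 \<le> B" "\<And>x. x \<in> hcarrier E \<Longrightarrow> hnorm F (K x) \<le> B * hnorm E x"
    using bounded_op_bound[OF Kb] by blast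
  have e1: "hnorm E e = 1" if "e \<in> S" for e
    using on that by (auto simp: orthonormal_def hnorm_def)
  have m: "0 \<le> ?m e \<and> ?m e \<le> B\<^sup>2 powr s" if e: "e \<in> S" for e
    using B(2)[OF carr[OF e]] e1[OF e] s linear_op_closed[OF bounded_op_linear[OF Kb] carr[OF e]]
    by (auto intro!: powr_mono2 power_mono)
  obtain T where T: "T \<in> extensional (hcarrier E)" "bounded_op E E T"
    and form: "\<And>x z. \<lbrakk>x \<in> hcarrier E; z \<in> hcarrier E\<rbrakk> \<Longrightarrow> hinner E (T x) z =
      (\<Sum>\<^sub>\<infinity>e\<in>S. complex_of_real (?m e) * hinner E x e * hinner E e z)"
    using E.multiplier_exists[OF on, of ?m "B\<^sup>2 powr s"] m by (auto simp del: powr_power)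
  have coeff: "hinner E e (T x) = complex_of_real (?m e) * hinner E e x"
    if "e \<in> S" "x \<in> hcarrier E" for e x
    by (rule E.multiplier_coeff[OF on that(1) T(2) that(2) form])
  have TV: "T x \<in> hcarrier E" if "x \<in> hcarrier E" for x
    using linear_op_closed[OF bounded_op_linear[OF T(2)] that] .
  let ?P = "\<lambda>B. B \<in> extensional (hcarrier E) \<and> bounded_op E E B \<and>
       (\<forall>\<mu>\<ge>0. \<forall>x\<in>hcarrier E. ?A x = hscale E (complex_of_real \<mu>) x \<longrightarrow>
          B x = hscale E (complex_of_real (\<mu> powr s)) x)"
  have "T x = hscale E (complex_of_real (\<mu> powr s)) x"
    if mu: "0 \<le> \<mu>" and x: "x \<in> hcarrier E" and Ax: "?A x = hscale E (complex_of_real \<mu>) x" for \<mu> x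
  proof (rule E.orthonormal_basis_eqI[OF S])
    fix e assume e: "e \<in> S"
    \<comment> \<open>Comparison of two eigenvalues: the coefficient of x at e vanishes unless |K
      e|^2 = \<mu>.\<close>
    have "complex_of_real ((hnorm F (K e))\<^sup>2) * hinner E e x = complex_of_real \<mu> * hinner E e x"
      using gram_eigenvector_coeff[OF Kb carr[OF e] bspec[OF eig e] x, symmetric]
      by (simp only: Ax E.inner_scale_right[OF carr[OF e] x])
    hence "(hnorm F (K e))\<^sup>2 = \<mu> \<or> hinner E e x = 0"
      by (metis mult_cancel_right of_real_eq_iff)
    thus "hinner E e (T x) = hinner E e (hscale E (complex_of_real (\<mu> powr s)) x)"
      using x e carr[OF e] by (auto simp: coeff E.inner_scale_right)
  qed (use x TV in auto)
  hence PT: "?P T" using T by blast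
  have uniq: "T' = T" if "?P T'" for T'
  proof (rule E.bounded_op_basis_eqI[OF S])
    fix e assume e: "e \<in> S"
    have "0 \<le> (hnorm F (K e))\<^sup>2" by simp
    thus "T' e = T e" using that PT bspec[OF eig e] carr[OF e] by metis
  qed (use that T in auto)
  have "(THE B. ?P B) = T" by (rule the_equality[of ?P, OF PT uniq])
  hence "gram_powr E F K s = T" by (simp only: gram_powr_def powr_op_def)
  thus "bounded_op E E (gram_powr E F K s)"
    "\<And>e x. \<lbrakk>e \<in> S; x \<in> hcarrier E\<rbrakk> \<Longrightarrow> hinner E e (gram_powr E F K s x) =
      complex_of_real ((hnorm F (K e))\<^sup>2 powr s) * hinner E e x"
    "\<And>x z. \<lbrakk>x \<in> hcarrier E; z \<in> hcarrier E\<rbrakk> \<Longrightarrow> hinner E (gram_powr E F K s x) z =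
      (\<Sum>\<^sub>\<infinity>e\<in>S. complex_of_real ((hnorm F (K e))\<^sup>2 powr s) * hinner E x e * hinner E e z)"
    using T(2) form coeff by (simp_all only:)
qed

text \<open>In an eigenbasis of K^*K the coefficient of x at e vanishes unless |K e| = \<mu>. This
  covers negative \<mu> too, for which all coefficients vanish.\<close>

lemma gram_half_eigenvector:
  assumes K: "compact_op E F K" and x: "x \<in> eigenspace E (gram_powr E F K (1 / 2)) \<mu>"
  shows "adjoint_op E F K (K x) = hscale E (complex_of_real (\<mu>\<^sup>2)) x"
proof -
  have Kb: "bounded_op E F K" using K by (simp add: compact_op_def)
  obtain S where S: "orthonormal_basis E S"
    and eig: "\<forall>e\<in>S. adjoint_op E F K (K e) = hscale E (complex_of_real ((hnorm F (K e))\<^sup>2)) e"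
    using gram_eigenbasis[OF K] by blast
  have xV: "x \<in> hcarrier E" and Bx: "gram_powr E F K (1 / 2) x = hscale E (complex_of_real \<mu>) x"
    using x by (auto simp: eigenspace_def)
  have carr: "e \<in> hcarrier E" if "e \<in> S" for e
    using S that orthonormal_carrier by (auto simp: orthonormal_basis_def)
  show ?thesis
  proof (rule E.orthonormal_basis_eqI[OF S])
    show "adjoint_op E F K (K x) \<in> hcarrier E"
      by (intro adjoint_closed[OF Kb] linear_op_closed[OF bounded_op_linear[OF Kb]] xV)
    fix e assume e: "e \<in> S"
    have "(hnorm F (K e))\<^sup>2 powr (1 / 2) = hnorm F (K e)"
      using linear_op_closed[OF bounded_op_linear[OF Kb] carr[OF e]] by (simp add: powr_half_sqrt)
    hence "complex_of_real (hnorm F (K e)) * hinner E e x = complex_of_real \<mu> * hinner E e x"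
      using gram_powr_coeff[OF K S eig half_gt_zero[OF zero_less_one] e xV, symmetric]
      by (simp only: Bx E.inner_scale_right[OF carr[OF e] xV])
    hence "hnorm F (K e) = \<mu> \<or> hinner E e x = 0"
      by (metis mult_cancel_right of_real_eq_iff)
    thus "hinner E e (adjoint_op E F K (K x)) = hinner E e (hscale E (complex_of_real (\<mu>\<^sup>2)) x)"
      unfolding gram_eigenvector_coeff[OF Kb carr[OF e] bspec[OF eig e] xV]
        E.inner_scale_right[OF carr[OF e] xV] by auto
  qed (use xV in auto)
qed

text \<open>Parseval for <x, K^*K x>, whose coefficient at e carries the factor |K e|^2.\<close>

lemma norm_sq_eigen_expansion:
  assumes K: "compact_op E F K" and S: "orthonormal_basis E S"
    and eig: "\<forall>e\<in>S.
      adjoint_op E F K (K e) = hscale E (complex_of_real ((hnorm F (K e))\<^sup>2)) e"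
    and x: "x \<in> hcarrier E"
  shows "((\<lambda>e. (hnorm F (K e))\<^sup>2 * (cmod (hinner E e x))\<^sup>2) has_sum (hnorm F (K x))\<^sup>2) S"
proof -
  have Kb: "bounded_op E F K" using K by (simp add: compact_op_def)
  let ?A = "adjoint_op E F K (K x)"
  have Kx: "K x \<in> hcarrier F" using linear_op_closed[OF bounded_op_linear[OF Kb] x] .
  hence A: "?A \<in> hcarrier E" using Kb by (intro adjoint_closed)
  have carr: "e \<in> hcarrier E" if "e \<in> S" for e
    using S that orthonormal_carrier by (auto simp: orthonormal_basis_def)
  have "hinner E x e * hinner E e ?A =
      complex_of_real ((hnorm F (K e))\<^sup>2 * (cmod (hinner E e x))\<^sup>2)" if e: "e \<in> S" for e
  proof -
    have "hinner E x e * hinner E e ?A = complex_of_real ((hnorm F (K e))\<^sup>2) * (hinner E e x * cnj (hinner E e x))"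
      using gram_eigenvector_coeff[OF Kb carr[OF e] bspec[OF eig e] x] E.inner_commute[OF x carr[OF e]]
      by (simp add: mult_ac)
    thus ?thesis by (simp only: complex_norm_square[symmetric] of_real_mult)
  qed
  hence "((\<lambda>e. complex_of_real ((hnorm F (K e))\<^sup>2 * (cmod (hinner E e x))\<^sup>2)) has_sum hinner E x ?A) S"
    using E.parseval_inner[OF S x A] by (subst (asm) has_sum_cong) auto
  from has_sum_Re[OF this] show ?thesis
    using gram_inner(1)[OF Kb x x] Kx by (simp add: F.norm_sq)
qed

text \<open>The trace uses some basis \<open>S'\<close> unrelated to the eigenbasis S. Each diagonal
  entry at d dominates the part of its expansion with e in T, and summing that part over d gives the
  left side, because every e has norm 1 and Parseval holds in \<open>S'\<close>.\<close>

lemma trace_gram_powr_ge: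
  assumes K: "compact_op E F K" and S: "orthonormal_basis E S"
    and eig: "\<forall>e\<in>S.
      adjoint_op E F K (K e) = hscale E (complex_of_real ((hnorm F (K e))\<^sup>2)) e"
    and s: "0 < s" and T: "finite T" "T \<subseteq> S"
  shows "ennreal (\<Sum>e\<in>T. (hnorm F (K e))\<^sup>2 powr s) \<le> trace_op E (gram_powr E F K s)"
proof -
  let ?B = "gram_powr E F K s"
  let ?m = "\<lambda>e. (hnorm F (K e))\<^sup>2 powr s"
  note Bb = gram_powr_bounded[OF K S eig s] and form = gram_powr_form[OF K S eig s]
  define S' where "S' = (SOME S. orthonormal_basis E S)"
  have S': "orthonormal_basis E S'" unfolding S'_def using E.orthonormal_basis_exists by (rule someI_ex)
  have carr: "e \<in> hcarrier E" if "e \<in> S" for e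
    using S that orthonormal_carrier by (auto simp: orthonormal_basis_def)
  have carr': "e \<in> hcarrier E" if "e \<in> S'" for e
    using S' that orthonormal_carrier by (auto simp: orthonormal_basis_def)
  have on: "orthonormal E S" using S by (simp add: orthonormal_basis_def)
  have Kb: "bounded_op E F K" using K by (simp add: compact_op_def)
  obtain B where B: "0 \<le> B" "\<And>x. x \<in> hcarrier E \<Longrightarrow> hnorm F (K x) \<le> B * hnorm E x"
    using bounded_op_bound[OF Kb] by blast
  have e1: "hnorm E e = 1" if "e \<in> S" for e
    using on that by (auto simp: orthonormal_def hnorm_def)
  have m: "0 \<le> ?m e \<and> ?m e \<le> B\<^sup>2 powr s" if e: "e \<in> S" for e
    using B(2)[OF carr[OF e]] e1[OF e] s linear_op_closed[OF bounded_op_linear[OF Kb] carr[OF e]]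
    by (auto intro!: powr_mono2 power_mono)
  have diag: "(\<Sum>e\<in>T. ?m e * (cmod (hinner E e d))\<^sup>2) \<le> Re (hinner E d (?B d))" if d: "d \<in> S'" for d
  proof -
    have dV: "d \<in> hcarrier E" using d by (rule carr')
    have sq: "complex_of_real (?m e) * hinner E d e * hinner E e d =
        complex_of_real (?m e * (cmod (hinner E e d))\<^sup>2)" if e: "e \<in> S" for e
      using E.inner_commute[OF dV carr[OF e]]
      by (simp only: mult.assoc complex_norm_square of_real_mult) (simp add: mult_ac)
    have "(\<lambda>e. complex_of_real (?m e) * hinner E d e * hinner E e d) summable_on S"
      by (rule abs_summable_summable[OF E.multiplier_summable[OF on dV dV, of ?m "B\<^sup>2 powr s"]]) (use m in auto)
    hence "((\<lambda>e. complex_of_real (?m e) * hinner E d e * hinner E e d) has_sum hinner E (?B d) d) S"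
      unfolding form[OF dV dV] by (rule has_sum_infsum)
    hence "((\<lambda>e. complex_of_real (?m e * (cmod (hinner E e d))\<^sup>2)) has_sum hinner E (?B d) d) S"
      using sq by (subst (asm) has_sum_cong) auto
    from has_sum_Re[OF this]
    have "((\<lambda>e. ?m e * (cmod (hinner E e d))\<^sup>2) has_sum Re (hinner E (?B d) d)) S" by simp
    hence "(\<Sum>e\<in>T. ?m e * (cmod (hinner E e d))\<^sup>2) \<le> Re (hinner E (?B d) d)"
      using T by (intro finite_sum_le_has_sum) auto
    also have "\<dots> = Re (hinner E d (?B d))"
      using linear_op_closed[OF bounded_op_linear[OF Bb] dV] dV by (intro E.Re_inner_commute)
    finally show ?thesis .
  qed
  \<comment> \<open>Only the sum over d is infinite, so the order of summation is exchanged by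
    induction on the finite set T.\<close>
  have "((\<lambda>d. \<Sum>e\<in>T. ?m e * (cmod (hinner E e d))\<^sup>2) has_sum (\<Sum>e\<in>T. ?m e)) S'"
    using T
  proof (induction T rule: finite_induct)
    case (insert e T)
    have eV: "e \<in> hcarrier E" using insert.prems carr by blast
    have "((\<lambda>d. (cmod (hinner E d e))\<^sup>2) has_sum 1) S'"
      using E.parseval[OF S' eV] e1[of e] insert.prems by simp
    hence "((\<lambda>d. (cmod (hinner E e d))\<^sup>2) has_sum 1) S'"
      using E.cmod_inner_commute[OF eV] carr' by (subst (asm) has_sum_cong) auto
    from has_sum_add[OF has_sum_cmult_right[OF this, of "?m e"] insert.IH] insert.prems insert.hyps
    show ?case by simp
  qed simp
  note total = this
  show ?thesis
  proof (cases "trace_op E ?B")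
    case (real b)
    have "(\<Sum>e\<in>T. ?m e) \<le> b"
    proof (rule has_sum_le_finite_sums[OF total])
      fix D assume D: "finite D" "D \<subseteq> S'"
      have "ennreal (\<Sum>d\<in>D. \<Sum>e\<in>T. ?m e * (cmod (hinner E e d))\<^sup>2) =
          (\<Sum>d\<in>D. ennreal (\<Sum>e\<in>T. ?m e * (cmod (hinner E e d))\<^sup>2))"
        by (intro sum_ennreal[symmetric] sum_nonneg) auto
      also have "\<dots> \<le> (\<Sum>d\<in>D. ennreal (Re (hinner E d (?B d))))"
        using D diag by (intro sum_mono ennreal_leI) auto
      also have "\<dots> \<le> trace_op E ?B"
        unfolding trace_op_def Let_def S'_def[symmetric] using D by (rule finite_sum_le_infsum_ennreal)
      finally show "(\<Sum>d\<in>D. \<Sum>e\<in>T. ?m e * (cmod (hinner E e d))\<^sup>2) \<le> b"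
        using real by simp
    qed
    thus ?thesis using real by (simp add: ennreal_leI)
  qed simp
qed

text \<open>A unit eigenvector of |K| with eigenvalue \<mu> satisfies |K x| = \<mu>, and different
  eigenvalues above \<kappa> have orthogonal eigenspaces. Orthonormal families from finitely many
  eigenspaces therefore unite to a single family of the kind that the hypothesis bounds.\<close>

lemma eigenvalue_count_le:
  assumes K: "compact_op E F K" and \<kappa>: "0 < \<kappa>"
    and bound: "\<And>T. \<lbrakk>finite T; orthonormal E T; \<And>x. x \<in> T \<Longrightarrow> \<kappa> < hnorm F (K x)\<rbrakk>
      \<Longrightarrow> ennreal (real (card T)) \<le> N"
  shows "eigenvalue_count E \<kappa> (gram_powr E F K (1 / 2)) \<le> N"
proof (cases N)
  case top
  thus ?thesis by simp
next
  case (real b)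
  have Kb: "bounded_op E F K" using K by (simp add: compact_op_def)
  let ?V = "eigenspace E (gram_powr E F K (1 / 2))"
  note eig = gram_half_eigenvector[OF K]
  have VE: "x \<in> hcarrier E" if "x \<in> ?V \<mu>" for x \<mu> using that by (simp add: eigenspace_def)
  have KV: "\<kappa> < hnorm F (K x)" if x: "x \<in> ?V \<mu>" "hinner E x x = 1" "\<kappa> < \<mu>" for x \<mu>
  proof -
    have "complex_of_real ((hnorm F (K x))\<^sup>2) = complex_of_real (\<mu>\<^sup>2)"
      using gram_inner(1)[OF Kb VE[OF x(1)] VE[OF x(1)]] VE[OF x(1)] x(2)
        linear_op_closed[OF bounded_op_linear[OF Kb] VE[OF x(1)]]
      by (simp only: eig[OF x(1)] E.inner_scale_right F.inner_self mult_1_right)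
    hence "(hnorm F (K x))\<^sup>2 = \<mu>\<^sup>2" by (simp only: of_real_eq_iff)
    thus ?thesis using x(3) \<kappa> linear_op_closed[OF bounded_op_linear[OF Kb] VE[OF x(1)]] by simp
  qed
  have orth: "hinner E x y = 0" if xy: "x \<in> ?V \<mu>" "y \<in> ?V \<nu>" "\<kappa> < \<mu>" "\<kappa> < \<nu>" "\<mu> \<noteq> \<nu>" for x y \<mu> \<nu>
  proof -
    have "complex_of_real (\<mu>\<^sup>2) * hinner E x y = complex_of_real (\<nu>\<^sup>2) * hinner E x y"
      using gram_inner[OF Kb VE[OF xy(1)] VE[OF xy(2)]] VE[OF xy(1)] VE[OF xy(2)]
      by (simp add: eig[OF xy(1)] eig[OF xy(2)] E.ip_simps)
    hence "\<mu>\<^sup>2 = \<nu>\<^sup>2 \<or> hinner E x y = 0" by (metis mult_cancel_right of_real_eq_iff)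
    thus ?thesis using xy(3-5) \<kappa> by (auto simp: power2_eq_iff)
  qed
  have "(\<Sum>\<mu>\<in>M. hdim E (?V \<mu>)) \<le> N" if M: "finite M" "M \<subseteq> {\<kappa><..}" for M
  proof -
    have "\<exists>T. finite T \<and> orthonormal E T \<and> T \<subseteq> ?V \<mu> \<and> hdim E (?V \<mu>) = of_nat (card T)"
      if mu: "\<mu> \<in> M" for \<mu>
    proof -
      let ?Q = "\<lambda>T. finite T \<and> orthonormal E T \<and> T \<subseteq> ?V \<mu>"
      \<comment> \<open>The bound is a real number b in this case, so orthonormal families in one
        eigenspace have bounded cardinality and a largest one exists. Its cardinality is the
        dimension.\<close>
      have "\<exists>T. ?Q T \<and> (\<forall>T'. ?Q T' \<longrightarrow> card T' \<le> card T)"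
      proof (rule Lattices_Big.ex_has_greatest_nat)
        show "?Q {}" by (simp add: orthonormal_def)
        show "\<forall>T. ?Q T \<longrightarrow> card T < nat \<lceil>b\<rceil> + 1"
        proof (intro allI impI)
          fix T assume T: "?Q T"
          have "ennreal (real (card T)) \<le> N"
          proof (rule bound)
            show "\<kappa> < hnorm F (K x)" if x: "x \<in> T" for x
            proof (rule KV)
              show "x \<in> ?V \<mu>" "\<kappa> < \<mu>" using T x mu M by auto
              show "hinner E x x = 1" using T x by (simp add: orthonormal_def)
            qed
          qed (use T in auto)
          thus "card T < nat \<lceil>b\<rceil> + 1" using real by simp linarith
        qed
      qed
      then obtain T where T: "?Q T" "\<And>T'. ?Q T' \<Longrightarrow> card T' \<le> card T" by blast
      have "hdim E (?V \<mu>) = of_nat (card T)"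
        unfolding hdim_def using T by (intro antisym SUP_least SUP_upper) auto
      thus ?thesis using T(1) by blast
    qed
    then obtain T where T: "\<And>\<mu>. \<mu> \<in> M \<Longrightarrow> finite (T \<mu>)" "\<And>\<mu>. \<mu> \<in> M \<Longrightarrow> orthonormal E (T \<mu>)"
      "\<And>\<mu>. \<mu> \<in> M \<Longrightarrow> T \<mu> \<subseteq> ?V \<mu>" "\<And>\<mu>. \<mu> \<in> M \<Longrightarrow> hdim E (?V \<mu>) = of_nat (card (T \<mu>))"
      by metis
    have one: "hinner E x x = 1" if "\<mu> \<in> M" "x \<in> T \<mu>" for x \<mu>
      using T(2)[OF that(1)] that(2) by (simp add: orthonormal_def)
    have T0: "hinner E x y = 0" if "\<mu> \<in> M" "\<nu> \<in> M" "\<mu> \<noteq> \<nu>" "x \<in> T \<mu>" "y \<in> T \<nu>" for x y \<mu> \<nu>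
      using that M T(3) by (intro orth[of x \<mu> y \<nu>]) auto
    have disj: "T \<mu> \<inter> T \<nu> = {}" if "\<mu> \<in> M" "\<nu> \<in> M" "\<mu> \<noteq> \<nu>" for \<mu> \<nu>
      using T0[OF that] one[OF that(1)] by fastforce
    have "(\<Sum>\<mu>\<in>M. hdim E (?V \<mu>)) = of_nat (\<Sum>\<mu>\<in>M. card (T \<mu>))" using T(4) by simp
    also have "(\<Sum>\<mu>\<in>M. card (T \<mu>)) = card (\<Union>\<mu>\<in>M. T \<mu>)"
      using M T(1) disj by (intro card_UN_disjoint[symmetric]) auto
    also have "of_nat \<dots> \<le> N"
      unfolding ennreal_of_nat_eq_real_of_nat
    proof (rule bound)
      show "finite (\<Union>\<mu>\<in>M. T \<mu>)" using M T(1) by blast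
      have on: "hinner E x y = (if x = y then 1 else 0)"
        if "\<mu> \<in> M" "\<nu> \<in> M" "x \<in> T \<mu>" "y \<in> T \<nu>" for x y \<mu> \<nu>
      proof (cases "\<mu> = \<nu>")
        case True
        thus ?thesis using T(2)[OF that(1)] that by (simp add: orthonormal_def)
      next
        case False
        thus ?thesis using T0[OF that(1,2) False that(3,4)] disj[OF that(1,2) False] that by auto
      qed
      show "orthonormal E (\<Union>\<mu>\<in>M. T \<mu>)"
        unfolding orthonormal_def using on T(3) VE by blast
      show "\<kappa> < hnorm F (K x)" if x: "x \<in> (\<Union>\<mu>\<in>M. T \<mu>)" for x
      proof -
        obtain \<mu> where mu: "\<mu> \<in> M" "x \<in> T \<mu>" using x by blast
        have "x \<in> ?V \<mu>" "\<kappa> < \<mu>" using mu T(3) M by auto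
        thus ?thesis using KV one[OF mu] by blast
      qed
    qed
    finally show ?thesis .
  qed
  thus ?thesis
    unfolding eigenvalue_count_def by (subst nonneg_infsum_complete) (auto intro!: SUP_least)
qed

end

section \<open>Extension by density and compactness\<close>

context hilbert_pair
begin

text \<open>The value K x is characterized by lying within B dist(x, d) of T d for every d in D.
  Linearity, the agreement with T and the norm bound are all read off from this one
  inequality.\<close>

lemma bounded_extension:
  assumes D: "hdense E D"
    and add: "\<And>x y. \<lbrakk>x \<in> D; y \<in> D\<rbrakk> \<Longrightarrow> hadd E x y \<in> D \<and> T (hadd E x y) = hadd F (T x) (T y)"
    and scale: "\<And>c x. x \<in> D \<Longrightarrow> hscale E c x \<in> D \<and> T (hscale E c x) = hscale F c (T x)"
    and TF: "\<And>x. x \<in> D \<Longrightarrow> T x \<in> hcarrier F"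
    and bound: "\<And>x. x \<in> D \<Longrightarrow> hnorm F (T x) \<le> B * hnorm E x" and B: "0 \<le> B"
  shows "\<exists>K. linear_op E F K \<and> (\<forall>x\<in>hcarrier E. hnorm F (K x) \<le> B * hnorm E x) \<and> (\<forall>d\<in>D. K d = T d)"
proof -
  have DE [simp]: "d \<in> hcarrier E" if "d \<in> D" for d using D that by (auto simp: hdense_def)
  note [simp] = TF
  have near: "\<exists>d\<in>D. hdist E x d < e" if "x \<in> hcarrier E" "0 < e" for x e
    using D that by (simp add: hdense_def)
  have Td: "hdist F (T d) (T d') \<le> B * hdist E d d'" if d: "d \<in> D" "d' \<in> D" for d d'
  proof -
    have "hadd E d (hscale E (-1) d') \<in> D"
      and "T (hadd E d (hscale E (-1) d')) = hadd F (T d) (hscale F (-1) (T d'))"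
      using add[of d "hscale E (-1) d'"] scale[of d' "-1"] d by simp_all
    thus ?thesis using bound[of "hadd E d (hscale E (-1) d')"] by (simp add: hdist_def)
  qed
  \<comment> \<open>The limit of T along approximants of x; the inequality passes to the limit
    simultaneously for all d in D.\<close>
  have "\<exists>y\<in>hcarrier F. \<forall>d\<in>D. hdist F y (T d) \<le> B * hdist E x d" if x: "x \<in> hcarrier E" for x
  proof -
    have "\<exists>d\<in>D. hdist E x d < inverse (real (Suc n))" for n by (rule near[OF x]) simp
    then obtain d where d: "\<And>n. d n \<in> D" "\<And>n. hdist E x (d n) < inverse (real (Suc n))" by metis
    have inv: "(\<lambda>n. inverse (real (Suc n))) \<longlonglongrightarrow> 0" by (rule LIMSEQ_inverse_real_of_nat)
    have "\<exists>y\<in>hcarrier F. (\<lambda>n. hdist F (T (d n)) y) \<longlonglongrightarrow> 0"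
    proof (rule F.complete)
      fix e :: real assume e: "0 < e"
      obtain k where k: "inverse (real (Suc k)) < e / (2 * (B + 1))"
        using reals_Archimedean[of "e / (2 * (B + 1))"] e B by auto
      have "hdist F (T (d m)) (T (d n)) < e" if mn: "m \<ge> k" "n \<ge> k" for m n
      proof -
        have inv_le: "inverse (real (Suc m)) \<le> inverse (real (Suc k))"
          "inverse (real (Suc n)) \<le> inverse (real (Suc k))"
          using mn by (auto intro!: le_imp_inverse_le)
        have "hdist E (d m) (d n) \<le> hdist E x (d m) + hdist E x (d n)"
          using E.dist_triangle[of "d m" x "d n"] E.dist_commute[of x "d m"] d x by simp
        also have "\<dots> < 2 * (e / (2 * (B + 1)))"
          using d(2)[of m] d(2)[of n] inv_le k by linarith
        finally have "(B + 1) * hdist E (d m) (d n) < e"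
          using B by (simp add: field_simps)
        moreover have "B * hdist E (d m) (d n) \<le> (B + 1) * hdist E (d m) (d n)"
          using d by (intro mult_right_mono) auto
        ultimately show ?thesis using Td[OF d(1) d(1), of m n] by linarith
      qed
      thus "\<exists>k. \<forall>m\<ge>k. \<forall>n\<ge>k. hdist F (T (d m)) (T (d n)) < e" by blast
    qed (use d in simp)
    then obtain y where y: "y \<in> hcarrier F" "(\<lambda>n. hdist F (T (d n)) y) \<longlonglongrightarrow> 0" by blast
    have "hdist F y (T d') \<le> B * hdist E x d'" if d': "d' \<in> D" for d'
    proof (rule LIMSEQ_le_const)
      show "(\<lambda>n. hdist F (T (d n)) y + B * (inverse (real (Suc n)) + hdist E x d')) \<longlonglongrightarrow>
          B * hdist E x d'"
        using tendsto_add[OF y(2) tendsto_mult[OF tendsto_const[of B] tendsto_add[OF inv tendsto_const]]]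
        by simp
      have "hdist F y (T d') \<le> hdist F (T (d n)) y + B * (inverse (real (Suc n)) + hdist E x d')" for n
      proof -
        have "hdist E (d n) d' \<le> inverse (real (Suc n)) + hdist E x d'"
          using E.dist_triangle[of "d n" x d'] E.dist_commute[of x "d n"] d(1) d(2)[of n] x d' by simp
        hence "B * hdist E (d n) d' \<le> B * (inverse (real (Suc n)) + hdist E x d')"
          using B by (rule mult_left_mono)
        thus ?thesis
          using F.dist_triangle[of y "T (d n)" "T d'"] F.dist_commute[of y "T (d n)"]
            Td[OF d(1) d', of n] y d(1) d' by simp
      qed
      thus "\<exists>N. \<forall>n\<ge>N. hdist F y (T d') \<le> hdist F (T (d n)) y + B * (inverse (real (Suc n)) + hdist E x d')"
        by blast
    qed
    thus ?thesis using y by blast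
  qed
  then obtain K where K: "\<And>x. x \<in> hcarrier E \<Longrightarrow> K x \<in> hcarrier F"
    "\<And>x d. \<lbrakk>x \<in> hcarrier E; d \<in> D\<rbrakk> \<Longrightarrow> hdist F (K x) (T d) \<le> B * hdist E x d" by metis
  \<comment> \<open>Identities for K are proved by comparison with T at points of D within e; every
    such comparison costs a fixed multiple of e.\<close>
  have zero: "y = y'" if y: "y \<in> hcarrier F" "y' \<in> hcarrier F"
    and le: "\<And>e. 0 < e \<Longrightarrow> hdist F y y' \<le> C * e" and C: "0 \<le> C" for y y' C
  proof (rule F.dist_eq_0)
    have "hdist F y y' \<le> 0 + e" if "0 < e" for e
    proof -
      have "hdist F y y' \<le> C * (e / (C + 1))" using that C by (intro le) simp
      also have "\<dots> \<le> e" using that C by (simp add: field_simps)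
      finally show ?thesis by simp
    qed
    hence "hdist F y y' \<le> 0" by (rule field_le_epsilon)
    thus "hdist F y y' = 0" using F.dist_nonneg[OF y] by simp
  qed (use y in auto)
  have dist_add: "hdist E (hadd E x x') (hadd E d d') \<le> hdist E x d + hdist E x' d'"
    if "x \<in> hcarrier E" "x' \<in> hcarrier E" "d \<in> hcarrier E" "d' \<in> hcarrier E" for x x' d d'
  proof -
    have "hadd E (hadd E x x') (hscale E (-1) (hadd E d d')) =
        hadd E (hadd E x (hscale E (-1) d)) (hadd E x' (hscale E (-1) d'))"
      using that by (intro E.vec_eqI) (auto simp: E.ip_simps algebra_simps)
    thus ?thesis using that E.norm_triangle by (simp add: hdist_def)
  qed
  have dist_addF: "hdist F (hadd F x x') (hadd F d d') \<le> hdist F x d + hdist F x' d'"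
    if "x \<in> hcarrier F" "x' \<in> hcarrier F" "d \<in> hcarrier F" "d' \<in> hcarrier F" for x x' d d'
  proof -
    have "hadd F (hadd F x x') (hscale F (-1) (hadd F d d')) =
        hadd F (hadd F x (hscale F (-1) d)) (hadd F x' (hscale F (-1) d'))"
      using that by (intro F.vec_eqI) (auto simp: F.ip_simps algebra_simps)
    thus ?thesis using that F.norm_triangle by (simp add: hdist_def)
  qed
  have Kadd: "K (hadd E x x') = hadd F (K x) (K x')"
    if x: "x \<in> hcarrier E" "x' \<in> hcarrier E" for x x'
  proof (rule zero[where C = "4 * B"])
    fix e :: real assume e: "0 < e"
    obtain d d' where d: "d \<in> D" "hdist E x d < e" "d' \<in> D" "hdist E x' d' < e"
      using near[OF x(1) e] near[OF x(2) e] by blast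
    let ?s = "hadd E d d'"
    have s: "?s \<in> D" "T ?s = hadd F (T d) (T d')" using add d by auto
    have "hdist F (K (hadd E x x')) (hadd F (K x) (K x')) \<le>
        hdist F (K (hadd E x x')) (T ?s) + hdist F (T ?s) (hadd F (K x) (K x'))"
      using x s(1) K(1) by (intro F.dist_triangle) auto
    also have "hdist F (T ?s) (hadd F (K x) (K x')) = hdist F (hadd F (K x) (K x')) (hadd F (T d) (T d'))"
      using x s d K(1) by (subst F.dist_commute) auto
    also have "\<dots> \<le> hdist F (K x) (T d) + hdist F (K x') (T d')"
      using x d K(1) by (intro dist_addF) auto
    also have "\<dots> \<le> B * hdist E x d + B * hdist E x' d'"
      using x d by (intro add_mono K(2)) auto
    also have "hdist F (K (hadd E x x')) (T ?s) \<le> B * (hdist E x d + hdist E x' d')"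
    proof -
      have "hdist F (K (hadd E x x')) (T ?s) \<le> B * hdist E (hadd E x x') ?s"
        using x s(1) by (intro K(2)) auto
      also have "\<dots> \<le> B * (hdist E x d + hdist E x' d')"
        using x d B by (intro mult_left_mono dist_add) auto
      finally show ?thesis .
    qed
    also have "B * (hdist E x d + hdist E x' d') + (B * hdist E x d + B * hdist E x' d') =
        2 * B * hdist E x d + 2 * B * hdist E x' d'" by (simp add: algebra_simps)
    also have "\<dots> \<le> 2 * B * e + 2 * B * e" using d B by (intro add_mono mult_left_mono) auto
    finally show "hdist F (K (hadd E x x')) (hadd F (K x) (K x')) \<le> 4 * B * e" by simp
  qed (use x B K(1) in auto)
  have Kscale: "K (hscale E c x) = hscale F c (K x)" if x: "x \<in> hcarrier E" for c x
  proof (rule zero[where C = "2 * B * cmod c"])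
    fix e :: real assume e: "0 < e"
    obtain d where d: "d \<in> D" "hdist E x d < e" using near[OF x e] by blast
    have s: "hscale E c d \<in> D" "T (hscale E c d) = hscale F c (T d)" using scale d by auto
    have "hdist F (K (hscale E c x)) (hscale F c (K x)) \<le>
        hdist F (K (hscale E c x)) (T (hscale E c d)) + hdist F (T (hscale E c d)) (hscale F c (K x))"
      using x s(1) K(1) by (intro F.dist_triangle) auto
    also have "hdist F (T (hscale E c d)) (hscale F c (K x)) = cmod c * hdist F (K x) (T d)"
      using x s d K(1) F.dist_scale[of "T d" "K x" c] F.dist_commute[of "T d" "K x"] by simp
    also have "\<dots> \<le> cmod c * (B * hdist E x d)" using x d by (intro mult_left_mono K(2)) auto
    also have "hdist F (K (hscale E c x)) (T (hscale E c d)) \<le> B * (cmod c * hdist E x d)"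
      using K(2)[of "hscale E c x" "hscale E c d"] s(1) x d E.dist_scale[of x d c] by simp
    also have "B * (cmod c * hdist E x d) + cmod c * (B * hdist E x d) = 2 * B * cmod c * hdist E x d"
      by simp
    also have "\<dots> \<le> 2 * B * cmod c * e" using d B by (intro mult_left_mono) auto
    finally show "hdist F (K (hscale E c x)) (hscale F c (K x)) \<le> 2 * B * cmod c * e" by simp
  qed (use x B K(1) in auto)
  have KT: "K d = T d" if d: "d \<in> D" for d
  proof (rule F.dist_eq_0)
    have "hdist E d d = 0" using d E.norm_sq_sub[of d d] by (simp add: E.norm_sq)
    thus "hdist F (K d) (T d) = 0"
      using K(2)[OF DE[OF d] d] F.dist_nonneg[OF K(1)[OF DE[OF d]] TF[OF d]] by simp
  qed (use d K in auto)
  have "hnorm F (K x) \<le> B * hnorm E x" if x: "x \<in> hcarrier E" for x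
  proof (rule field_le_epsilon)
    fix e :: real assume e: "0 < e"
    obtain d where d: "d \<in> D" "hdist E x d < e / (2 * B + 1)"
      using near[OF x, of "e / (2 * B + 1)"] e B by auto
    have "hnorm F (K x) \<le> hnorm F (T d) + hdist F (K x) (T d)"
      using x d K(1) by (intro F.norm_le_dist) auto
    also have "\<dots> \<le> B * hnorm E d + B * hdist E x d"
      using x d by (intro add_mono bound K(2)) auto
    also have "hnorm E d \<le> hnorm E x + hdist E x d"
      using x d E.norm_le_dist[of d x] E.dist_commute[of x d] by simp
    finally have "hnorm F (K x) \<le> B * (hnorm E x + hdist E x d) + B * hdist E x d"
      using B by (simp add: mult_left_mono)
    also have "\<dots> \<le> B * hnorm E x + (2 * B + 1) * hdist E x d"
      using x d by (simp add: algebra_simps)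
    also have "(2 * B + 1) * hdist E x d \<le> e"
      using d(2) B by (simp add: field_simps)
    finally show "hnorm F (K x) \<le> B * hnorm E x + e" by simp
  qed
  moreover have "linear_op E F K" using K(1) Kadd Kscale by (simp add: linear_op_def)
  ultimately show ?thesis using KT by blast
qed

text \<open>Take T of maximal cardinality among the families on which |K x| exceeds \<epsilon>. A
  vector orthogonal to T violating the conclusion could be normalized and added to T.\<close>

lemma exists_finite_orthonormal_small:
  assumes K: "bounded_op E F K" and \<epsilon>: "0 < \<epsilon>"
    and N: "\<And>T. \<lbrakk>finite T; orthonormal E T; \<And>x. x \<in> T \<Longrightarrow> \<epsilon> < hnorm F (K x)\<rbrakk> \<Longrightarrow> card T \<le> N"
  shows "\<exists>T. finite T \<and> orthonormal E T \<and>
    (\<forall>x\<in>hcarrier E. (\<forall>e\<in>T. hinner E e x = 0) \<longrightarrow> hnorm F (K x) \<le> \<epsilon> * hnorm E x)"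
proof -
  note lin = bounded_op_linear[OF K]
  let ?Q = "\<lambda>T. finite T \<and> orthonormal E T \<and> (\<forall>x\<in>T. \<epsilon> < hnorm F (K x))"
  have "\<exists>T. ?Q T \<and> (\<forall>T'. ?Q T' \<longrightarrow> card T' \<le> card T)"
  proof (rule Lattices_Big.ex_has_greatest_nat)
    show "?Q {}" by (simp add: orthonormal_def)
    show "\<forall>T. ?Q T \<longrightarrow> card T < N + 1" using N by (simp add: less_Suc_eq_le)
  qed
  then obtain T where T: "finite T" "orthonormal E T" "\<forall>x\<in>T. \<epsilon> < hnorm F (K x)"
    and max: "\<And>T'. ?Q T' \<Longrightarrow> card T' \<le> card T" by blast
  have "hnorm F (K x) \<le> \<epsilon> * hnorm E x" if x: "x \<in> hcarrier E" and 0: "\<forall>e\<in>T. hinner E e x = 0" for x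
  proof (rule ccontr)
    assume neg: "\<not> hnorm F (K x) \<le> \<epsilon> * hnorm E x"
    obtain B where B: "0 \<le> B" "\<And>x. x \<in> hcarrier E \<Longrightarrow> hnorm F (K x) \<le> B * hnorm E x"
      using bounded_op_bound[OF K] by blast
    have "hnorm E x \<noteq> 0" using neg B(2)[OF x] \<epsilon> by auto
    hence pos: "0 < hnorm E x" using E.norm_nonneg[OF x] by simp
    hence nz: "x \<noteq> E.hzero" by auto
    define u where "u = hscale E (complex_of_real (1 / hnorm E x)) x"
    have u: "u \<in> hcarrier E" "hnorm E u = 1"
      using x E.normalize[OF x nz] by (auto simp: u_def)
    have uu: "hinner E u u = 1" using u by (simp add: E.inner_self)
    have Tu: "hinner E e u = 0" "hinner E u e = 0" if "e \<in> T" for e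
      using 0 that x orthonormal_carrier[OF T(2) that] E.inner_commute[of x e]
      by (auto simp: u_def E.inner_scale_right E.inner_scale_left)
    have "K u = hscale F (complex_of_real (1 / hnorm E x)) (K x)"
      unfolding u_def using linear_op_scale[OF lin x] .
    hence "hnorm F (K u) = hnorm F (K x) / hnorm E x"
      using linear_op_closed[OF lin x] pos by (simp add: norm_divide)
    hence "\<epsilon> < hnorm F (K u)" using neg pos by (simp add: pos_less_divide_eq)
    moreover have "orthonormal E (insert u T)"
      using T(2) u(1) uu Tu unfolding orthonormal_def by auto
    ultimately have "card (insert u T) \<le> card T" using T by (intro max) auto
    moreover have "u \<notin> T" using Tu(1)[of u] uu by auto
    ultimately show False using T(1) by simp
  qed
  thus ?thesis using T by blast
qed

text \<open>Split d into its projection p on T and the remainder w, to which the smallness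
  assumption applies. The vector p is known only through inner products, so |K p| is estimated by
  pairing p with K^* K p.\<close>

lemma norm_finite_projection_le:
  assumes K: "bounded_op E F K" and T: "finite T" "orthonormal E T" and B: "0 \<le> B"
    "\<And>x. x \<in> hcarrier E \<Longrightarrow> hnorm F (K x) \<le> B * hnorm E x"
    and small: "\<And>x. \<lbrakk>x \<in> hcarrier E; \<forall>e\<in>T. hinner E e x = 0\<rbrakk> \<Longrightarrow> hnorm F (K x) \<le> \<epsilon> * hnorm E x"
    and \<epsilon>: "0 < \<epsilon>" and d: "d \<in> hcarrier E"
  shows "hnorm F (K d) \<le> B * (\<Sum>e\<in>T. cmod (hinner E e d)) + \<epsilon> * hnorm E d"
proof -
  note lin = bounded_op_linear[OF K]
  have carr: "e \<in> hcarrier E" if "e \<in> T" for e using T(2) that by (rule orthonormal_carrier)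
  have e1: "hnorm E e = 1" if "e \<in> T" for e
    using T(2) that by (auto simp: orthonormal_def hnorm_def)
  obtain p where p: "p \<in> hcarrier E"
    "\<And>z. z \<in> hcarrier E \<Longrightarrow> hinner E z p = (\<Sum>e\<in>T. hinner E z e * hinner E e d)"
    using E.finite_projection[OF T d] by blast
  define w where "w = hadd E d (hscale E (-1) p)"
  have w: "w \<in> hcarrier E" using d p by (simp add: w_def)
  have ep: "hinner E e p = hinner E e d" if e: "e \<in> T" for e
  proof -
    have "hinner E e p = (\<Sum>e'\<in>T. if e' = e then hinner E e d else 0)"
      using T(2) e carr[OF e] unfolding p(2)[OF carr[OF e]]
      by (intro sum.cong) (auto simp: orthonormal_def)
    thus ?thesis using T(1) e by simp
  qed
  have ew: "hinner E e w = 0" if "e \<in> T" for e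
    using that carr d p ep by (simp add: w_def E.ip_simps)
  have "hinner E w p = 0"
    using w ew E.inner_commute[OF w carr] by (simp add: p(2))
  hence "hinner E p w = 0" using E.inner_commute[OF p(1) w] by simp
  moreover have dpw: "d = hadd E p w"
    unfolding w_def using d p by (intro E.vec_eqI) (auto simp: E.ip_simps)
  ultimately have "(hnorm E d)\<^sup>2 = (hnorm E p)\<^sup>2 + (hnorm E w)\<^sup>2"
    using E.norm_sq_add[OF p(1) w] by simp
  hence "(hnorm E w)\<^sup>2 \<le> (hnorm E d)\<^sup>2" by simp
  hence wd: "hnorm E w \<le> hnorm E d" by (rule power2_le_imp_le) (use d in simp)
  have Kp: "hnorm F (K p) \<le> B * (\<Sum>e\<in>T. cmod (hinner E e d))"
  proof (cases "hnorm F (K p) = 0")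
    case True
    thus ?thesis using B by (simp add: sum_nonneg)
  next
    case False
    note KpF = linear_op_closed[OF lin p(1)]
    have pos: "0 < hnorm F (K p)" using False F.norm_nonneg[OF KpF] by simp
    let ?z = "adjoint_op E F K (K p)"
    have z: "?z \<in> hcarrier E" using K KpF by (rule adjoint_closed)
    have "complex_of_real ((hnorm F (K p))\<^sup>2) = hinner F (K p) (K p)" using KpF by (simp add: F.inner_self)
    also have "\<dots> = hinner E ?z p" using adjoint_inner_left[OF K p(1) KpF] by simp
    also have "\<dots> = (\<Sum>e\<in>T. hinner F (K p) (K e) * hinner E e d)"
      unfolding p(2)[OF z] using adjoint_inner_left[OF K carr KpF] by (intro sum.cong) auto
    finally have "(hnorm F (K p))\<^sup>2 = cmod (\<Sum>e\<in>T. hinner F (K p) (K e) * hinner E e d)"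
      by (metis abs_power2 norm_of_real)
    also have "\<dots> \<le> (\<Sum>e\<in>T. cmod (hinner F (K p) (K e)) * cmod (hinner E e d))"
      by (intro order_trans[OF norm_sum] sum_mono) (simp add: norm_mult)
    also have "\<dots> \<le> (\<Sum>e\<in>T. (hnorm F (K p) * B) * cmod (hinner E e d))"
    proof (intro sum_mono mult_right_mono)
      fix e assume e: "e \<in> T"
      have "cmod (hinner F (K p) (K e)) \<le> hnorm F (K p) * hnorm F (K e)"
        by (intro F.cauchy_schwarz KpF linear_op_closed[OF lin carr[OF e]])
      also have "\<dots> \<le> hnorm F (K p) * B"
        using B(2)[OF carr[OF e]] e1[OF e] pos by (intro mult_left_mono) auto
      finally show "cmod (hinner F (K p) (K e)) \<le> hnorm F (K p) * B" .
    qed auto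
    also have "\<dots> = hnorm F (K p) * (B * (\<Sum>e\<in>T. cmod (hinner E e d)))"
      by (simp only: sum_distrib_left[symmetric] mult.assoc)
    finally show ?thesis using pos by (simp add: power2_eq_square)
  qed
  have "K d = hadd F (K p) (K w)" using linear_op_add[OF lin p(1) w] dpw by simp
  hence "hnorm F (K d) \<le> hnorm F (K p) + hnorm F (K w)"
    using F.norm_triangle[OF linear_op_closed[OF lin p(1)] linear_op_closed[OF lin w]] by simp
  also have "hnorm F (K w) \<le> \<epsilon> * hnorm E w" using ew by (intro small w) auto
  also have "\<epsilon> * hnorm E w \<le> \<epsilon> * hnorm E d" using wd \<epsilon> by simp
  finally show ?thesis using Kp by simp
qed

text \<open>Outside a finite family T k the operator K is smaller than 1/(k+1). Along a diagonal
  subsequence the coefficients with respect to all these families converge, and then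
  \<open>norm_finite_projection_le\<close> makes the images a Cauchy sequence.\<close>

lemma compact_op_criterion:
  assumes K: "bounded_op E F K"
    and N: "\<And>\<epsilon>. 0 < \<epsilon> \<Longrightarrow> \<exists>N. \<forall>T. finite T \<and> orthonormal E T \<and> (\<forall>x\<in>T. \<epsilon> < hnorm F (K x)) \<longrightarrow> card T \<le> N"
  shows "compact_op E F K"
  unfolding compact_op_def
proof (intro conjI allI impI K)
  fix x :: "nat \<Rightarrow> 'v"
  assume "(\<forall>n. x n \<in> hcarrier E) \<and> (\<exists>M. \<forall>n. hnorm E (x n) \<le> M)"
  then obtain M where x [simp]: "\<And>n. x n \<in> hcarrier E" and M: "\<And>n. hnorm E (x n) \<le> M" by blast
  have M0: "0 \<le> M" using M[of 0] E.norm_nonneg[OF x, of 0] by linarith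
  note lin = bounded_op_linear[OF K]
  note [simp] = linear_op_closed[OF lin]
  obtain B where B: "0 \<le> B" "\<And>x. x \<in> hcarrier E \<Longrightarrow> hnorm F (K x) \<le> B * hnorm E x"
    using bounded_op_bound[OF K] by blast
  have "\<exists>T. finite T \<and> orthonormal E T \<and> (\<forall>x\<in>hcarrier E. (\<forall>e\<in>T. hinner E e x = 0)
      \<longrightarrow> hnorm F (K x) \<le> inverse (real (Suc k)) * hnorm E x)" for k
  proof -
    have "0 < inverse (real (Suc k))" by simp
    from N[OF this] obtain N' where "\<forall>T. finite T \<and> orthonormal E T \<and>
      (\<forall>x\<in>T. inverse (real (Suc k)) < hnorm F (K x)) \<longrightarrow> card T \<le> N'" by blast
    thus ?thesis by (intro exists_finite_orthonormal_small[OF K, of _ N']) auto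
  qed
  then obtain T where T: "\<And>k. finite (T k)" "\<And>k. orthonormal E (T k)"
    "\<And>k x. \<lbrakk>x \<in> hcarrier E; \<forall>e\<in>T k. hinner E e x = 0\<rbrakk> \<Longrightarrow>
      hnorm F (K x) \<le> inverse (real (Suc k)) * hnorm E x" by metis
  \<comment> \<open>All families together form a countable set; inserting zero makes it nonempty, so
    that it can be enumerated by all natural numbers.\<close>
  define D where "D = insert E.hzero (\<Union>k. T k)"
  have "countable D" unfolding D_def using T(1) by (intro countable_insert countable_UN) (auto intro: countable_finite)
  moreover have "D \<noteq> {}" by (simp add: D_def)
  ultimately have rD: "range (from_nat_into D) = D" by (intro range_from_nat_into)
  define b where "b = from_nat_into D"
  have bE: "b i \<in> hcarrier E" for i
  proof -
    have "b i \<in> D" using rD by (auto simp: b_def)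
    thus ?thesis using orthonormal_carrier[OF T(2)] by (auto simp: D_def)
  qed
  \<comment> \<open>The refinement step at index i: coefficients against b i are bounded complex
    numbers and have a convergent subsequence.\<close>
  interpret subseqs "\<lambda>i s. convergent (\<lambda>n. hinner E (b i) (x (s n)))"
  proof
    fix i and s :: "nat \<Rightarrow> nat" assume "strict_mono s"
    have "bounded (range (\<lambda>n. hinner E (b i) (x (s n))))"
    proof (rule boundedI)
      fix y assume "y \<in> range (\<lambda>n. hinner E (b i) (x (s n)))"
      then obtain n where "y = hinner E (b i) (x (s n))" by blast
      thus "norm y \<le> hnorm E (b i) * M"
        using E.cauchy_schwarz[OF bE[of i] x, of "s n"] mult_left_mono[OF M[of "s n"] E.norm_nonneg[OF bE[of i]]]
        by simp
    qed
    from bounded_imp_convergent_subsequence[OF this] obtain l r where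
      r: "strict_mono r" "((\<lambda>n. hinner E (b i) (x (s n))) \<circ> r) \<longlonglongrightarrow> l" by blast
    have "convergent (\<lambda>n. hinner E (b i) (x ((s \<circ> r) n)))"
      using r(2) unfolding convergent_def o_def by blast
    thus "\<exists>r'. strict_mono r' \<and> convergent (\<lambda>n. hinner E (b i) (x ((s \<circ> r') n)))" using r(1) by blast
  qed
  define r where "r = diagseq"
  have r: "strict_mono r" unfolding r_def by (rule subseq_diagseq)
  have conv: "convergent (\<lambda>n. hinner E e (x (r n)))" if "e \<in> T k" for e k
  proof -
    have "e \<in> range b" using that rD by (auto simp: D_def b_def)
    then obtain i where i: "e = b i" by blast
    have "convergent (\<lambda>n. hinner E (b i) (x ((diagseq \<circ> (+) (Suc i)) n)))"
    proof (rule diagseq_holds)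
      fix r s :: "nat \<Rightarrow> nat" and n assume "strict_mono r" "convergent (\<lambda>na. hinner E (b n) (x (s na)))"
      from convergent_subseq_convergent[OF this(2,1)]
      show "convergent (\<lambda>na. hinner E (b n) (x ((s \<circ> r) na)))" by (simp add: o_def)
    qed
    hence "convergent (\<lambda>n. hinner E (b i) (x (diagseq (n + Suc i))))" by (simp add: o_def add.commute)
    thus ?thesis
      using convergent_ignore_initial_segment[of "\<lambda>n. hinner E (b i) (x (diagseq n))" "Suc i"]
      by (simp add: r_def i)
  qed
  have "\<exists>y\<in>hcarrier F. (\<lambda>n. hdist F (K (x (r n))) y) \<longlonglongrightarrow> 0"
  proof (rule F.complete)
    fix e :: real assume e: "0 < e"
    \<comment> \<open>Differences have norm at most 2 M, so this k makes the part outside T k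
      contribute at most e/2. The coefficients below are kept within e/(4 (B+1)) of their limits,
      which leaves less than e/2 for the finite part; the added 1 covers M = 0 and B = 0.\<close>
    obtain k where k: "inverse (real (Suc k)) < e / (4 * (M + 1))"
      using reals_Archimedean[of "e / (4 * (M + 1))"] e M0 by auto
    define L where "L t = lim (\<lambda>n. hinner E t (x (r n)))" for t
    define \<sigma> where "\<sigma> n = (\<Sum>t\<in>T k. cmod (hinner E t (x (r n)) - L t))" for n
    have "\<sigma> \<longlonglongrightarrow> (\<Sum>t\<in>T k. 0)"
      unfolding \<sigma>_def
    proof (rule tendsto_sum)
      fix t assume "t \<in> T k"
      hence "(\<lambda>n. hinner E t (x (r n))) \<longlonglongrightarrow> L t"
        unfolding L_def using conv convergent_LIMSEQ_iff by blast
      thus "(\<lambda>n. cmod (hinner E t (x (r n)) - L t)) \<longlonglongrightarrow> 0"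
        by (intro tendsto_norm_zero LIM_zero)
    qed
    hence "\<sigma> \<longlonglongrightarrow> 0" by simp
    moreover have "0 < e / (4 * (B + 1))" using e B(1) by simp
    ultimately obtain n0 where n0: "\<And>n. n \<ge> n0 \<Longrightarrow> norm (\<sigma> n - 0) < e / (4 * (B + 1))"
      using LIMSEQ_D by blast
    have "hdist F (K (x (r m))) (K (x (r n))) < e" if mn: "m \<ge> n0" "n \<ge> n0" for m n
    proof -
      define d where "d = hadd E (x (r m)) (hscale E (-1) (x (r n)))"
      have d: "d \<in> hcarrier E" by (simp add: d_def)
      have "hnorm E d \<le> hnorm E (x (r m)) + hnorm E (hscale E (-1) (x (r n)))"
        unfolding d_def by (intro E.norm_triangle) auto
      hence dM: "hnorm E d \<le> 2 * M" using M[of "r m"] M[of "r n"] by simp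
      have "(\<Sum>t\<in>T k. cmod (hinner E t d)) \<le> \<sigma> m + \<sigma> n"
        unfolding \<sigma>_def sum.distrib[symmetric]
      proof (rule sum_mono)
        fix t assume "t \<in> T k"
        hence "t \<in> hcarrier E" using orthonormal_carrier[OF T(2)] by blast
        hence "hinner E t d = (hinner E t (x (r m)) - L t) - (hinner E t (x (r n)) - L t)"
          by (simp add: d_def E.ip_simps)
        thus "cmod (hinner E t d) \<le> cmod (hinner E t (x (r m)) - L t) + cmod (hinner E t (x (r n)) - L t)"
          by (metis norm_triangle_ineq4)
      qed
      also have "\<dots> < 2 * (e / (4 * (B + 1)))" using n0[OF mn(1)] n0[OF mn(2)] by simp
      finally have "(B + 1) * (\<Sum>t\<in>T k. cmod (hinner E t d)) < e / 2" using B(1) by (simp add: field_simps)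
      moreover have "B * (\<Sum>t\<in>T k. cmod (hinner E t d)) \<le> (B + 1) * (\<Sum>t\<in>T k. cmod (hinner E t d))"
        by (intro mult_right_mono sum_nonneg) auto
      moreover have "inverse (real (Suc k)) * hnorm E d \<le> e / (4 * (M + 1)) * (2 * M)"
        using k dM d e M0 by (intro mult_mono) auto
      moreover have "e / (4 * (M + 1)) * (2 * M) \<le> e / 2" using e M0 by (simp add: field_simps)
      moreover have "hnorm F (K d) \<le> B * (\<Sum>t\<in>T k. cmod (hinner E t d)) + inverse (real (Suc k)) * hnorm E d"
        by (rule norm_finite_projection_le[OF K T(1,2) B T(3) _ d]) auto
      ultimately have "hnorm F (K d) < e" by linarith
      thus ?thesis unfolding linear_dist[OF lin x x] by (simp add: d_def)
    qed
    thus "\<exists>k. \<forall>m\<ge>k. \<forall>n\<ge>k. hdist F (K (x (r m))) (K (x (r n))) < e" by blast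
  qed simp
  thus "\<exists>r. strict_mono r \<and> (\<exists>y\<in>hcarrier F. (\<lambda>n. hdist F (K (x (r n))) y) \<longlonglongrightarrow> 0)"
    using r by blast
qed

end

section \<open>The Hilbert space of square-integrable functions\<close>

lemma scaleC_minus1_left: "(-1) *\<^sub>C x = - (x :: 'a::complex_hilbert_space)"
  using scaleR_scaleC[of "-1" x] by simp

lemma scaleC_one: "1 *\<^sub>C x = (x :: 'a::complex_hilbert_space)"
  using scaleR_scaleC[of 1 x] by simp

lemma type_hspace_simps [simp]:
  "hcarrier type_hspace = UNIV" "hadd type_hspace = (+)" "hscale type_hspace = scaleC"
  "hinner type_hspace = cinner"
  by (simp_all add: type_hspace_def)

lemma hnorm_type_hspace [simp]: "hnorm type_hspace x = norm x"
  by (simp add: hnorm_def cinner_self)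

lemma hdist_type_hspace [simp]: "hdist type_hspace x y = norm (x - y)"
  by (simp add: hdist_def scaleC_minus1_left)

lemma hilbert_type_hspace: "hilbert (type_hspace :: 'h::complex_hilbert_space hspace)"
proof
  fix s :: "nat \<Rightarrow> 'h"
  assume "\<And>e. 0 < e \<Longrightarrow> \<exists>k. \<forall>m\<ge>k. \<forall>n\<ge>k. hdist type_hspace (s m) (s n) < e"
  hence "Cauchy s" by (intro CauchyI) simp
  then obtain l where "s \<longlonglongrightarrow> l" using Cauchy_convergent convergent_def by blast
  hence "(\<lambda>n. norm (s n - l)) \<longlonglongrightarrow> 0" by (intro tendsto_norm_zero LIM_zero)
  thus "\<exists>l\<in>hcarrier type_hspace. (\<lambda>n. hdist type_hspace (s n) l) \<longlonglongrightarrow> 0" by auto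
qed (auto simp: cinner_add_right cinner_scaleC_right cinner_self cinner_commute[symmetric])

lemma cinner_add_left: "cinner (x + y) z = cinner x z + cinner y (z :: 'a::complex_hilbert_space)"
  using hilbert.inner_add_left[OF hilbert_type_hspace, of x y z] by simp

lemma cinner_scaleC_left: "cinner (c *\<^sub>C x) z = cnj c * cinner x (z :: 'a::complex_hilbert_space)"
  using hilbert.inner_scale_left[OF hilbert_type_hspace, of x z c] by simp

lemma norm_scaleC: "norm (c *\<^sub>C x) = cmod c * norm (x :: 'a::complex_hilbert_space)"
  using hilbert.norm_scale[OF hilbert_type_hspace, of x c] by simp

lemma cmod_cinner_le: "cmod (cinner x y) \<le> norm x * norm (y :: 'a::complex_hilbert_space)"
  using hilbert.cauchy_schwarz[OF hilbert_type_hspace, of x y] by simp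

lemma scaleC_zero_right [simp]: "c *\<^sub>C (0 :: 'a::complex_hilbert_space) = 0"
  using norm_scaleC[of c "0 :: 'a"] by simp

lemma bounded_bilinear_cinner: "bounded_bilinear (cinner :: 'a::complex_hilbert_space \<Rightarrow> 'a \<Rightarrow> complex)"
proof
  show "\<exists>K. \<forall>a b :: 'a. norm (cinner a b) \<le> norm a * norm b * K"
    by (intro exI[of _ 1]) (simp add: cmod_cinner_le)
qed (simp_all add: cinner_add_left cinner_add_right scaleR_scaleC cinner_scaleC_left
  cinner_scaleC_right scaleR_conv_of_real)

lemma bounded_linear_scaleC: "bounded_linear (\<lambda>x :: 'a::complex_hilbert_space. c *\<^sub>C x)"
proof
  show "\<exists>K. \<forall>x :: 'a. norm (c *\<^sub>C x) \<le> norm x * K"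
    by (intro exI[of _ "cmod c"]) (simp add: norm_scaleC mult.commute)
qed (simp_all add: scaleC_add_right scaleR_scaleC scaleC_scaleC mult.commute)

lemma borel_measurable_cinner [measurable (raw)]:
  fixes u v :: "'x \<Rightarrow> 'a::{complex_hilbert_space, second_countable_topology}"
  assumes "u \<in> borel_measurable M" "v \<in> borel_measurable M"
  shows "(\<lambda>x. cinner (u x) (v x)) \<in> borel_measurable M"
  using assms
  by (rule borel_measurable_continuous_Pair)
    (intro bounded_bilinear.continuous_on[OF bounded_bilinear_cinner] continuous_intros)

lemma borel_measurable_scaleC [measurable (raw)]:
  fixes u :: "'x \<Rightarrow> 'a::complex_hilbert_space"
  assumes "u \<in> borel_measurable M"
  shows "(\<lambda>x. c *\<^sub>C u x) \<in> borel_measurable M"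
  using assms
  by (rule measurable_compose)
    (rule borel_measurable_continuous_onI[OF linear_continuous_on[OF bounded_linear_scaleC]])

lemma cinner_sum_right:
  "cinner x (sum f I) = (\<Sum>i\<in>I. cinner x (f i :: 'a::complex_hilbert_space))"
  by (rule bounded_bilinear.sum_right[OF bounded_bilinear_cinner])

lemma cinner_sum_left:
  "cinner (sum f I) x = (\<Sum>i\<in>I. cinner (f i) (x :: 'a::complex_hilbert_space))"
  by (rule bounded_bilinear.sum_left[OF bounded_bilinear_cinner])

lemma norm_add_sq_le: "(norm (a + b))\<^sup>2 \<le> 2 * (norm a)\<^sup>2 + 2 * (norm (b :: 'a::real_normed_vector))\<^sup>2"
proof -
  have "(norm (a + b))\<^sup>2 \<le> (norm a + norm b)\<^sup>2"
    by (intro power_mono norm_triangle_ineq) simp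
  moreover have "0 \<le> (norm a - norm b)\<^sup>2" by simp
  ultimately show ?thesis by (simp add: power2_sum power2_diff)
qed

section \<open>Square-integrable functions\<close>

lemma L2_fun_iff:
  "u \<in> L2_fun M \<longleftrightarrow> u \<in> borel_measurable M \<and>
    integrable M (\<lambda>x. (norm (u x :: 'a::{complex_hilbert_space, second_countable_topology}))\<^sup>2)"
  by (auto simp: L2_fun_def integrable_iff_bounded)

context
  fixes M :: "'x measure"
begin

lemma L2_fun_measurable: "u \<in> L2_fun M \<Longrightarrow> u \<in> borel_measurable M"
  by (simp add: L2_fun_def)

lemma L2_fun_add:
  fixes u v :: "'x \<Rightarrow> 'a::{complex_hilbert_space, second_countable_topology}"
  assumes "u \<in> L2_fun M" "v \<in> L2_fun M"
  shows "(\<lambda>x. u x + v x) \<in> L2_fun M"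
  unfolding L2_fun_iff
proof
  have [measurable]: "u \<in> borel_measurable M" "v \<in> borel_measurable M"
    using assms by (auto dest: L2_fun_measurable)
  show "(\<lambda>x. u x + v x) \<in> borel_measurable M" by measurable
  have "integrable M (\<lambda>x. 2 * (norm (u x))\<^sup>2 + 2 * (norm (v x))\<^sup>2)"
    using assms by (simp add: L2_fun_iff)
  thus "integrable M (\<lambda>x. (norm (u x + v x))\<^sup>2)"
    by (rule Bochner_Integration.integrable_bound) (use norm_add_sq_le in \<open>auto simp: abs_of_nonneg\<close>)
qed

lemma L2_fun_scaleC:
  fixes u :: "'x \<Rightarrow> 'a::{complex_hilbert_space, second_countable_topology}"
  shows "u \<in> L2_fun M \<Longrightarrow> (\<lambda>x. c *\<^sub>C u x) \<in> L2_fun M"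
  by (auto simp: L2_fun_iff norm_scaleC power_mult_distrib)

lemma L2_fun_zero: "(\<lambda>x. 0 :: 'a::{complex_hilbert_space, second_countable_topology}) \<in> L2_fun M"
  by (simp add: L2_fun_iff)

lemma L2_fun_diff:
  fixes u v :: "'x \<Rightarrow> 'a::{complex_hilbert_space, second_countable_topology}"
  assumes "u \<in> L2_fun M" "v \<in> L2_fun M"
  shows "(\<lambda>x. u x - v x) \<in> L2_fun M"
  using L2_fun_add[OF assms(1) L2_fun_scaleC[OF assms(2), of "-1"]] by (simp add: scaleC_minus1_left)

lemma L2_fun_sum:
  fixes u :: "'i \<Rightarrow> 'x \<Rightarrow> 'a::{complex_hilbert_space, second_countable_topology}"
  assumes "\<And>i. i \<in> I \<Longrightarrow> u i \<in> L2_fun M"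
  shows "(\<lambda>x. \<Sum>i\<in>I. u i x) \<in> L2_fun M"
  using assms by (induction I rule: infinite_finite_induct) (auto intro: L2_fun_add L2_fun_zero)

lemma L2_fun_bound:
  fixes u :: "'x \<Rightarrow> 'a::{complex_hilbert_space, second_countable_topology}"
    and v :: "'x \<Rightarrow> 'b::{complex_hilbert_space, second_countable_topology}"
  assumes "v \<in> L2_fun M" "u \<in> borel_measurable M" "AE x in M. norm (u x) \<le> c * norm (v x)"
  shows "u \<in> L2_fun M"
  unfolding L2_fun_iff
proof
  have "integrable M (\<lambda>x. c\<^sup>2 * (norm (v x))\<^sup>2)" using assms by (simp add: L2_fun_iff)
  thus "integrable M (\<lambda>x. (norm (u x))\<^sup>2)"
  proof (rule Bochner_Integration.integrable_bound)
    show "(\<lambda>x. (norm (u x))\<^sup>2) \<in> borel_measurable M" using assms(2) by measurable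
    show "AE x in M. norm ((norm (u x))\<^sup>2) \<le> norm (c\<^sup>2 * (norm (v x))\<^sup>2)"
      using assms(3)
    proof eventually_elim
      fix x assume "norm (u x) \<le> c * norm (v x)"
      from power_mono[OF this, of 2]
      show "norm ((norm (u x))\<^sup>2) \<le> norm (c\<^sup>2 * (norm (v x))\<^sup>2)" by (simp add: power_mult_distrib)
    qed
  qed
qed (rule assms)

lemma integrable_cinner:
  fixes u v :: "'x \<Rightarrow> 'a::{complex_hilbert_space, second_countable_topology}"
  assumes "u \<in> L2_fun M" "v \<in> L2_fun M"
  shows "integrable M (\<lambda>x. cinner (u x) (v x))"
proof (rule Bochner_Integration.integrable_bound)
  show "integrable M (\<lambda>x. (norm (u x))\<^sup>2 + (norm (v x))\<^sup>2)" using assms by (simp add: L2_fun_iff)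
  show "(\<lambda>x. cinner (u x) (v x)) \<in> borel_measurable M"
    using assms by (intro borel_measurable_cinner L2_fun_measurable)
  have "norm (cinner (u x) (v x)) \<le> norm ((norm (u x))\<^sup>2 + (norm (v x))\<^sup>2)" for x
  proof -
    have "0 \<le> (norm (u x) - norm (v x))\<^sup>2" "0 \<le> norm (u x) * norm (v x)" by simp_all
    hence "norm (u x) * norm (v x) \<le> (norm (u x))\<^sup>2 + (norm (v x))\<^sup>2"
      unfolding power2_diff by linarith
    thus ?thesis using cmod_cinner_le[of "u x" "v x"] by simp
  qed
  thus "AE x in M. norm (cinner (u x) (v x)) \<le> norm ((norm (u x))\<^sup>2 + (norm (v x))\<^sup>2)" by simp
qed

lemma nn_integral_norm_sq:
  fixes u :: "'x \<Rightarrow> 'a::{complex_hilbert_space, second_countable_topology}"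
  assumes "u \<in> L2_fun M"
  shows "(\<integral>\<^sup>+x. ennreal ((norm (u x))\<^sup>2) \<partial>M) = ennreal (\<integral>x. (norm (u x))\<^sup>2 \<partial>M)"
  using assms by (intro nn_integral_eq_integral) (auto simp: L2_fun_iff)

section \<open>Classes modulo equality almost everywhere\<close>

lemma equiv_L2_rel: "equiv (L2_fun M :: ('x \<Rightarrow> 'a::{complex_hilbert_space, second_countable_topology}) set) (L2_rel M)"
proof (rule equivI)
  show "L2_rel M \<subseteq> (L2_fun M :: ('x \<Rightarrow> 'a) set) \<times> L2_fun M" by (auto simp: L2_rel_def)
  show "refl_on (L2_fun M :: ('x \<Rightarrow> 'a) set) (L2_rel M)" by (auto simp: refl_on_def L2_rel_def)
  show "sym (L2_rel M :: (('x \<Rightarrow> 'a) \<times> ('x \<Rightarrow> 'a)) set)"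
    by (auto simp: sym_def L2_rel_def elim: eventually_mono)
  show "trans (L2_rel M :: (('x \<Rightarrow> 'a) \<times> ('x \<Rightarrow> 'a)) set)"
    by (auto simp: trans_def L2_rel_def elim: eventually_elim2)
qed

lemma hcarrier_L2: "hcarrier (L2 M) = L2_fun M // L2_rel M"
  by (simp add: L2_def)

lemma L2_class_closed [simp]:
  "u \<in> L2_fun M \<Longrightarrow> L2_class M u \<in> hcarrier (L2 M)"
  for u :: "'x \<Rightarrow> 'a::{complex_hilbert_space, second_countable_topology}"
  by (simp add: hcarrier_L2 L2_class_def quotientI)

lemma L2_class_eq_iff:
  fixes u v :: "'x \<Rightarrow> 'a::{complex_hilbert_space, second_countable_topology}"
  assumes "u \<in> L2_fun M" "v \<in> L2_fun M"
  shows "L2_class M u = L2_class M v \<longleftrightarrow> (AE x in M. u x = v x)"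
  using eq_equiv_class_iff[OF equiv_L2_rel assms] assms by (simp add: L2_class_def L2_rel_def)

lemma L2_rep:
  fixes a :: "('x \<Rightarrow> 'a::{complex_hilbert_space, second_countable_topology}) set"
  assumes "a \<in> hcarrier (L2 M)"
  shows L2_rep_closed [simp]: "L2_rep a \<in> L2_fun M" and L2_class_rep [simp]: "L2_class M (L2_rep a) = a"
proof -
  obtain u where u: "u \<in> L2_fun M" "a = L2_rel M `` {u}"
    using assms unfolding hcarrier_L2 by (auto elim: quotientE)
  have "u \<in> a" using u equiv_class_self[OF equiv_L2_rel] by simp
  hence "L2_rep a \<in> a" unfolding L2_rep_def by (rule someI[where P = "\<lambda>u. u \<in> a"])
  hence rel: "(u, L2_rep a) \<in> L2_rel M" using u by simp
  thus "L2_rep a \<in> L2_fun M" by (simp add: L2_rel_def)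
  show "L2_class M (L2_rep a) = a"
    using equiv_class_eq[OF equiv_L2_rel rel] u by (simp add: L2_class_def)
qed

text \<open>The operations of \<open>L2\<close> are defined with chosen representatives. This lemma
  lets them be computed with any representative.\<close>

lemma L2_rep_class:
  fixes u :: "'x \<Rightarrow> 'a::{complex_hilbert_space, second_countable_topology}"
  assumes "u \<in> L2_fun M"
  shows "AE x in M. L2_rep (L2_class M u) x = u x"
  using L2_class_eq_iff[OF L2_rep_closed assms, of "L2_class M u"] assms by simp

lemma hinner_L2_class:
  fixes u v :: "'x \<Rightarrow> 'a::{complex_hilbert_space, second_countable_topology}"
  assumes "u \<in> L2_fun M" "v \<in> L2_fun M"
  shows "hinner (L2 M) (L2_class M u) (L2_class M v) = (\<integral>x. cinner (u x) (v x) \<partial>M)"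
proof -
  have [measurable]: "u \<in> borel_measurable M" "v \<in> borel_measurable M"
    "L2_rep (L2_class M u) \<in> borel_measurable M" "L2_rep (L2_class M v) \<in> borel_measurable M"
    using assms by (auto intro!: L2_fun_measurable)
  show ?thesis
    unfolding L2_def hspace.simps
    using L2_rep_class[OF assms(1)] L2_rep_class[OF assms(2)]
    by (intro integral_cong_AE) (auto elim!: eventually_elim2)
qed

lemma hadd_L2_class:
  fixes u v :: "'x \<Rightarrow> 'a::{complex_hilbert_space, second_countable_topology}"
  assumes "u \<in> L2_fun M" "v \<in> L2_fun M"
  shows "hadd (L2 M) (L2_class M u) (L2_class M v) = L2_class M (\<lambda>x. u x + v x)"
  unfolding L2_def hspace.simps
  using L2_rep_class[OF assms(1)] L2_rep_class[OF assms(2)] assms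
  by (subst L2_class_eq_iff) (auto intro!: L2_fun_add elim!: eventually_elim2)

lemma hscale_L2_class:
  fixes u :: "'x \<Rightarrow> 'a::{complex_hilbert_space, second_countable_topology}"
  assumes "u \<in> L2_fun M"
  shows "hscale (L2 M) c (L2_class M u) = L2_class M (\<lambda>x. c *\<^sub>C u x)"
  unfolding L2_def hspace.simps
  using L2_rep_class[OF assms(1)] assms
  by (subst L2_class_eq_iff) (auto intro!: L2_fun_scaleC elim!: eventually_mono)

lemma hnorm_L2_class:
  fixes u :: "'x \<Rightarrow> 'a::{complex_hilbert_space, second_countable_topology}"
  assumes "u \<in> L2_fun M"
  shows "hnorm (L2 M) (L2_class M u) = sqrt (\<integral>x. (norm (u x))\<^sup>2 \<partial>M)"
proof -
  have "hinner (L2 M) (L2_class M u) (L2_class M u) = (\<integral>x. complex_of_real ((norm (u x))\<^sup>2) \<partial>M)"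
    using assms by (simp add: hinner_L2_class cinner_self del: of_real_power)
  also have "\<dots> = complex_of_real (\<integral>x. (norm (u x))\<^sup>2 \<partial>M)"
    by (rule integral_of_real) (use assms in \<open>simp add: L2_fun_iff\<close>)
  finally show ?thesis by (simp add: hnorm_def)
qed

lemma hdist_L2_class:
  fixes u v :: "'x \<Rightarrow> 'a::{complex_hilbert_space, second_countable_topology}"
  assumes "u \<in> L2_fun M" "v \<in> L2_fun M"
  shows "hdist (L2 M) (L2_class M u) (L2_class M v) = sqrt (\<integral>x. (norm (u x - v x))\<^sup>2 \<partial>M)"
proof -
  have "hdist (L2 M) (L2_class M u) (L2_class M v) = hnorm (L2 M) (L2_class M (\<lambda>x. u x + (-1) *\<^sub>C v x))"
    unfolding hdist_def hscale_L2_class[OF assms(2)] using assms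
    by (subst hadd_L2_class) (auto intro: L2_fun_scaleC)
  also have "(\<lambda>x. u x + (-1) *\<^sub>C v x) = (\<lambda>x. u x - v x)" by (simp add: scaleC_minus1_left)
  finally have "hdist (L2 M) (L2_class M u) (L2_class M v) = hnorm (L2 M) (L2_class M (\<lambda>x. u x - v x))" .
  thus ?thesis using assms by (simp add: hnorm_L2_class L2_fun_diff)
qed

lemma hnorm_sq_L2_class:
  fixes u :: "'x \<Rightarrow> 'a::{complex_hilbert_space, second_countable_topology}"
  assumes "u \<in> L2_fun M"
  shows "ennreal ((hnorm (L2 M) (L2_class M u))\<^sup>2) = (\<integral>\<^sup>+x. ennreal ((norm (u x))\<^sup>2) \<partial>M)"
  using assms by (simp add: hnorm_L2_class nn_integral_norm_sq)

lemma hdist_sq_L2_class: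
  fixes u v :: "'x \<Rightarrow> 'a::{complex_hilbert_space, second_countable_topology}"
  assumes "u \<in> L2_fun M" "v \<in> L2_fun M"
  shows "ennreal ((hdist (L2 M) (L2_class M u) (L2_class M v))\<^sup>2) = (\<integral>\<^sup>+x. ennreal ((norm (u x - v x))\<^sup>2) \<partial>M)"
  using assms by (simp add: hdist_L2_class nn_integral_norm_sq[OF L2_fun_diff])

lemma L2_carrierE:
  fixes a :: "('x \<Rightarrow> 'a::{complex_hilbert_space, second_countable_topology}) set"
  assumes "a \<in> hcarrier (L2 M)"
  obtains u where "u \<in> L2_fun M" "a = L2_class M u"
  using L2_rep[OF assms] by metis

text \<open>Riesz-Fischer: along a subsequence with fast decaying \<open>\<parallel>u\<^sub>i\<^sub>+\<^sub>1 - u\<^sub>i\<parallel>\<^sub>2\<close> the weighted sum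
  \<open>\<Sum>i. 4\<^sup>i |u\<^sub>i\<^sub>+\<^sub>1 - u\<^sub>i|\<^sup>2\<close> is integrable, hence finite almost everywhere.\<close>

lemma L2_complete:
  fixes u :: "nat \<Rightarrow> 'x \<Rightarrow> 'a::{complex_hilbert_space, second_countable_topology}"
  assumes u: "\<And>n. u n \<in> L2_fun M"
    and cauchy: "\<And>e. 0 < e \<Longrightarrow> \<exists>k. \<forall>m\<ge>k. \<forall>n\<ge>k. (\<integral>\<^sup>+x. ennreal ((norm (u m x - u n x))\<^sup>2) \<partial>M) \<le> ennreal e"
  shows "\<exists>v\<in>L2_fun M. \<forall>e>0. \<exists>k. \<forall>n\<ge>k. (\<integral>\<^sup>+x. ennreal ((norm (u n x - v x))\<^sup>2) \<partial>M) \<le> ennreal e"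
proof -
  have [measurable]: "u n \<in> borel_measurable M" for n using u by (rule L2_fun_measurable)
  have "\<exists>k. \<forall>m\<ge>k. \<forall>n\<ge>k. (\<integral>\<^sup>+x. ennreal ((norm (u m x - u n x))\<^sup>2) \<partial>M) \<le> ennreal ((1/8) ^ i)" for i :: nat
    by (rule cauchy) simp
  then obtain k0 where k0: "\<And>i m n. \<lbrakk>m \<ge> k0 i; n \<ge> k0 i\<rbrakk> \<Longrightarrow>
      (\<integral>\<^sup>+x. ennreal ((norm (u m x - u n x))\<^sup>2) \<partial>M) \<le> ennreal ((1/8) ^ i)" by metis
  \<comment> \<open>Prefix sums make k i and k (i+1) both at least k0 i, so consecutive terms fall
    under the i-th Cauchy bound; the summand i sends k to infinity.\<close>
  define k where "k i = (\<Sum>j\<le>i. k0 j) + i" for i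
  have k_ge: "k i \<ge> k0 i" "k i \<ge> i" for i
  proof -
    have "k0 i \<le> (\<Sum>j\<le>i. k0 j)" by (rule member_le_sum) auto
    thus "k i \<ge> k0 i" "k i \<ge> i" by (simp_all add: k_def)
  qed
  have k_Suc: "k (Suc i) \<ge> k0 i" for i
    using k_ge(1)[of i] by (simp add: k_def)
  \<comment> \<open>Squared norms of the increments are at most (1/8)^i, so the weights 4^i still
    leave a geometric series with ratio 1/2.\<close>
  define d where "d i x = norm (u (k (Suc i)) x - u (k i) x)" for i x
  have [measurable]: "d i \<in> borel_measurable M" for i unfolding d_def by measurable
  have "(\<integral>\<^sup>+x. (\<Sum>i. ennreal (4 ^ i * (d i x)\<^sup>2)) \<partial>M) = (\<Sum>i. \<integral>\<^sup>+x. ennreal (4 ^ i * (d i x)\<^sup>2) \<partial>M)"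
    by (rule nn_integral_suminf) measurable
  also have "\<dots> \<le> (\<Sum>i. ennreal ((1/2) ^ i))"
  proof (intro suminf_le allI summableI)
    fix i
    have "(\<integral>\<^sup>+x. ennreal (4 ^ i * (d i x)\<^sup>2) \<partial>M) = ennreal (4 ^ i) * (\<integral>\<^sup>+x. ennreal ((d i x)\<^sup>2) \<partial>M)"
      by (subst nn_integral_cmult[symmetric]) (auto simp: ennreal_mult)
    also have "\<dots> \<le> ennreal (4 ^ i) * ennreal ((1/8) ^ i)"
      unfolding d_def using k_ge k_Suc by (intro mult_left_mono k0) auto
    also have "\<dots> = ennreal ((1/2) ^ i)"
      by (simp add: ennreal_mult[symmetric] power_mult_distrib[symmetric])
    finally show "(\<integral>\<^sup>+x. ennreal (4 ^ i * (d i x)\<^sup>2) \<partial>M) \<le> ennreal ((1/2) ^ i)" .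
  qed
  also have "\<dots> = ennreal (\<Sum>i. (1/2) ^ i)"
    by (rule suminf_ennreal2) (auto simp: summable_geometric)
  also have "\<dots> < \<infinity>" by simp
  finally have "AE x in M. (\<Sum>i. ennreal (4 ^ i * (d i x)\<^sup>2)) \<noteq> \<infinity>"
    by (intro nn_integral_noteq_infinite) auto
  hence conv: "AE x in M. convergent (\<lambda>i. u (k i) x)"
  proof eventually_elim
    fix x
    define h where "h i = ennreal (4 ^ i * (d i x)\<^sup>2)" for i
    assume "(\<Sum>i. ennreal (4 ^ i * (d i x)\<^sup>2)) \<noteq> \<infinity>"
    hence "suminf h \<noteq> \<infinity>" unfolding h_def[abs_def] .
    then obtain G where G: "0 \<le> G" "suminf h = ennreal G"
      by (metis ennreal_cases infinity_ennreal_def)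
    \<comment> \<open>Finiteness of the weighted sum at x gives increments of order 2^(-i), hence an
      absolutely convergent telescoping series.\<close>
    have dle: "d i x \<le> sqrt G * (1/2) ^ i" for i
    proof -
      have "sum h {i} \<le> suminf h" by (intro sum_le_suminf summableI) auto
      hence "ennreal (4 ^ i * (d i x)\<^sup>2) \<le> ennreal G" by (simp add: G h_def)
      hence "4 ^ i * (d i x)\<^sup>2 \<le> G" using G(1) by simp
      moreover have "(2::real) ^ i * 2 ^ i = 4 ^ i" by (simp add: power_mult_distrib[symmetric])
      hence "(2 ^ i * d i x)\<^sup>2 = 4 ^ i * (d i x)\<^sup>2"
        by (simp add: power_mult_distrib power2_eq_square)
      ultimately have "2 ^ i * d i x \<le> sqrt G" by (intro real_le_rsqrt) simp
      thus ?thesis by (simp add: field_simps power_one_over)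
    qed
    have "summable (\<lambda>i. sqrt G * (1/2) ^ i)" by (intro summable_mult summable_geometric) simp
    hence "summable (\<lambda>i. u (k (Suc i)) x - u (k i) x)"
      by (rule summable_comparison_test'[where N = 0]) (use dle in \<open>simp add: d_def\<close>)
    hence "convergent (\<lambda>n. \<Sum>i<n. u (k (Suc i)) x - u (k i) x)" by (simp add: summable_iff_convergent)
    hence "convergent (\<lambda>n. u (k n) x - u (k 0) x)" by (simp only: sum_lessThan_telescope[of "\<lambda>i. u (k i) x"])
    from convergent_add[OF this convergent_const[of "u (k 0) x"]]
    show "convergent (\<lambda>i. u (k i) x)" by simp
  qed
  define v where "v x = lim (\<lambda>i. u (k i) x)" for x
  have v_meas [measurable]: "v \<in> borel_measurable M" unfolding v_def by measurable
  have lim: "AE x in M. (\<lambda>i. u (k i) x) \<longlonglongrightarrow> v x"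
    using conv by eventually_elim (simp add: v_def convergent_LIMSEQ_iff)
  have main: "\<exists>K. \<forall>n\<ge>K. (\<integral>\<^sup>+x. ennreal ((norm (u n x - v x))\<^sup>2) \<partial>M) \<le> ennreal e" if e: "e > 0" for e
  proof -
    obtain K where K: "\<And>m n. \<lbrakk>m \<ge> K; n \<ge> K\<rbrakk> \<Longrightarrow> (\<integral>\<^sup>+x. ennreal ((norm (u m x - u n x))\<^sup>2) \<partial>M) \<le> ennreal e"
      using cauchy[OF e] by blast
    have "(\<integral>\<^sup>+x. ennreal ((norm (u n x - v x))\<^sup>2) \<partial>M) \<le> ennreal e" if n: "n \<ge> K" for n
    proof -
      have "(\<integral>\<^sup>+x. ennreal ((norm (u n x - v x))\<^sup>2) \<partial>M) =
          (\<integral>\<^sup>+x. liminf (\<lambda>i. ennreal ((norm (u n x - u (k i) x))\<^sup>2)) \<partial>M)"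
      \<comment> \<open>Preparation for Fatou: |u n - v|^2 is the pointwise limit along the
        subsequence, and the integrals with u (k i) in place of v are at most e for large i.\<close>
      proof (rule nn_integral_cong_AE)
        show "AE x in M. ennreal ((norm (u n x - v x))\<^sup>2) = liminf (\<lambda>i. ennreal ((norm (u n x - u (k i) x))\<^sup>2))"
          using lim
        proof eventually_elim
          fix x assume l: "(\<lambda>i. u (k i) x) \<longlonglongrightarrow> v x"
          have "(\<lambda>i. ennreal ((norm (u n x - u (k i) x))\<^sup>2)) \<longlonglongrightarrow> ennreal ((norm (u n x - v x))\<^sup>2)"
            by (intro tendsto_ennrealI tendsto_power tendsto_norm tendsto_diff tendsto_const l)
          thus "ennreal ((norm (u n x - v x))\<^sup>2) = liminf (\<lambda>i. ennreal ((norm (u n x - u (k i) x))\<^sup>2))"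
            by (intro lim_imp_Liminf[symmetric]) simp_all
        qed
      qed
      also have "\<dots> \<le> liminf (\<lambda>i. \<integral>\<^sup>+x. ennreal ((norm (u n x - u (k i) x))\<^sup>2) \<partial>M)"
        by (intro nn_integral_liminf) measurable
      also have "\<dots> \<le> liminf (\<lambda>i. ennreal e)"
      proof (rule Liminf_mono)
        show "\<forall>\<^sub>F i in sequentially. (\<integral>\<^sup>+x. ennreal ((norm (u n x - u (k i) x))\<^sup>2) \<partial>M) \<le> ennreal e"
          using eventually_ge_at_top[of K]
        proof eventually_elim
          fix i assume "i \<ge> K"
          thus "(\<integral>\<^sup>+x. ennreal ((norm (u n x - u (k i) x))\<^sup>2) \<partial>M) \<le> ennreal e"
            using k_ge(2)[of i] n by (intro K) linarith+
        qed
      qed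
      also have "\<dots> = ennreal e" by (simp add: Liminf_const)
      finally show ?thesis .
    qed
    thus ?thesis by blast
  qed
  obtain K where "(\<integral>\<^sup>+x. ennreal ((norm (u K x - v x))\<^sup>2) \<partial>M) \<le> ennreal 1"
    using main[of 1] by auto
  hence "(\<integral>\<^sup>+x. ennreal ((norm (u K x - v x))\<^sup>2) \<partial>M) < top" by (rule order_le_less_trans) simp
  hence "(\<lambda>x. u K x - v x) \<in> L2_fun M" by (simp add: L2_fun_def)
  from L2_fun_diff[OF u[of K] this] have "v \<in> L2_fun M" by simp
  thus ?thesis using main by blast
qed

lemma hilbert_L2:
  "hilbert (L2 M :: ('x \<Rightarrow> 'a::{complex_hilbert_space, second_countable_topology}) set hspace)"
proof
  let ?E = "L2 M :: ('x \<Rightarrow> 'a) set hspace"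
  show "hcarrier ?E \<noteq> {}" using L2_class_closed[OF L2_fun_zero] by blast
  fix a b c :: "('x \<Rightarrow> 'a) set" and z :: complex
  assume a: "a \<in> hcarrier ?E"
  then obtain u where u: "u \<in> L2_fun M" "a = L2_class M u" by (rule L2_carrierE)
  show "hscale ?E z a \<in> hcarrier ?E" using u by (simp add: hscale_L2_class L2_fun_scaleC)
  show "0 \<le> Re (hinner ?E a a)"
  proof -
    have "hinner ?E a a = (\<integral>x. complex_of_real ((norm (u x))\<^sup>2) \<partial>M)"
      using u by (simp add: hinner_L2_class cinner_self del: of_real_power)
    also have "\<dots> = complex_of_real (\<integral>x. (norm (u x))\<^sup>2 \<partial>M)"
      by (rule integral_of_real) (use u in \<open>simp add: L2_fun_iff\<close>)
    finally show ?thesis by simp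
  qed
  assume b: "b \<in> hcarrier ?E"
  then obtain v where v: "v \<in> L2_fun M" "b = L2_class M v" by (rule L2_carrierE)
  show "hadd ?E a b \<in> hcarrier ?E" using u v by (simp add: hadd_L2_class L2_fun_add)
  show "hinner ?E a b = cnj (hinner ?E b a)"
  proof -
    have "(\<integral>x. cinner (u x) (v x) \<partial>M) = (\<integral>x. cnj (cinner (v x) (u x)) \<partial>M)"
      by (simp only: cinner_commute[symmetric])
    thus ?thesis using u v by (simp add: hinner_L2_class)
  qed
  show "hinner ?E a (hscale ?E z b) = z * hinner ?E a b"
    using u v by (simp add: hscale_L2_class L2_fun_scaleC hinner_L2_class cinner_scaleC_right)
  show "a = b" if "hdist ?E a b = 0"
  proof -
    have "(\<integral>x. (norm (u x - v x))\<^sup>2 \<partial>M) = 0" using that u v by (simp add: hdist_L2_class)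
    moreover have "integrable M (\<lambda>x. (norm (u x - v x))\<^sup>2)"
      using L2_fun_diff[OF u(1) v(1)] by (simp add: L2_fun_iff)
    ultimately have "AE x in M. (norm (u x - v x))\<^sup>2 = 0"
      by (subst (asm) integral_nonneg_eq_0_iff_AE) auto
    hence "AE x in M. u x = v x" by eventually_elim simp
    thus ?thesis using u v by (simp add: L2_class_eq_iff)
  qed
  assume "c \<in> hcarrier ?E"
  then obtain w where w: "w \<in> L2_fun M" "c = L2_class M w" by (rule L2_carrierE)
  show "hinner ?E a (hadd ?E b c) = hinner ?E a b + hinner ?E a c"
    using u v w
    by (simp add: hadd_L2_class L2_fun_add hinner_L2_class cinner_add_right integrable_cinner)
next
  let ?E = "L2 M :: ('x \<Rightarrow> 'a) set hspace"
  fix s :: "nat \<Rightarrow> ('x \<Rightarrow> 'a) set"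
  assume s: "\<And>n. s n \<in> hcarrier ?E"
    and cauchy: "\<And>e. 0 < e \<Longrightarrow> \<exists>k. \<forall>m\<ge>k. \<forall>n\<ge>k. hdist ?E (s m) (s n) < e"
  define u where "u n = L2_rep (s n)" for n
  have u: "u n \<in> L2_fun M" "s n = L2_class M (u n)" for n using s by (simp_all add: u_def)
  have dn: "0 \<le> hdist ?E (s m) (s n)" for m n using u by (simp add: hdist_L2_class)
  have "\<exists>v\<in>L2_fun M. \<forall>e>0. \<exists>k. \<forall>n\<ge>k. (\<integral>\<^sup>+x. ennreal ((norm (u n x - v x))\<^sup>2) \<partial>M) \<le> ennreal e"
  proof (rule L2_complete[OF u(1)])
    fix e :: real assume e: "0 < e"
    obtain k where k: "\<And>m n. \<lbrakk>m \<ge> k; n \<ge> k\<rbrakk> \<Longrightarrow> hdist ?E (s m) (s n) < sqrt e"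
      using cauchy[of "sqrt e"] e by auto
    have "(\<integral>\<^sup>+x. ennreal ((norm (u m x - u n x))\<^sup>2) \<partial>M) \<le> ennreal e" if "m \<ge> k" "n \<ge> k" for m n
    proof -
      have "(hdist ?E (s m) (s n))\<^sup>2 \<le> (sqrt e)\<^sup>2"
        using k[OF that] dn by (intro power_mono) auto
      hence "ennreal ((hdist ?E (s m) (s n))\<^sup>2) \<le> ennreal e" using e by (intro ennreal_leI) simp
      thus ?thesis using hdist_sq_L2_class[OF u(1) u(1), of m n] u(2) by simp
    qed
    thus "\<exists>k. \<forall>m\<ge>k. \<forall>n\<ge>k. (\<integral>\<^sup>+x. ennreal ((norm (u m x - u n x))\<^sup>2) \<partial>M) \<le> ennreal e" by blast
  qed
  then obtain v where v: "v \<in> L2_fun M"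
    "\<And>e. e > 0 \<Longrightarrow> \<exists>k. \<forall>n\<ge>k. (\<integral>\<^sup>+x. ennreal ((norm (u n x - v x))\<^sup>2) \<partial>M) \<le> ennreal e" by blast
  have "(\<lambda>n. hdist ?E (s n) (L2_class M v)) \<longlonglongrightarrow> 0"
  proof (rule LIMSEQ_I)
    fix r :: real assume r: "0 < r"
    obtain k where k: "\<And>n. n \<ge> k \<Longrightarrow> (\<integral>\<^sup>+x. ennreal ((norm (u n x - v x))\<^sup>2) \<partial>M) \<le> ennreal ((r/2)\<^sup>2)"
      using v(2)[of "(r/2)\<^sup>2"] r by auto
    have "norm (hdist ?E (s n) (L2_class M v) - 0) < r" if "n \<ge> k" for n
    proof -
      have "ennreal ((hdist ?E (s n) (L2_class M v))\<^sup>2) \<le> ennreal ((r/2)\<^sup>2)"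
        using k[OF that] hdist_sq_L2_class[OF u(1) v(1), of n] u(2)[of n] by simp
      hence "(hdist ?E (s n) (L2_class M v))\<^sup>2 \<le> (r/2)\<^sup>2" by simp
      hence "hdist ?E (s n) (L2_class M v) \<le> r/2" by (rule power2_le_imp_le) (use r in simp)
      moreover have "0 \<le> hdist ?E (s n) (L2_class M v)"
        using u[of n] v by (simp add: hdist_L2_class)
      ultimately show ?thesis using r by simp
    qed
    thus "\<exists>no. \<forall>n\<ge>no. norm (hdist ?E (s n) (L2_class M v) - 0) < r" by blast
  qed
  thus "\<exists>l\<in>hcarrier ?E. (\<lambda>n. hdist ?E (s n) l) \<longlonglongrightarrow> 0" using v(1) by (intro bexI) auto
qed

end

section \<open>Operator-valued functions and tails of weak type functions\<close>

lemma bounded_op_type_hspace_bounded_linear: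
  assumes "bounded_op type_hspace type_hspace T"
  shows "bounded_linear (T :: 'a::complex_hilbert_space \<Rightarrow> 'b::complex_hilbert_space)"
proof -
  have lin: "linear_op type_hspace type_hspace T" using assms by (rule bounded_op_linear)
  obtain B where "\<And>x. norm (T x) \<le> B * norm x" using assms by (auto simp: bounded_op_def)
  thus ?thesis
    using linear_op_add[OF lin] linear_op_scale[OF lin]
    by (intro bounded_linear_intro[of T B]) (auto simp: scaleR_scaleC mult.commute)
qed

lemma bounded_op_type_hspace_scaleC:
  "bounded_op type_hspace type_hspace T \<Longrightarrow> T (c *\<^sub>C x) = c *\<^sub>C T x"
  using linear_op_scale[OF bounded_op_linear, of type_hspace type_hspace T x c] by simp

text \<open>For a simple function the claim is a finite sum of strongly measurable pieces with
  constant arguments; continuity of each \<open>f x\<close> passes to the limit.\<close>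

lemma borel_measurable_op_apply:
  fixes f :: "'x \<Rightarrow> 'a::{complex_hilbert_space, second_countable_topology} \<Rightarrow> 'a"
  assumes f: "op_measurable M f" and lin: "\<And>x. x \<in> space M \<Longrightarrow> bounded_linear (f x)"
    and u: "u \<in> borel_measurable M"
  shows "(\<lambda>x. f x (u x)) \<in> borel_measurable M"
proof -
  obtain s where s: "\<And>i. simple_function M (s i)" "\<And>x. x \<in> space M \<Longrightarrow> (\<lambda>i. s i x) \<longlonglongrightarrow> u x"
    using borel_measurable_implies_sequence_metric[OF u, of 0] by blast
  have "(\<lambda>x. f x (s i x)) \<in> borel_measurable M" for i
  proof -
    have fin: "finite (s i ` space M)" using s(1) by (rule simple_functionD)
    have [measurable]: "(\<lambda>x. f x h) \<in> borel_measurable M" for h using f by (simp add: op_measurable_def)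
    have [measurable]: "s i -` {h} \<inter> space M \<in> sets M" for h using s(1) by (rule simple_functionD)
    have "f x (s i x) = (\<Sum>h\<in>s i ` space M. indicator (s i -` {h} \<inter> space M) x *\<^sub>R f x h)"
      if x: "x \<in> space M" for x
    proof -
      have "(\<Sum>h\<in>s i ` space M. indicator (s i -` {h} \<inter> space M) x *\<^sub>R f x h) =
          (\<Sum>h\<in>s i ` space M. if h = s i x then f x h else 0)"
        using x by (intro sum.cong) (auto simp: indicator_def)
      thus ?thesis using fin x by (simp add: sum.delta)
    qed
    moreover have "(\<lambda>x. \<Sum>h\<in>s i ` space M. indicator (s i -` {h} \<inter> space M) x *\<^sub>R f x h) \<in> borel_measurable M"
      by (intro borel_measurable_sum borel_measurable_scaleR borel_measurable_indicator) measurable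
    ultimately show ?thesis by (subst measurable_cong) auto
  qed
  moreover have "(\<lambda>i. f x (s i x)) \<longlonglongrightarrow> f x (u x)" if "x \<in> space M" for x
    using bounded_linear.tendsto[OF lin[OF that] s(2)[OF that]] .
  ultimately show ?thesis by (rule borel_measurable_LIMSEQ_metric)
qed

text \<open>Strong measurability controls one vector at a time, so a superlevel set of the operator
  norm has to be a countable union over vectors. Separability provides the countable dense
  set.\<close>

lemma borel_measurable_onorm:
  fixes g :: "'x \<Rightarrow> 'a::{complex_hilbert_space, second_countable_topology} \<Rightarrow> 'a"
  assumes g: "op_measurable M g" and lin: "\<And>x. x \<in> space M \<Longrightarrow> bounded_linear (g x)"
  shows "(\<lambda>x. onorm (g x)) \<in> borel_measurable M"
proof -
  obtain D :: "'a set" where D: "countable D" "\<And>X. open X \<Longrightarrow> X \<noteq> {} \<Longrightarrow> \<exists>d\<in>D. d \<in> X"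
    using countable_dense_exists by blast
  have [measurable]: "(\<lambda>x. g x h) \<in> borel_measurable M" for h using g by (simp add: op_measurable_def)
  \<comment> \<open>The vectors h with |g x h| > a |h| form an open set. If the norm exceeds a, it
    is nonempty and meets the dense set D.\<close>
  have iff: "a < onorm (g x) \<longleftrightarrow> (\<exists>h\<in>D. a * norm h < norm (g x h))"
    if x: "x \<in> space M" and a: "0 \<le> a" for x a
  proof
    assume less: "a < onorm (g x)"
    let ?X = "{h. a * norm h < norm (g x h)}"
    have "?X \<noteq> {}"
    proof
      assume "?X = {}"
      hence "norm (g x h) \<le> a * norm h" for h by (auto simp: not_less)
      hence "onorm (g x) \<le> a" using a by (rule onorm_bound[rotated])
      thus False using less by simp
    qed
    moreover have "open ?X"
      using linear_continuous_on[OF lin[OF x]]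
      by (intro open_Collect_less continuous_intros) auto
    ultimately show "\<exists>h\<in>D. a * norm h < norm (g x h)" using D(2)[of ?X] by blast
  next
    assume "\<exists>h\<in>D. a * norm h < norm (g x h)"
    then obtain h where h: "a * norm h < norm (g x h)" by blast
    show "a < onorm (g x)"
    proof (rule ccontr)
      assume "\<not> a < onorm (g x)"
      hence "onorm (g x) * norm h \<le> a * norm h" by (intro mult_right_mono) auto
      thus False using onorm[OF lin[OF x], of h] h by linarith
    qed
  qed
  show ?thesis
  proof (rule borel_measurable_iff_greater[THEN iffD2], rule allI)
    fix a :: real
    show "{x \<in> space M. a < onorm (g x)} \<in> sets M"
    proof (cases "0 \<le> a")
      case True
      hence "{x \<in> space M. a < onorm (g x)} = (\<Union>h\<in>D. {x \<in> space M. a * norm h < norm (g x h)})"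
        using iff by blast
      also have "\<dots> \<in> sets M" using D(1) by (intro sets.countable_UN') auto
      finally show ?thesis .
    next
      case False
      hence "{x \<in> space M. a < onorm (g x)} = space M"
        using onorm_pos_le[OF lin] by (auto intro: less_le_trans simp: not_le)
      thus ?thesis by simp
    qed
  qed
qed

text \<open>Weighted arithmetic-geometric mean, with weights balanced so that the two halves add up
  to X Y. Enlarging X and Y slightly permits division when one of them is 0.\<close>

lemma nn_integral_Cauchy_Schwarz_le:
  fixes f g :: "'x \<Rightarrow> real"
  assumes [measurable]: "f \<in> borel_measurable M" "g \<in> borel_measurable M"
    and f: "(\<integral>\<^sup>+x. ennreal ((f x)\<^sup>2) \<partial>M) \<le> ennreal (X\<^sup>2)"
    and g: "(\<integral>\<^sup>+x. ennreal ((g x)\<^sup>2) \<partial>M) \<le> ennreal (Y\<^sup>2)" and XY: "0 \<le> X" "0 \<le> Y"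
  shows "(\<integral>\<^sup>+x. ennreal (f x * g x) \<partial>M) \<le> ennreal (X * Y)"
proof (rule ennreal_le_epsilon)
  fix e :: real assume e: "0 < e"
  define \<epsilon> where "\<epsilon> = min 1 (e / (X + Y + 1))"
  have eps: "0 < \<epsilon>" "\<epsilon> \<le> 1" "\<epsilon> * (X + Y + 1) \<le> e"
  proof -
    show "0 < \<epsilon>" "\<epsilon> \<le> 1" using e XY by (auto simp: \<epsilon>_def)
    have "\<epsilon> \<le> e / (X + Y + 1)" by (simp add: \<epsilon>_def)
    thus "\<epsilon> * (X + Y + 1) \<le> e" using XY by (simp add: pos_le_divide_eq)
  qed
  define X' where "X' = X + \<epsilon>"
  define Y' where "Y' = Y + \<epsilon>"
  have pos: "0 < X'" "0 < Y'" "X \<le> X'" "Y \<le> Y'" using XY eps by (auto simp: X'_def Y'_def)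
  define \<alpha> where "\<alpha> = Y' / (2 * X')"
  define \<beta> where "\<beta> = X' / (2 * Y')"
  have ab: "0 < \<alpha>" "0 < \<beta>" using pos by (auto simp: \<alpha>_def \<beta>_def)
  have amgm: "f x * g x \<le> \<alpha> * (f x)\<^sup>2 + \<beta> * (g x)\<^sup>2" for x
  proof -
    have "0 \<le> (Y' * f x - X' * g x)\<^sup>2" by simp
    hence "2 * X' * Y' * (f x * g x) \<le> Y'\<^sup>2 * (f x)\<^sup>2 + X'\<^sup>2 * (g x)\<^sup>2"
      by (simp add: power2_eq_square algebra_simps)
    thus ?thesis using pos by (simp add: \<alpha>_def \<beta>_def field_simps power2_eq_square)
  qed
  have "(\<integral>\<^sup>+x. ennreal (f x * g x) \<partial>M) \<le> (\<integral>\<^sup>+x. ennreal \<alpha> * ennreal ((f x)\<^sup>2) + ennreal \<beta> * ennreal ((g x)\<^sup>2) \<partial>M)"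
    using amgm ab by (intro nn_integral_mono) (simp add: ennreal_mult[symmetric] ennreal_plus[symmetric] ennreal_leI del: ennreal_plus)
  also have "\<dots> = ennreal \<alpha> * (\<integral>\<^sup>+x. ennreal ((f x)\<^sup>2) \<partial>M) + ennreal \<beta> * (\<integral>\<^sup>+x. ennreal ((g x)\<^sup>2) \<partial>M)"
    by (subst nn_integral_add) (auto simp: nn_integral_cmult)
  also have "\<dots> \<le> ennreal \<alpha> * ennreal (X\<^sup>2) + ennreal \<beta> * ennreal (Y\<^sup>2)"
    using f g by (intro add_mono mult_left_mono) auto
  also have "\<dots> = ennreal (\<alpha> * X\<^sup>2 + \<beta> * Y\<^sup>2)" using ab by (simp add: ennreal_mult ennreal_plus)
  also have "\<dots> \<le> ennreal (X * Y + e)"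
  proof (rule ennreal_leI)
    have "\<alpha> * X\<^sup>2 \<le> \<alpha> * X'\<^sup>2" "\<beta> * Y\<^sup>2 \<le> \<beta> * Y'\<^sup>2"
      using ab pos XY by (auto intro!: mult_left_mono power_mono)
    moreover have "\<alpha> * X'\<^sup>2 + \<beta> * Y'\<^sup>2 = X' * Y'"
      using pos by (simp add: \<alpha>_def \<beta>_def power2_eq_square)
    moreover have "X' * Y' = X * Y + \<epsilon> * (X + Y + \<epsilon>)" by (simp add: X'_def Y'_def algebra_simps)
    moreover have "\<epsilon> * (X + Y + \<epsilon>) \<le> \<epsilon> * (X + Y + 1)" using eps by (intro mult_left_mono) auto
    ultimately show "\<alpha> * X\<^sup>2 + \<beta> * Y\<^sup>2 \<le> X * Y + e" using eps(3) by linarith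
  qed
  also have "\<dots> = ennreal (X * Y) + ennreal e" using XY e by (simp add: ennreal_plus)
  finally show "(\<integral>\<^sup>+x. ennreal (f x * g x) \<partial>M) \<le> ennreal (X * Y) + ennreal e" .
qed

text \<open>The function \<open>b\<close> need not be measurable; its integral is then the lower integral.\<close>

lemma nn_integral_le_add_lower:
  assumes [measurable]: "F \<in> borel_measurable M" "G \<in> borel_measurable M"
    and le: "AE x in M. F x \<le> G x + ennreal k * b x" and fin: "\<And>x. F x \<noteq> \<infinity>" and k: "0 \<le> k"
  shows "(\<integral>\<^sup>+x. F x \<partial>M) \<le> (\<integral>\<^sup>+x. G x \<partial>M) + ennreal k * (\<integral>\<^sup>+x. b x \<partial>M)"
proof -
  \<comment> \<open>Truncated subtraction makes F - G measurable and nonnegative. It is at most k b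
    pointwise, so additivity is applied to G and F - G and never to b.\<close>
  have "F x \<le> G x + (F x - G x)" for x 
    using ennreal_minus_le_iff[of "F x" "G x" "F x - G x"] by simp
  hence "(\<integral>\<^sup>+x. F x \<partial>M) \<le> (\<integral>\<^sup>+x. G x + (F x - G x) \<partial>M)" by (intro nn_integral_mono)
  also have "\<dots> = (\<integral>\<^sup>+x. G x \<partial>M) + (\<integral>\<^sup>+x. F x - G x \<partial>M)" by (rule nn_integral_add) measurable
  also have "(\<integral>\<^sup>+x. F x - G x \<partial>M) \<le> ennreal k * (\<integral>\<^sup>+x. b x \<partial>M)"
  proof (cases "k = 0")
    case True
    have "(\<integral>\<^sup>+x. F x - G x \<partial>M) = (\<integral>\<^sup>+x. 0 \<partial>M)"
      using le fin by (intro nn_integral_cong_AE) (auto elim!: eventually_mono simp: True diff_eq_0_iff_ennreal less_top)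
    thus ?thesis by simp
  next
    case False
    hence k: "0 < k" using k by simp
    have kk: "ennreal k * ennreal (1 / k) = 1" using k by (simp add: ennreal_mult[symmetric])
    have "AE x in M. ennreal (1 / k) * (F x - G x) \<le> b x"
      using le
    proof eventually_elim
      fix x assume "F x \<le> G x + ennreal k * b x"
      hence "F x - G x \<le> ennreal k * b x" using fin[of x] by (simp add: ennreal_minus_le_iff)
      hence "ennreal (1 / k) * (F x - G x) \<le> ennreal (1 / k) * (ennreal k * b x)" by (rule mult_left_mono) simp
      also have "\<dots> = b x" using kk by (simp add: mult.assoc[symmetric] mult.commute)
      finally show "ennreal (1 / k) * (F x - G x) \<le> b x" .
    qed
    hence "(\<integral>\<^sup>+x. ennreal (1 / k) * (F x - G x) \<partial>M) \<le> (\<integral>\<^sup>+x. b x \<partial>M)" by (rule nn_integral_mono_AE)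
    hence "ennreal k * (\<integral>\<^sup>+x. ennreal (1 / k) * (F x - G x) \<partial>M) \<le> ennreal k * (\<integral>\<^sup>+x. b x \<partial>M)"
      by (rule mult_left_mono) simp
    also have "ennreal k * (\<integral>\<^sup>+x. ennreal (1 / k) * (F x - G x) \<partial>M) = (\<integral>\<^sup>+x. F x - G x \<partial>M)"
      using kk by (subst nn_integral_cmult) (auto simp: mult.assoc[symmetric])
    finally show ?thesis .
  qed
  finally show ?thesis by simp
qed

text \<open>Layer-cake representation of t^2 above T. The boundary term gives G T^(2-q) and the
  integral over higher levels gives 2 G/(q-2) T^(2-q); together they produce the factor q/(q-2).
  Convergence of the second integral is where q > 2 enters.\<close>

lemma nn_integral_tail_sq_le:
  fixes t :: "'y \<Rightarrow> real"
  assumes N: "sigma_finite_measure N" and [measurable]: "t \<in> borel_measurable N"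
    and weak: "\<And>\<tau>. 0 < \<tau> \<Longrightarrow> ennreal (\<tau> powr q) * emeasure N {y \<in> space N. \<tau> < t y} \<le> ennreal G"
    and G: "0 \<le> G" and q: "2 < q" and T: "0 < T"
  shows "(\<integral>\<^sup>+y. ennreal ((t y)\<^sup>2) * (if T < t y then 1 else 0) \<partial>N) \<le> ennreal (G * (q / (q - 2)) * T powr (2 - q))"
proof -
  interpret N: sigma_finite_measure N by (rule N)
  interpret pair_sigma_finite lborel N ..
  have em: "emeasure N {y \<in> space N. s < t y} \<le> ennreal (G * s powr (- q))" if s: "0 < s" for s
  proof -
    have "ennreal (s powr (- q)) * (ennreal (s powr q) * emeasure N {y \<in> space N. s < t y})
        \<le> ennreal (s powr (- q)) * ennreal G"
      by (intro mult_left_mono weak s) auto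
    also have "\<dots> = ennreal (G * s powr (- q))" using G by (simp add: ennreal_mult[symmetric] mult.commute)
    also have "ennreal (s powr (- q)) * (ennreal (s powr q) * emeasure N {y \<in> space N. s < t y}) =
        emeasure N {y \<in> space N. s < t y}"
      using s by (simp add: mult.assoc[symmetric] ennreal_mult[symmetric] powr_add[symmetric])
    finally show ?thesis .
  qed
  \<comment> \<open>Where t > T, t^2 is T^2 plus the integral of 2 s from T to t. Tonelli then leads
    to measures of superlevel sets, which the weak bound controls.\<close>
  have split: "ennreal ((t y)\<^sup>2) * (if T < t y then 1 else 0) =
      ennreal (T\<^sup>2) * (if T < t y then 1 else 0) + (\<integral>\<^sup>+s. (if T < s \<and> s < t y then ennreal (2 * s) else 0) \<partial>lborel)"
    for y
  proof (cases "T < t y")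
    case True
    have "(\<integral>\<^sup>+s. (if T < s \<and> s < t y then ennreal (2 * s) else 0) \<partial>lborel) =
        (\<integral>\<^sup>+s. ennreal (2 * s) * indicator {T..t y} s \<partial>lborel)"
      using AE_lborel_singleton[of T] AE_lborel_singleton[of "t y"]
      by (intro nn_integral_cong_AE) (auto elim!: eventually_elim2 simp: indicator_def)
    also have "\<dots> = ennreal ((t y)\<^sup>2 - T\<^sup>2)"
      using True T
      by (intro nn_integral_FTC_Icc) (auto intro!: derivative_eq_intros)
    finally show ?thesis using True T by (simp add: ennreal_plus[symmetric] power_mono del: ennreal_plus)
  next
    case False
    hence "(\<integral>\<^sup>+s. (if T < s \<and> s < t y then ennreal (2 * s) else 0) \<partial>lborel) = (\<integral>\<^sup>+s. 0 \<partial>(lborel :: real measure))"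
      by (intro nn_integral_cong) auto
    thus ?thesis using False by simp
  qed
  have tail: "(\<integral>\<^sup>+s. ennreal (2 * G * s powr (1 - q)) * indicator {T..} s \<partial>lborel) =
      ennreal (0 - (- (2 * G / (q - 2)) * T powr (2 - q)))"
  proof (rule nn_integral_FTC_atLeast)
    fix s assume s: "T \<le> s"
    show "((\<lambda>s. - (2 * G / (q - 2)) * s powr (2 - q)) has_real_derivative 2 * G * s powr (1 - q)) (at s)"
    proof -
      have c: "- (2 * G / (q - 2)) * (2 - q) = 2 * G" using q by (simp add: field_simps)
      have "((\<lambda>s. - (2 * G / (q - 2)) * s powr (2 - q)) has_real_derivative
          - (2 * G / (q - 2)) * ((2 - q) * s powr (2 - q - 1))) (at s)"
        using s T by (intro DERIV_cmult has_real_derivative_powr) auto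
      moreover have "2 - q - 1 = 1 - q" by simp
      ultimately show ?thesis by (simp only: mult.assoc[symmetric] c)
    qed
    show "0 \<le> 2 * G * s powr (1 - q)" using G by simp
  next
    have "((\<lambda>s. s powr (2 - q)) \<longlongrightarrow> 0) at_top"
      using q by (intro tendsto_neg_powr filterlim_ident) auto
    from tendsto_mult_left[OF this, of "- (2 * G / (q - 2))"]
    show "((\<lambda>s. - (2 * G / (q - 2)) * s powr (2 - q)) \<longlongrightarrow> 0) at_top" by simp
  qed measurable
  have [measurable]: "(\<lambda>y. \<integral>\<^sup>+s. (if T < s \<and> s < t y then ennreal (2 * s) else 0) \<partial>lborel) \<in> borel_measurable N"
    by (rule lborel.borel_measurable_nn_integral) measurable
  have "(\<integral>\<^sup>+y. ennreal ((t y)\<^sup>2) * (if T < t y then 1 else 0) \<partial>N) =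
      (\<integral>\<^sup>+y. ennreal (T\<^sup>2) * (if T < t y then 1 else 0) \<partial>N) +
      (\<integral>\<^sup>+y. \<integral>\<^sup>+s. (if T < s \<and> s < t y then ennreal (2 * s) else 0) \<partial>lborel \<partial>N)"
    unfolding split by (rule nn_integral_add) measurable
  also have "(\<integral>\<^sup>+y. ennreal (T\<^sup>2) * (if T < t y then 1 else 0) \<partial>N) = ennreal (T\<^sup>2) * emeasure N {y \<in> space N. T < t y}"
    by (subst nn_integral_cmult_indicator[symmetric]) (auto intro!: nn_integral_cong simp: indicator_def)
  also have "\<dots> \<le> ennreal (T\<^sup>2) * ennreal (G * T powr (- q))" using T by (intro mult_left_mono em) auto
  also have "\<dots> = ennreal (G * T powr (2 - q))"
  proof -
    have "T powr (2 - q) = T\<^sup>2 * T powr (- q)"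
      using T powr_add[of T 2 "- q"] by (simp add: powr_numeral)
    thus ?thesis using G by (simp add: ennreal_mult[symmetric] mult.left_commute)
  qed
  also have "(\<integral>\<^sup>+y. \<integral>\<^sup>+s. (if T < s \<and> s < t y then ennreal (2 * s) else 0) \<partial>lborel \<partial>N) =
      (\<integral>\<^sup>+s. \<integral>\<^sup>+y. (if T < s \<and> s < t y then ennreal (2 * s) else 0) \<partial>N \<partial>lborel)"
    by (rule Fubini') measurable
  also have "\<dots> \<le> (\<integral>\<^sup>+s. ennreal (2 * G * s powr (1 - q)) * indicator {T..} s \<partial>lborel)"
  proof (rule nn_integral_mono)
    fix s :: real
    show "(\<integral>\<^sup>+y. (if T < s \<and> s < t y then ennreal (2 * s) else 0) \<partial>N) \<le>
        ennreal (2 * G * s powr (1 - q)) * indicator {T..} s"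
    proof (cases "T < s")
      case True
      hence s: "0 < s" using T by simp
      have "(\<integral>\<^sup>+y. (if T < s \<and> s < t y then ennreal (2 * s) else 0) \<partial>N) =
          (\<integral>\<^sup>+y. ennreal (2 * s) * indicator {y \<in> space N. s < t y} y \<partial>N)"
        using True by (intro nn_integral_cong) (auto simp: indicator_def)
      also have "\<dots> = ennreal (2 * s) * emeasure N {y \<in> space N. s < t y}"
        by (rule nn_integral_cmult_indicator) measurable
      also have "\<dots> \<le> ennreal (2 * s) * ennreal (G * s powr (- q))" by (intro mult_left_mono em s) auto
      also have "\<dots> = ennreal (2 * G * s powr (1 - q))"
      proof -
        have "s powr (1 - q) = s * s powr (- q)" using s powr_add[of s 1 "- q"] by simp
        thus ?thesis using G s by (simp add: ennreal_mult[symmetric] mult.left_commute mult.assoc)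
      qed
      finally show ?thesis using True by simp
    qed simp
  qed
  also have "\<dots> = ennreal (2 * G / (q - 2) * T powr (2 - q))" unfolding tail by simp
  also have "ennreal (G * T powr (2 - q)) + ennreal (2 * G / (q - 2) * T powr (2 - q)) =
      ennreal (G * (q / (q - 2)) * T powr (2 - q))"
    using G q by (simp add: ennreal_plus[symmetric] field_simps del: ennreal_plus)
  finally show ?thesis by (simp add: add_mono)
qed

text \<open>The left side is a left Riemann sum of the increasing function s^p, hence below its
  integral; the mean value theorem gives this cell by cell.\<close>

lemma sum_powr_le_integral:
  assumes h: "0 < h" and p: "0 < p"
  shows "h * (\<Sum>i<m. (real i * h) powr p) \<le> (real m * h) powr (p + 1) / (p + 1)"
proof (induction m)
  case (Suc m)
  have "h * (real m * h) powr p \<le> ((real (Suc m) * h) powr (p + 1) - (real m * h) powr (p + 1)) / (p + 1)"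
  proof (cases "m = 0")
    case True
    thus ?thesis using h p by simp
  next
    case False
    hence m: "0 < real m * h" using h by simp
    have "\<exists>z. real m * h < z \<and> z < real (Suc m) * h \<and>
      (real (Suc m) * h) powr (p + 1) - (real m * h) powr (p + 1) = (real (Suc m) * h - real m * h) * ((p + 1) * z powr p)"
      using h m by (intro MVT2) (auto intro!: derivative_eq_intros simp: algebra_simps)
    then obtain z where z: "real m * h < z"
      "(real (Suc m) * h) powr (p + 1) - (real m * h) powr (p + 1) = h * ((p + 1) * z powr p)"
      by (auto simp: algebra_simps)
    have "(real m * h) powr p \<le> z powr p" using z(1) m p by (intro powr_mono2) auto
    hence "h * (real m * h) powr p \<le> h * z powr p" using h by simp
    also have "\<dots> = ((real (Suc m) * h) powr (p + 1) - (real m * h) powr (p + 1)) / (p + 1)"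
      using z(2) p by simp
    finally show ?thesis .
  qed
  thus ?case using Suc by (simp add: algebra_simps diff_divide_distrib)
qed simp

section \<open>The averaged level decomposition\<close>

lemma scaleC_zero_left [simp]: "0 *\<^sub>C x = (0 :: 'a::complex_hilbert_space)"
  using norm_scaleC[of 0 x] by simp

text \<open>The layer-cake step: \<open>\<sigma> \<rho>\<close> is averaged over the levels \<open>i h < l \<sigma>\<close>, so that each level
  enters with the same weight \<open>h / l\<close> whatever \<open>\<sigma>\<close> is.\<close>

lemma level_average_le:
  fixes \<alpha> :: "nat \<Rightarrow> real"
  assumes pos: "0 < h" "0 < l" "0 < d" "2 < q" "0 \<le> A" "0 \<le> \<sigma>" "0 \<le> \<rho>" "\<And>i. 0 \<le> \<alpha> i"
    and le: "\<And>i. \<rho> \<le> (1 + d) * \<alpha> i + (1 + 1 / d) * (A * (real i * h) powr (q / 2 - 1))"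
  shows "\<exists>m. \<forall>m'\<ge>m. \<sigma> * \<rho> \<le> (1 + d) / l * (\<Sum>i<m'. h * \<alpha> i) + h / l * \<rho> +
    (1 + 1 / d) * A * l powr (q / 2 - 1) * (2 / q) * \<sigma> powr (q / 2)"
proof (intro exI allI impI)
  \<comment> \<open>The number of full mesh cells below l \<sigma>. The incomplete last cell costs
    at most the term h/l \<rho>. Further levels only enlarge the right side, so the bound persists
    for all m' >= m and finitely many vectors can share one cutoff.\<close>
  define m where "m = nat \<lfloor>l * \<sigma> / h\<rfloor>"
  fix m' assume m': "m \<le> m'"
  have fl: "real m \<le> l * \<sigma> / h" "l * \<sigma> / h \<le> real m + 1"
    using pos by (auto simp: m_def of_nat_nat)
  have "real m * h \<le> l * \<sigma>" using fl(1) pos by (simp add: pos_le_divide_eq)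
  have "\<sigma> * \<rho> = h / l * ((l * \<sigma> / h) * \<rho>)" using pos by simp
  also have "\<dots> \<le> h / l * ((real m + 1) * \<rho>)"
    using fl pos by (intro mult_left_mono mult_right_mono) auto
  also have "\<dots> = 1 / l * (\<Sum>i<m. h * \<rho>) + h / l * \<rho>" using pos by (simp add: field_simps)
  finally have 1: "\<sigma> * \<rho> \<le> 1 / l * (\<Sum>i<m. h * \<rho>) + h / l * \<rho>" .
  let ?Z = "h * (\<Sum>i<m. (real i * h) powr (q / 2 - 1))"
  have "?Z \<le> (real m * h) powr (q / 2 - 1 + 1) / (q / 2 - 1 + 1)"
    using pos by (intro sum_powr_le_integral) auto
  also have "\<dots> = (2 / q) * (real m * h) powr (q / 2)" by simp
  also have "\<dots> \<le> (2 / q) * (l * \<sigma>) powr (q / 2)"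
    using pos \<open>real m * h \<le> l * \<sigma>\<close> by (intro mult_left_mono powr_mono2) auto
  also have "(l * \<sigma>) powr (q / 2) = l powr (q / 2) * \<sigma> powr (q / 2)" using pos by (simp add: powr_mult)
  finally have 2: "?Z \<le> (2 / q) * (l powr (q / 2) * \<sigma> powr (q / 2))" .
  have "(\<Sum>i<m. h * \<rho>) \<le> (\<Sum>i<m. h * ((1 + d) * \<alpha> i + (1 + 1 / d) * (A * (real i * h) powr (q / 2 - 1))))"
    using pos le by (intro sum_mono mult_left_mono) auto
  also have "\<dots> = (1 + d) * (\<Sum>i<m. h * \<alpha> i) + (1 + 1 / d) * A * ?Z"
    by (simp add: sum_distrib_left sum.distrib algebra_simps)
  also have "\<dots> \<le> (1 + d) * (\<Sum>i<m'. h * \<alpha> i) +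
      (1 + 1 / d) * A * ((2 / q) * (l powr (q / 2) * \<sigma> powr (q / 2)))"
    using m' pos 2 by (intro add_mono mult_left_mono sum_mono2) auto
  finally have "1 / l * (\<Sum>i<m. h * \<rho>) \<le> 1 / l * ((1 + d) * (\<Sum>i<m'. h * \<alpha> i) +
      (1 + 1 / d) * A * ((2 / q) * (l powr (q / 2) * \<sigma> powr (q / 2))))"
    using pos by (intro mult_left_mono) auto
  also have "\<dots> = (1 + d) / l * (\<Sum>i<m'. h * \<alpha> i) +
    (1 + 1 / d) * A * (l powr (q / 2) / l) * (2 / q) * \<sigma> powr (q / 2)"
    by (simp add: algebra_simps add_divide_distrib)
  also have "l powr (q / 2) / l = l powr (q / 2 - 1)" using pos by (simp add: powr_diff)
  finally show "\<sigma> * \<rho> \<le> (1 + d) / l * (\<Sum>i<m'. h * \<alpha> i) + h / l * \<rho> +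
    (1 + 1 / d) * A * l powr (q / 2 - 1) * (2 / q) * \<sigma> powr (q / 2)"
    using 1 by linarith
qed

lemma cmod_add_sq_le:
  assumes "0 < d"
  shows "(cmod (a + b))\<^sup>2 \<le> (1 + d) * (cmod a)\<^sup>2 + (1 + 1 / d) * (cmod b)\<^sup>2"
proof -
  have "(cmod (a + b))\<^sup>2 \<le> (cmod a + cmod b)\<^sup>2" by (intro power_mono norm_triangle_ineq) simp
  also have "\<dots> = (cmod a)\<^sup>2 + (cmod b)\<^sup>2 + 2 * cmod a * cmod b" by (rule power2_sum)
  also have "2 * cmod a * cmod b \<le> d * (cmod a)\<^sup>2 + 1 / d * (cmod b)\<^sup>2"
  proof -
    have "0 \<le> (d * cmod a - cmod b)\<^sup>2 / d" using assms by simp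
    thus ?thesis using assms by (simp add: power2_eq_square field_simps)
  qed
  finally show ?thesis by (simp add: algebra_simps)
qed

text \<open>Duality between a synthesis map and its adjoint: with c j the conjugate of <e, b j>, the
  combination z satisfies s <= |z| and |z|^2 <= B s, where s is the sum to be bounded.\<close>

lemma coeff_sq_sum_le:
  fixes b :: "'i \<Rightarrow> 'h::complex_hilbert_space"
  assumes b: "\<And>c. (norm (\<Sum>j\<in>J. c j *\<^sub>C b j))\<^sup>2 \<le> B * (\<Sum>j\<in>J. (cmod (c j))\<^sup>2)"
    and e: "norm e = 1" and B: "0 \<le> B"
  shows "(\<Sum>j\<in>J. (cmod (cinner e (b j)))\<^sup>2) \<le> B"
proof -
  define s where "s = (\<Sum>j\<in>J. (cmod (cinner e (b j)))\<^sup>2)"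
  define z where "z = (\<Sum>j\<in>J. cnj (cinner e (b j)) *\<^sub>C b j)"
  have s0: "0 \<le> s" unfolding s_def by (simp add: sum_nonneg)
  have "cinner e z = (\<Sum>j\<in>J. complex_of_real ((cmod (cinner e (b j)))\<^sup>2))"
    unfolding z_def cinner_sum_right
    by (intro sum.cong) (simp_all only: cinner_scaleC_right complex_norm_square mult.commute)
  hence "cinner e z = complex_of_real s" by (simp only: s_def of_real_sum)
  hence "s \<le> norm z" using cmod_cinner_le[of e z] e s0 by simp
  hence "s\<^sup>2 \<le> (norm z)\<^sup>2" using s0 by (intro power_mono)
  also have "\<dots> \<le> B * s" using b[of "\<lambda>j. cnj (cinner e (b j))"] by (simp add: z_def s_def)
  finally have "s * s \<le> B * s" by (simp add: power2_eq_square)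
  hence "s \<le> B" using s0 B by (cases "s = 0") auto
  thus ?thesis by (simp add: s_def)
qed

text \<open>The estimate at one point x, where T = f x. In an eigenbasis of T^*T the levels can be
  averaged separately for each e, because |T u|^2 splits into eigenvalues times squared
  coefficients. Bessel then removes e from the low parts and from the mesh error, while the powers
  \<sigma>^(q/2) sum up to at most the trace.\<close>

lemma schatten_pointwise_le:
  fixes T :: "'h::complex_hilbert_space \<Rightarrow> 'h" and u :: "nat \<Rightarrow> 'h" and a b :: "nat \<Rightarrow> nat \<Rightarrow> 'h"
  assumes K: "compact_op type_hspace type_hspace T"
    and pos: "0 < h" "0 < l" "0 < d" "2 < q" "0 \<le> A"
    and dec: "\<And>i j. j < n \<Longrightarrow> u j = a i j + b i j"
    and b: "\<And>i c. (norm (\<Sum>j<n. c j *\<^sub>C b i j))\<^sup>2 \<le>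
      A * (real i * h) powr (q / 2 - 1) * (\<Sum>j<n. (cmod (c j))\<^sup>2)"
  shows "(\<Sum>j<n. ennreal ((norm (T (u j)))\<^sup>2)) \<le>
    ennreal ((1 + d) / l) * (\<Sum>i. ennreal (h * (\<Sum>j<n. (norm (a i j))\<^sup>2))) +
    ennreal (h / l * (\<Sum>j<n. (norm (u j))\<^sup>2)) +
    ennreal ((1 + 1 / d) * A * l powr (q / 2 - 1) * (2 / q)) *
      trace_op type_hspace (gram_powr type_hspace type_hspace T (q / 2))"
    (is "_ \<le> ?R")
proof -
  let ?E = "type_hspace :: 'h hspace"
  interpret hilbert_pair ?E ?E by (intro hilbert_pair.intro hilbert_type_hspace)
  obtain S where S: "orthonormal_basis ?E S"
    and eig: "\<forall>e\<in>S. adjoint_op ?E ?E T (T e) = hscale ?E (complex_of_real ((hnorm ?E (T e))\<^sup>2)) e"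
    using gram_eigenbasis[OF K] by blast
  have on: "orthonormal ?E S" using S by (simp add: orthonormal_basis_def)
  have e1: "norm e = 1" if "e \<in> S" for e
  proof -
    have "complex_of_real ((norm e)\<^sup>2) = 1"
      using on that unfolding orthonormal_def cinner_self[symmetric] by simp
    hence "(norm e)\<^sup>2 = 1" by (simp only: of_real_eq_1_iff)
    thus ?thesis using power2_eq_iff_nonneg[of "norm e" 1] by simp
  qed
  define \<sigma> where "\<sigma> e = (norm (T e))\<^sup>2" for e
  define \<rho> where "\<rho> e = (\<Sum>j<n. (cmod (cinner e (u j)))\<^sup>2)" for e
  define \<alpha> where "\<alpha> e i = (\<Sum>j<n. (cmod (cinner e (a i j)))\<^sup>2)" for e i
  let ?c = "(1 + 1 / d) * A * l powr (q / 2 - 1) * (2 / q)"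
  have c0: "0 \<le> ?c" using pos by simp
  have bessel: "(\<Sum>e\<in>F. \<Sum>j<n. (cmod (cinner e (x j)))\<^sup>2) \<le> (\<Sum>j<n. (norm (x j))\<^sup>2)"
    if "finite F" "F \<subseteq> S" for F and x :: "nat \<Rightarrow> 'h"
    using E.bessel[OF that(1) orthonormal_subset[OF on that(2)]]
    by (subst sum.swap) (auto intro!: sum_mono)
  have level: "\<exists>m. \<forall>m'\<ge>m. \<sigma> e * \<rho> e \<le> (1 + d) / l * (\<Sum>i<m'. h * \<alpha> e i) + h / l * \<rho> e +
      ?c * \<sigma> e powr (q / 2)" if e: "e \<in> S" for e
  proof (rule level_average_le)
    fix i
    have "\<rho> e \<le> (\<Sum>j<n. (1 + d) * (cmod (cinner e (a i j)))\<^sup>2 + (1 + 1 / d) * (cmod (cinner e (b i j)))\<^sup>2)"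
      unfolding \<rho>_def
    proof (rule sum_mono)
      fix j assume "j \<in> {..<n}"
      hence "cinner e (u j) = cinner e (a i j) + cinner e (b i j)"
        using dec[of j i] by (simp add: cinner_add_right)
      thus "(cmod (cinner e (u j)))\<^sup>2 \<le>
          (1 + d) * (cmod (cinner e (a i j)))\<^sup>2 + (1 + 1 / d) * (cmod (cinner e (b i j)))\<^sup>2"
        by (simp only: cmod_add_sq_le[OF pos(3)])
    qed
    also have "\<dots> = (1 + d) * \<alpha> e i + (1 + 1 / d) * (\<Sum>j<n. (cmod (cinner e (b i j)))\<^sup>2)"
      by (simp add: sum.distrib sum_distrib_left \<alpha>_def)
    also have "(\<Sum>j<n. (cmod (cinner e (b i j)))\<^sup>2) \<le> A * (real i * h) powr (q / 2 - 1)"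
      using b e1[OF e] pos by (intro coeff_sq_sum_le) auto
    finally show "\<rho> e \<le> (1 + d) * \<alpha> e i + (1 + 1 / d) * (A * (real i * h) powr (q / 2 - 1))"
      using pos by (simp add: mult_left_mono)
  qed (use pos in \<open>auto simp: \<sigma>_def \<rho>_def \<alpha>_def sum_nonneg\<close>)
  have finite_part: "ennreal (\<Sum>e\<in>F. \<sigma> e * \<rho> e) \<le> ?R" if F: "finite F" "F \<subseteq> S" for F
  proof -
    obtain m where m: "\<And>e m'. \<lbrakk>e \<in> F; m' \<ge> m e\<rbrakk> \<Longrightarrow>
      \<sigma> e * \<rho> e \<le> (1 + d) / l * (\<Sum>i<m'. h * \<alpha> e i) + h / l * \<rho> e + ?c * \<sigma> e powr (q / 2)"
      using level F(2) by (metis subsetD)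
    \<comment> \<open>Each e has its own cutoff; the sum of finitely many cutoffs dominates them
      all. This is why finite subsets F of the basis are treated before the whole sum.\<close>
    define k where "k = (\<Sum>e\<in>F. m e)"
    have "(\<Sum>e\<in>F. \<sigma> e * \<rho> e) \<le>
        (\<Sum>e\<in>F. (1 + d) / l * (\<Sum>i<k. h * \<alpha> e i) + h / l * \<rho> e + ?c * \<sigma> e powr (q / 2))"
    proof (rule sum_mono)
      fix e assume e: "e \<in> F"
      have "m e \<le> k" unfolding k_def using F(1) e by (intro member_le_sum) auto
      thus "\<sigma> e * \<rho> e \<le> (1 + d) / l * (\<Sum>i<k. h * \<alpha> e i) + h / l * \<rho> e + ?c * \<sigma> e powr (q / 2)"
        using m e by blast
    qed
    also have "\<dots> = (1 + d) / l * (\<Sum>i<k. h * (\<Sum>e\<in>F. \<alpha> e i)) + h / l * (\<Sum>e\<in>F. \<rho> e) +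
        ?c * (\<Sum>e\<in>F. \<sigma> e powr (q / 2))"
    proof -
      have "(\<Sum>e\<in>F. \<Sum>i<k. h * \<alpha> e i) = (\<Sum>i<k. h * (\<Sum>e\<in>F. \<alpha> e i))"
        by (subst sum.swap) (simp add: sum_distrib_left)
      thus ?thesis by (simp only: sum.distrib sum_distrib_left[symmetric])
    qed
    also have "\<dots> \<le> (1 + d) / l * (\<Sum>i<k. h * (\<Sum>j<n. (norm (a i j))\<^sup>2)) + h / l * (\<Sum>j<n. (norm (u j))\<^sup>2) +
        ?c * (\<Sum>e\<in>F. \<sigma> e powr (q / 2))"
      using pos bessel[OF F] unfolding \<alpha>_def \<rho>_def
      by (intro add_mono mult_left_mono sum_mono) auto
    finally have "ennreal (\<Sum>e\<in>F. \<sigma> e * \<rho> e) \<le> ennreal (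
        (1 + d) / l * (\<Sum>i<k. h * (\<Sum>j<n. (norm (a i j))\<^sup>2)) + h / l * (\<Sum>j<n. (norm (u j))\<^sup>2) +
        ?c * (\<Sum>e\<in>F. \<sigma> e powr (q / 2)))" by (rule ennreal_leI)
    also have "\<dots> = ennreal ((1 + d) / l) * (\<Sum>i<k. ennreal (h * (\<Sum>j<n. (norm (a i j))\<^sup>2))) +
        ennreal (h / l * (\<Sum>j<n. (norm (u j))\<^sup>2)) + ennreal ?c * ennreal (\<Sum>e\<in>F. \<sigma> e powr (q / 2))"
    proof -
      have "0 \<le> (\<Sum>i<k. h * (\<Sum>j<n. (norm (a i j))\<^sup>2))" "0 \<le> (\<Sum>j<n. (norm (u j))\<^sup>2)"
        "0 \<le> (\<Sum>e\<in>F. \<sigma> e powr (q / 2))" "\<And>i. 0 \<le> h * (\<Sum>j<n. (norm (a i j))\<^sup>2)"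
        using pos by (auto intro!: sum_nonneg mult_nonneg_nonneg)
      thus ?thesis using pos c0
        by (simp only: ennreal_plus ennreal_mult sum_ennreal[symmetric] mult_nonneg_nonneg
          add_nonneg_nonneg divide_nonneg_pos zero_le_one less_imp_le)
    qed
    also have "\<dots> \<le> ?R"
    proof (intro add_mono mult_left_mono order_refl)
      show "(\<Sum>i<k. ennreal (h * (\<Sum>j<n. (norm (a i j))\<^sup>2))) \<le> (\<Sum>i. ennreal (h * (\<Sum>j<n. (norm (a i j))\<^sup>2)))"
        by (intro sum_le_suminf summableI) auto
      show "ennreal (\<Sum>e\<in>F. \<sigma> e powr (q / 2)) \<le> trace_op ?E (gram_powr ?E ?E T (q / 2))"
        using trace_gram_powr_ge[OF K S eig _ F, of "q / 2"] pos by (simp add: \<sigma>_def)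
    qed auto
    finally show ?thesis .
  qed
  have "((\<lambda>e. \<Sum>j<k. \<sigma> e * (cmod (cinner e (u j)))\<^sup>2) has_sum (\<Sum>j<k. (norm (T (u j)))\<^sup>2)) S" for k
  proof (induction k)
    case (Suc k)
    have "((\<lambda>e. \<sigma> e * (cmod (cinner e (u k)))\<^sup>2) has_sum (norm (T (u k)))\<^sup>2) S"
      using norm_sq_eigen_expansion[OF K S eig, of "u k"] by (simp add: \<sigma>_def)
    from has_sum_add[OF Suc this] show ?case by simp
  qed simp
  from this[of n] have total: "((\<lambda>e. \<sigma> e * \<rho> e) has_sum (\<Sum>j<n. (norm (T (u j)))\<^sup>2)) S"
    by (simp only: sum_distrib_left[symmetric] \<rho>_def)
  have "ennreal (\<Sum>j<n. (norm (T (u j)))\<^sup>2) \<le> ?R"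
  proof (cases ?R)
    case (real r)
    have "(\<Sum>j<n. (norm (T (u j)))\<^sup>2) \<le> r"
    proof (rule has_sum_le_finite_sums[OF total])
      fix F assume "finite F" "F \<subseteq> S"
      from finite_part[OF this] show "(\<Sum>e\<in>F. \<sigma> e * \<rho> e) \<le> r"
        unfolding real(2) using real(1) by (simp add: ennreal_le_iff)
    qed
    thus ?thesis unfolding real(2) by (rule ennreal_leI)
  next
    case top
    show ?thesis unfolding top by (rule top_greatest)
  qed
  thus ?thesis by simp
qed

text \<open>Both sides are continuous in c, so coefficients from a dense set suffice. The
  extensional product over \<open>PiE\<close> is countable when D is, which later keeps the
  exceptional sets countable in number.\<close>

lemma norm_lincomb_le_closure:
  fixes b :: "nat \<Rightarrow> 'h::complex_hilbert_space"
  assumes D: "\<And>X. open X \<Longrightarrow> X \<noteq> {} \<Longrightarrow> \<exists>d\<in>D. d \<in> X"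
    and le: "\<And>c. c \<in> PiE {..<n} (\<lambda>_. D) \<Longrightarrow> (norm (\<Sum>j<n. c j *\<^sub>C b j))\<^sup>2 \<le> B * (\<Sum>j<n. (cmod (c j))\<^sup>2)"
  shows "(norm (\<Sum>j<n. c j *\<^sub>C b j))\<^sup>2 \<le> B * (\<Sum>j<n. (cmod (c j))\<^sup>2)"
proof -
  have "\<exists>z\<in>D. dist z (c j) < inverse (real (Suc k))" for j k
    using D[of "ball (c j) (inverse (real (Suc k)))"] by (auto simp: dist_commute)
  then obtain z where z: "\<And>j k. z j k \<in> D" "\<And>j k. dist (z j k) (c j) < inverse (real (Suc k))" by metis
  have zc: "(\<lambda>k. z j k) \<longlonglongrightarrow> c j" for j
  proof (rule Lim_null[THEN iffD2])
    show "(\<lambda>k. z j k - c j) \<longlonglongrightarrow> 0"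
      by (rule Lim_null_comparison[OF _ LIMSEQ_inverse_real_of_nat])
        (use z(2) in \<open>auto intro!: always_eventually less_imp_le simp: dist_norm\<close>)
  qed
  have bl: "bounded_linear (\<lambda>s. s *\<^sub>C (x :: 'h))" for x
    by (rule bounded_linear_intro[where K = "norm x"])
      (auto simp: scaleC_add_left scaleR_scaleC scaleC_scaleC norm_scaleC scaleR_conv_of_real)
  have "(\<lambda>k. (norm (\<Sum>j<n. z j k *\<^sub>C b j))\<^sup>2) \<longlonglongrightarrow> (norm (\<Sum>j<n. c j *\<^sub>C b j))\<^sup>2"
    by (intro tendsto_power tendsto_norm tendsto_sum bounded_linear.tendsto[OF bl] zc)
  moreover have "(\<lambda>k. B * (\<Sum>j<n. (cmod (z j k))\<^sup>2)) \<longlonglongrightarrow> B * (\<Sum>j<n. (cmod (c j))\<^sup>2)"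
    by (intro tendsto_mult tendsto_const tendsto_sum tendsto_power tendsto_norm zc)
  moreover have "(norm (\<Sum>j<n. z j k *\<^sub>C b j))\<^sup>2 \<le> B * (\<Sum>j<n. (cmod (z j k))\<^sup>2)" for k
    using le[of "\<lambda>j\<in>{..<n}. z j k"] z(1) by simp
  ultimately show ?thesis by (intro LIMSEQ_le) auto
qed

text \<open>Here t stands for |g|, w for |g v| and v for |v| at one point. About 1/(t^2 h) levels
  are low, each contributing h w^2; their total is w^2/t^2, which is at most v^2, up to the single
  summand h w^2 for level 0.\<close>

lemma level_count_le:
  fixes w v t h :: real
  assumes h: "0 < h" and t: "0 \<le> t" and wv: "0 \<le> w" "w \<le> t * v"
  shows "(\<Sum>i. ennreal (h * (if 1 < t\<^sup>2 * (real i * h) then 0 else w\<^sup>2))) \<le> ennreal (v\<^sup>2 + h * w\<^sup>2)"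
proof (rule suminf_le_const[OF summableI])
  fix n
  show "(\<Sum>i<n. ennreal (h * (if 1 < t\<^sup>2 * (real i * h) then 0 else w\<^sup>2))) \<le> ennreal (v\<^sup>2 + h * w\<^sup>2)"
  proof (cases "w = 0")
    case True
    hence "h * (if 1 < t\<^sup>2 * (real i * h) then 0 else w\<^sup>2) = 0" for i by simp
    thus ?thesis by (simp only: ennreal_0 sum.neutral_const zero_le)
  next
    case False
    hence w: "0 < w" using wv by simp
    hence tv: "0 < t * v" using wv by linarith
    hence t: "0 < t" using t by (cases "t = 0") auto
    have v: "0 < v" using tv t by (simp add: zero_less_mult_iff)
    \<comment> \<open>Low indices are at most m, and 0 is among them, so there are at most m + 1.
      The additional one is the error term h w^2.\<close>
    define m where "m = nat \<lfloor>1 / (t\<^sup>2 * h)\<rfloor>"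
    have m: "real m \<le> 1 / (t\<^sup>2 * h)" "\<And>i. t\<^sup>2 * (real i * h) \<le> 1 \<Longrightarrow> i \<le> m"
    proof -
      show "real m \<le> 1 / (t\<^sup>2 * h)" using t h by (simp add: m_def)
      fix i assume "t\<^sup>2 * (real i * h) \<le> 1"
      hence "real i \<le> 1 / (t\<^sup>2 * h)" using t h by (simp add: pos_le_divide_eq mult_ac)
      thus "i \<le> m" unfolding m_def by (simp add: le_nat_floor)
    qed
    have "(\<Sum>i<n. h * (if 1 < t\<^sup>2 * (real i * h) then 0 else w\<^sup>2)) \<le> (\<Sum>i<n. if i \<le> m then h * w\<^sup>2 else 0)"
      using m(2) h by (intro sum_mono) (auto simp: not_less)
    also have "\<dots> = (\<Sum>i\<in>{..<n} \<inter> {..m}. h * w\<^sup>2)"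
      by (simp add: sum.If_cases atMost_def)
    also have "\<dots> \<le> (\<Sum>i\<in>{..m}. h * w\<^sup>2)" using h by (intro sum_mono2) auto
    also have "\<dots> = real m * (h * w\<^sup>2) + h * w\<^sup>2" by (simp add: algebra_simps)
    also have "real m * (h * w\<^sup>2) \<le> 1 / (t\<^sup>2 * h) * (h * w\<^sup>2)" using m(1) h by (intro mult_right_mono) auto
    also have "\<dots> = w\<^sup>2 / t\<^sup>2" using h by simp
    also have "w\<^sup>2 / t\<^sup>2 \<le> v\<^sup>2"
    proof -
      have "w\<^sup>2 \<le> (t * v)\<^sup>2" using wv by (intro power_mono) auto
      thus ?thesis using t by (simp add: power_mult_distrib pos_divide_le_eq mult.commute)
    qed
    finally have "(\<Sum>i<n. h * (if 1 < t\<^sup>2 * (real i * h) then 0 else w\<^sup>2)) \<le> v\<^sup>2 + h * w\<^sup>2" by simp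
    hence "ennreal (\<Sum>i<n. h * (if 1 < t\<^sup>2 * (real i * h) then 0 else w\<^sup>2)) \<le> ennreal (v\<^sup>2 + h * w\<^sup>2)"
      by (rule ennreal_leI)
    thus ?thesis using h by (subst sum_ennreal) simp_all
  qed
qed

text \<open>The adjoint of \<Phi> acting on functions. Its values are chosen representatives of
  classes, so linearity is available only almost everywhere. The axiom \<open>sup_bound\<close> is
  the L_1 to L_\<infinity> bound of \<Phi> transferred to the adjoint.\<close>

locale L2_transform =
  fixes M :: "'x measure" and N :: "'y measure" and C :: real
    and \<Psi> :: "('y \<Rightarrow> 'g::{complex_hilbert_space, second_countable_topology}) \<Rightarrow>
      ('x \<Rightarrow> 'h::{complex_hilbert_space, second_countable_topology})"
  assumes sigma_finite_source: "sigma_finite_measure N"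
    and closed: "w \<in> L2_fun N \<Longrightarrow> \<Psi> w \<in> L2_fun M"
    and add: "\<lbrakk>w \<in> L2_fun N; w' \<in> L2_fun N\<rbrakk> \<Longrightarrow> AE x in M. \<Psi> (\<lambda>y. w y + w' y) x = \<Psi> w x + \<Psi> w' x"
    and scale: "w \<in> L2_fun N \<Longrightarrow> AE x in M. \<Psi> (\<lambda>y. c *\<^sub>C w y) x = c *\<^sub>C \<Psi> w x"
    and isometry: "w \<in> L2_fun N \<Longrightarrow>
      (\<integral>\<^sup>+x. ennreal ((norm (\<Psi> w x))\<^sup>2) \<partial>M) = (\<integral>\<^sup>+y. ennreal ((norm (w y))\<^sup>2) \<partial>N)"
    and sup_bound: "\<lbrakk>w \<in> L2_fun N; (\<integral>\<^sup>+y. ennreal (norm (w y)) \<partial>N) \<le> ennreal r; 0 \<le> r\<rbrakk>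
      \<Longrightarrow> AE x in M. norm (\<Psi> w x) \<le> C * r"
    and C_nonneg: "0 \<le> C"
begin

lemma lincomb:
  fixes n :: nat
  assumes w: "\<And>j. j < n \<Longrightarrow> w j \<in> L2_fun N"
  shows "AE x in M. \<Psi> (\<lambda>y. \<Sum>j<n. c j *\<^sub>C w j y) x = (\<Sum>j<n. c j *\<^sub>C \<Psi> (w j) x)"
  using w
proof (induction n)
  case 0
  have "AE x in M. \<Psi> (\<lambda>y. 0) x = 0" using scale[OF L2_fun_zero, of 0] by simp
  thus ?case by simp
next
  case (Suc n)
  have 1: "(\<lambda>y. \<Sum>j<n. c j *\<^sub>C w j y) \<in> L2_fun N"
    using Suc.prems by (intro L2_fun_sum L2_fun_scaleC) auto
  have 2: "w n \<in> L2_fun N" using Suc.prems by simp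
  have "AE x in M. \<Psi> (\<lambda>y. (\<Sum>j<n. c j *\<^sub>C w j y) + c n *\<^sub>C w n y) x =
      \<Psi> (\<lambda>y. \<Sum>j<n. c j *\<^sub>C w j y) x + \<Psi> (\<lambda>y. c n *\<^sub>C w n y) x"
    using 1 2 by (intro add L2_fun_scaleC)
  moreover have "AE x in M. \<Psi> (\<lambda>y. \<Sum>j<n. c j *\<^sub>C w j y) x = (\<Sum>j<n. c j *\<^sub>C \<Psi> (w j) x)"
    using Suc by auto
  ultimately show ?case using scale[OF 2, of "c n"] by eventually_elim simp
qed

text \<open>A combination of the high parts is the image of one function, g applied to the same
  combination of the v j on P. Cauchy-Schwarz bounds its L_1 norm, and \<open>sup_bound\<close>
  makes this a pointwise bound. The quantifier over c stands inside the almost-everywhere statement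
  because c will be chosen depending on x.\<close>

lemma high_part_bound:
  fixes g :: "'y \<Rightarrow> 'g \<Rightarrow> 'g" and v :: "nat \<Rightarrow> 'y \<Rightarrow> 'g"
  assumes g: "op_measurable N g" "\<And>y. y \<in> space N \<Longrightarrow> bounded_op type_hspace type_hspace (g y)"
    and v: "\<And>j. j < n \<Longrightarrow> v j \<in> L2_fun N" and w: "\<And>j. j < n \<Longrightarrow> (\<lambda>y. g y (v j y)) \<in> L2_fun N"
    and contr: "\<And>c. (\<integral>\<^sup>+y. ennreal ((norm (\<Sum>j<n. c j *\<^sub>C v j y))\<^sup>2) \<partial>N) \<le> ennreal (\<Sum>j<n. (cmod (c j))\<^sup>2)"
    and P [measurable]: "Measurable.pred N P"
    and X: "(\<integral>\<^sup>+y. ennreal ((onorm (g y))\<^sup>2) * (if P y then 1 else 0) \<partial>N) \<le> ennreal (X\<^sup>2)" "0 \<le> X"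
  shows "AE x in M. \<forall>c. (norm (\<Sum>j<n. c j *\<^sub>C \<Psi> (\<lambda>y. if P y then g y (v j y) else 0) x))\<^sup>2 \<le>
    (C * X)\<^sup>2 * (\<Sum>j<n. (cmod (c j))\<^sup>2)"
proof -
  obtain D :: "complex set" where D: "countable D" "\<And>X. open X \<Longrightarrow> X \<noteq> {} \<Longrightarrow> \<exists>d\<in>D. d \<in> X"
    using countable_dense_exists by blast
  have lin: "bounded_linear (g y)" if "y \<in> space N" for y
    using g(2)[OF that] by (rule bounded_op_type_hspace_bounded_linear)
  have [measurable]: "(\<lambda>y. onorm (g y)) \<in> borel_measurable N"
    using g(1) lin by (rule borel_measurable_onorm)
  define b where "b j y = (if P y then g y (v j y) else 0)" for j y
  have b: "b j \<in> L2_fun N" if "j < n" for j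
  proof (rule L2_fun_bound[OF w[OF that]])
    have [measurable]: "(\<lambda>y. g y (v j y)) \<in> borel_measurable N" using w[OF that] by (rule L2_fun_measurable)
    show "b j \<in> borel_measurable N" unfolding b_def by measurable
    show "AE y in N. norm (b j y) \<le> 1 * norm (g y (v j y))" by (simp add: b_def)
  qed
  have single: "AE x in M. (norm (\<Sum>j<n. c j *\<^sub>C \<Psi> (b j) x))\<^sup>2 \<le> (C * X)\<^sup>2 * (\<Sum>j<n. (cmod (c j))\<^sup>2)" for c
  proof -
    define z where "z y = (\<Sum>j<n. c j *\<^sub>C v j y)" for y
    define s where "s = (\<Sum>j<n. (cmod (c j))\<^sup>2)"
    have s0: "0 \<le> s" by (simp add: s_def sum_nonneg)
    have z: "z \<in> L2_fun N" unfolding z_def using v by (intro L2_fun_sum L2_fun_scaleC) auto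
    hence [measurable]: "z \<in> borel_measurable N" by (rule L2_fun_measurable)
    \<comment> \<open>Linearity of g y is what allows the contraction property of the v j to be
      applied to the combination as a whole.\<close>
    have bz: "(\<Sum>j<n. c j *\<^sub>C b j y) = (if P y then g y (z y) else 0)" if y: "y \<in> space N" for y
      using bounded_op_type_hspace_scaleC[OF g(2)[OF y]] bounded_linear.linear[OF lin[OF y]]
      by (simp add: b_def z_def linear_sum)
    have "(\<integral>\<^sup>+y. ennreal (norm (\<Sum>j<n. c j *\<^sub>C b j y)) \<partial>N) \<le>
        (\<integral>\<^sup>+y. ennreal ((if P y then onorm (g y) else 0) * norm (z y)) \<partial>N)"
      using onorm[OF lin] by (intro nn_integral_mono ennreal_leI) (simp add: bz)
    also have "\<dots> \<le> ennreal (X * sqrt s)"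
    proof (rule nn_integral_Cauchy_Schwarz_le)
      have "(\<integral>\<^sup>+y. ennreal ((if P y then onorm (g y) else 0)\<^sup>2) \<partial>N) =
          (\<integral>\<^sup>+y. ennreal ((onorm (g y))\<^sup>2) * (if P y then 1 else 0) \<partial>N)"
        by (intro nn_integral_cong) simp
      thus "(\<integral>\<^sup>+y. ennreal ((if P y then onorm (g y) else 0)\<^sup>2) \<partial>N) \<le> ennreal (X\<^sup>2)" using X by simp
      show "(\<integral>\<^sup>+y. ennreal ((norm (z y))\<^sup>2) \<partial>N) \<le> ennreal ((sqrt s)\<^sup>2)"
        using contr[of c] s0 by (simp add: z_def s_def)
    qed (use X s0 in auto)
    finally have "AE x in M. norm (\<Psi> (\<lambda>y. \<Sum>j<n. c j *\<^sub>C b j y) x) \<le> C * (X * sqrt s)"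
      using b X s0 by (intro sup_bound L2_fun_sum L2_fun_scaleC) auto
    moreover have "AE x in M. \<Psi> (\<lambda>y. \<Sum>j<n. c j *\<^sub>C b j y) x = (\<Sum>j<n. c j *\<^sub>C \<Psi> (b j) x)"
      using b by (rule lincomb)
    ultimately show ?thesis
    proof eventually_elim
      case (elim x)
      hence "(norm (\<Sum>j<n. c j *\<^sub>C \<Psi> (b j) x))\<^sup>2 \<le> (C * (X * sqrt s))\<^sup>2"
        by (intro power_mono) auto
      also have "\<dots> = (C * X)\<^sup>2 * s" using s0 by (simp add: power_mult_distrib)
      finally show ?case by (simp add: s_def)
    qed
  qed
  \<comment> \<open>Countably many coefficient vectors share one null set; continuity in c then
    covers all the others at the same x.\<close>
  have "AE x in M. \<forall>c\<in>PiE {..<n} (\<lambda>_. D). (norm (\<Sum>j<n. c j *\<^sub>C \<Psi> (b j) x))\<^sup>2 \<le> (C * X)\<^sup>2 * (\<Sum>j<n. (cmod (c j))\<^sup>2)"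
    using single D(1) by (subst AE_ball_countable) (auto intro: countable_PiE)
  thus ?thesis
    unfolding b_def[symmetric]
  proof eventually_elim
    case (elim x)
    show ?case
    proof
      fix c
      show "(norm (\<Sum>j<n. c j *\<^sub>C \<Psi> (\<lambda>y. b j y) x))\<^sup>2 \<le> (C * X)\<^sup>2 * (\<Sum>j<n. (cmod (c j))\<^sup>2)"
        by (rule norm_lincomb_le_closure[OF D(2)]) (use elim in auto)
    qed
  qed
qed

end

context L2_transform
begin

text \<open>Integration of \<open>schatten_pointwise_le\<close> over x. Isometry moves the low parts
  back to Y, where the levels are counted pointwise by \<open>level_count_le\<close>, and
  \<open>high_part_bound\<close> with the weak tail estimate controls the high parts. The terms with
  W are the cost of a positive mesh size.\<close>

lemma estimate_mesh:
  fixes g :: "'y \<Rightarrow> 'g \<Rightarrow> 'g" and v :: "nat \<Rightarrow> 'y \<Rightarrow> 'g" and f :: "'x \<Rightarrow> 'h \<Rightarrow> 'h"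
  assumes f: "op_measurable M f" "\<And>x. x \<in> space M \<Longrightarrow> compact_op type_hspace type_hspace (f x)"
    and g: "op_measurable N g" "\<And>y. y \<in> space N \<Longrightarrow> bounded_op type_hspace type_hspace (g y)"
    and weak: "\<And>\<tau>. 0 < \<tau> \<Longrightarrow> ennreal (\<tau> powr q) * emeasure N {y \<in> space N. \<tau> < onorm (g y)} \<le> ennreal G"
    and G: "0 \<le> G" and q: "2 < q"
    and v: "\<And>j. j < n \<Longrightarrow> v j \<in> L2_fun N" and w: "\<And>j. j < n \<Longrightarrow> (\<lambda>y. g y (v j y)) \<in> L2_fun N"
    and contr: "\<And>c. (\<integral>\<^sup>+y. ennreal ((norm (\<Sum>j<n. c j *\<^sub>C v j y))\<^sup>2) \<partial>N) \<le> ennreal (\<Sum>j<n. (cmod (c j))\<^sup>2)"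
    and pos: "0 < h" "0 < l" "0 < d"
    and W: "(\<Sum>j<n. \<integral>\<^sup>+y. ennreal ((norm (g y (v j y)))\<^sup>2) \<partial>N) \<le> ennreal W" "0 \<le> W"
  shows "(\<integral>\<^sup>+x. (\<Sum>j<n. ennreal ((norm (f x (\<Psi> (\<lambda>y. g y (v j y)) x)))\<^sup>2)) \<partial>M) \<le>
    ennreal ((1 + d) / l * (real n + h * W) + h / l * W) +
    ennreal ((1 + 1 / d) * (C\<^sup>2 * (G * (q / (q - 2)))) * l powr (q / 2 - 1) * (2 / q)) *
      (\<integral>\<^sup>+x. trace_op type_hspace (gram_powr type_hspace type_hspace (f x) (q / 2)) \<partial>M)"
proof -
  define t where "t y = onorm (g y)" for y
  \<comment> \<open>High at level E = i h means |g|^2 > 1/E, written without division. At level 0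
    nothing is high, in agreement with 0 powr (q/2 - 1) = 0.\<close>
  define P where "P i y = (1 < (t y)\<^sup>2 * (real i * h))" for i :: nat and y
  define A where "A = C\<^sup>2 * (G * (q / (q - 2)))"
  have A0: "0 \<le> A" using G q by (simp add: A_def)
  have lin: "bounded_linear (g y)" if "y \<in> space N" for y
    using g(2)[OF that] by (rule bounded_op_type_hspace_bounded_linear)
  have linf: "bounded_linear (f x)" if "x \<in> space M" for x
    using f(2)[OF that] by (intro bounded_op_type_hspace_bounded_linear) (simp add: compact_op_def)
  have t_meas [measurable]: "t \<in> borel_measurable N"
    unfolding t_def[abs_def] using g(1) lin by (rule borel_measurable_onorm)
  have P_meas [measurable]: "Measurable.pred N (P i)" for i unfolding P_def[abs_def] by measurable
  have t0: "0 \<le> t y" if "y \<in> space N" for y unfolding t_def using lin[OF that] by (rule onorm_pos_le)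
  define w where "w j y = g y (v j y)" for j y
  define a where "a i j = \<Psi> (\<lambda>y. if P i y then 0 else w j y)" for i j
  define b where "b i j = \<Psi> (\<lambda>y. if P i y then w j y else 0)" for i j
  have w': "w j \<in> L2_fun N" if "j < n" for j using w[OF that] by (simp add: w_def[abs_def])
  have w_meas [measurable]: "w j \<in> borel_measurable N" if "j < n" for j
    using w'[OF that] by (rule L2_fun_measurable)
  have lo: "(\<lambda>y. if P i y then 0 else w j y) \<in> L2_fun N" if j: "j < n" for i j
  proof (rule L2_fun_bound[OF w'[OF j]])
    note [measurable] = w_meas[OF j]
    show "(\<lambda>y. if P i y then 0 else w j y) \<in> borel_measurable N" by measurable
    show "AE y in N. norm (if P i y then 0 else w j y) \<le> 1 * norm (w j y)" by simp
  qed
  have hi: "(\<lambda>y. if P i y then w j y else 0) \<in> L2_fun N" if j: "j < n" for i j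
  proof (rule L2_fun_bound[OF w'[OF j]])
    note [measurable] = w_meas[OF j]
    show "(\<lambda>y. if P i y then w j y else 0) \<in> borel_measurable N" by measurable
    show "AE y in N. norm (if P i y then w j y else 0) \<le> 1 * norm (w j y)" by simp
  qed
  have dec: "AE x in M. \<forall>j\<in>{..<n}. \<forall>i. \<Psi> (w j) x = a i j x + b i j x"
  proof -
    have "AE x in M. \<Psi> (w j) x = a i j x + b i j x" if "j < n" for i j
    proof -
      have "(\<lambda>y. (if P i y then 0 else w j y) + (if P i y then w j y else 0)) = w j" by auto
      thus ?thesis using add[OF lo[OF that] hi[OF that], of i i] by (simp add: a_def b_def)
    qed
    hence "AE x in M. \<forall>i. \<Psi> (w j) x = a i j x + b i j x" if "j < n" for j
      using that by (simp add: AE_all_countable)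
    thus ?thesis by (subst AE_ball_countable) auto
  qed
  have high: "AE x in M. \<forall>i c. (norm (\<Sum>j<n. c j *\<^sub>C b i j x))\<^sup>2 \<le>
      A * (real i * h) powr (q / 2 - 1) * (\<Sum>j<n. (cmod (c j))\<^sup>2)"
  proof (subst AE_all_countable, rule allI)
    fix i
    define X where "X = sqrt (G * (q / (q - 2)) * (real i * h) powr (q / 2 - 1))"
    have arg0: "0 \<le> G * (q / (q - 2)) * (real i * h) powr (q / 2 - 1)" using G q by simp
    hence X0: "0 \<le> X" and X2: "X\<^sup>2 = G * (q / (q - 2)) * (real i * h) powr (q / 2 - 1)"
      by (simp_all add: X_def)
    have "(\<integral>\<^sup>+y. ennreal ((t y)\<^sup>2) * (if P i y then 1 else 0) \<partial>N) \<le> ennreal (X\<^sup>2)"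
    proof (cases "i = 0")
      case True
      thus ?thesis by (simp add: P_def)
    next
      case False
      \<comment> \<open>The threshold for |g| at level E = i h. Since T^(2-q) = E^(q/2-1), the tail
        estimate delivers exactly the power that is averaged over the levels.\<close>
      define T where "T = 1 / sqrt (real i * h)"
      have ih: "0 < real i * h" using False pos by simp
      have T: "0 < T" using ih by (simp add: T_def)
      have PT: "P i y \<longleftrightarrow> T < t y" if y: "y \<in> space N" for y
      proof -
        have "T < t y \<longleftrightarrow> T\<^sup>2 < (t y)\<^sup>2" 
        proof
          show "T\<^sup>2 < (t y)\<^sup>2" if "T < t y" by (rule power_strict_mono[OF that]) (use T in auto)
          show "T < t y" if "T\<^sup>2 < (t y)\<^sup>2" using that t0[OF y] by (rule power2_less_imp_less)
        qed
        also have "\<dots> \<longleftrightarrow> P i y" using ih by (simp add: T_def P_def power_divide pos_divide_less_eq)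
        finally show ?thesis ..
      qed
      have "(\<integral>\<^sup>+y. ennreal ((t y)\<^sup>2) * (if P i y then 1 else 0) \<partial>N) =
          (\<integral>\<^sup>+y. ennreal ((t y)\<^sup>2) * (if T < t y then 1 else 0) \<partial>N)"
        by (intro nn_integral_cong) (simp add: PT)
      also have "\<dots> \<le> ennreal (G * (q / (q - 2)) * T powr (2 - q))"
        using weak G q T unfolding t_def[symmetric]
        by (intro nn_integral_tail_sq_le sigma_finite_source t_meas) auto
      also have "T powr (2 - q) = (real i * h) powr (q / 2 - 1)"
      proof -
        have "(real i * h) powr (- (1 / 2)) = inverse (sqrt (real i * h))"
          using powr_half_sqrt[OF less_imp_le[OF ih]] by (simp only: powr_minus)
        hence "T = (real i * h) powr (- (1 / 2))" unfolding T_def by (simp only: inverse_eq_divide)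
        hence "T powr (2 - q) = (real i * h) powr (- (1 / 2) * (2 - q))" by (simp only: powr_powr)
        also have "- (1 / 2) * (2 - q) = q / 2 - 1" by (simp add: field_simps)
        finally show ?thesis .
      qed
      finally show ?thesis by (simp only: X2)
    qed
    hence "AE x in M. \<forall>c. (norm (\<Sum>j<n. c j *\<^sub>C \<Psi> (\<lambda>y. if P i y then g y (v j y) else 0) x))\<^sup>2 \<le>
        (C * X)\<^sup>2 * (\<Sum>j<n. (cmod (c j))\<^sup>2)"
      unfolding t_def using g v w contr X0 by (intro high_part_bound) (auto simp: t_def[symmetric])
    moreover have "(C * X)\<^sup>2 = A * (real i * h) powr (q / 2 - 1)"
      by (simp only: power_mult_distrib X2 A_def mult.assoc)
    ultimately show "AE x in M. \<forall>c. (norm (\<Sum>j<n. c j *\<^sub>C b i j x))\<^sup>2 \<le>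
        A * (real i * h) powr (q / 2 - 1) * (\<Sum>j<n. (cmod (c j))\<^sup>2)"
      by (simp only: b_def w_def)
  qed
  let ?tr = "\<lambda>x. trace_op type_hspace (gram_powr type_hspace type_hspace (f x) (q / 2))"
  let ?F = "\<lambda>x. \<Sum>j<n. ennreal ((norm (f x (\<Psi> (w j) x)))\<^sup>2)"
  let ?G = "\<lambda>x. ennreal ((1 + d) / l) * (\<Sum>i. ennreal (h * (\<Sum>j<n. (norm (a i j x))\<^sup>2))) +
    ennreal (h / l * (\<Sum>j<n. (norm (\<Psi> (w j) x))\<^sup>2))"
  have a_meas: "a i j \<in> borel_measurable M" if "j < n" for i j
    unfolding a_def using closed[OF lo[OF that]] by (rule L2_fun_measurable)
  have Psi_meas: "\<Psi> (w j) \<in> borel_measurable M" if "j < n" for j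
    using closed[OF w'[OF that]] by (rule L2_fun_measurable)
  have sa_meas [measurable]: "(\<lambda>x. \<Sum>j<n. (norm (a i j x))\<^sup>2) \<in> borel_measurable M" for i
    using a_meas by (intro borel_measurable_sum borel_measurable_power borel_measurable_norm) auto
  have sP_meas [measurable]: "(\<lambda>x. \<Sum>j<n. (norm (\<Psi> (w j) x))\<^sup>2) \<in> borel_measurable M"
    using Psi_meas by (intro borel_measurable_sum borel_measurable_power borel_measurable_norm) auto
  have F_meas [measurable]: "?F \<in> borel_measurable M"
    using Psi_meas borel_measurable_op_apply[OF f(1) linf]
    by (intro borel_measurable_sum measurable_compose[OF _ measurable_ennreal] borel_measurable_power borel_measurable_norm) auto
  have "(\<integral>\<^sup>+x. ?F x \<partial>M) \<le> (\<integral>\<^sup>+x. ?G x \<partial>M) +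
      ennreal ((1 + 1 / d) * A * l powr (q / 2 - 1) * (2 / q)) * (\<integral>\<^sup>+x. ?tr x \<partial>M)"
  \<comment> \<open>Measurability of the trace in x is not established, so its term is split off by
    the inequality for lower integrals.\<close>
  proof (rule nn_integral_le_add_lower)
    show "AE x in M. ?F x \<le> ?G x + ennreal ((1 + 1 / d) * A * l powr (q / 2 - 1) * (2 / q)) * ?tr x"
      using dec high AE_space
    proof eventually_elim
      case (elim x)
      show ?case
        using elim f(2) pos q A0 by (intro schatten_pointwise_le[where b = "\<lambda>i j. b i j x"]) auto
    qed
    show "?F x \<noteq> \<infinity>" for x by simp
    show "0 \<le> (1 + 1 / d) * A * l powr (q / 2 - 1) * (2 / q)" using pos q A0 by simp
  qed measurable
  also have "(\<integral>\<^sup>+x. ?G x \<partial>M) \<le> ennreal ((1 + d) / l * (real n + h * W) + h / l * W)"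
  proof -
    have "(\<integral>\<^sup>+x. (\<Sum>i. ennreal (h * (\<Sum>j<n. (norm (a i j x))\<^sup>2))) \<partial>M) =
        (\<Sum>i. \<integral>\<^sup>+x. ennreal (h * (\<Sum>j<n. (norm (a i j x))\<^sup>2)) \<partial>M)"
      by (rule nn_integral_suminf) measurable
    also have "\<dots> = (\<Sum>i. \<Sum>j<n. \<integral>\<^sup>+y. ennreal (h * (if P i y then 0 else (norm (w j y))\<^sup>2)) \<partial>N)"
    proof (rule suminf_cong)
      fix i
      have "(\<integral>\<^sup>+x. ennreal (h * (\<Sum>j<n. (norm (a i j x))\<^sup>2)) \<partial>M) =
          (\<integral>\<^sup>+x. (\<Sum>j<n. ennreal h * ennreal ((norm (a i j x))\<^sup>2)) \<partial>M)"
        using pos by (intro nn_integral_cong) (simp add: ennreal_mult[symmetric] sum_distrib_left)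
      also have "\<dots> = (\<Sum>j<n. \<integral>\<^sup>+x. ennreal h * ennreal ((norm (a i j x))\<^sup>2) \<partial>M)"
        using a_meas by (intro nn_integral_sum) simp
      also have "\<dots> = (\<Sum>j<n. \<integral>\<^sup>+y. ennreal (h * (if P i y then 0 else (norm (w j y))\<^sup>2)) \<partial>N)"
      proof (rule sum.cong)
        fix j assume "j \<in> {..<n}"
        hence j: "j < n" by simp
        note [measurable] = w_meas[OF j] a_meas[OF j]
        have "(\<integral>\<^sup>+x. ennreal h * ennreal ((norm (a i j x))\<^sup>2) \<partial>M) = ennreal h * (\<integral>\<^sup>+x. ennreal ((norm (a i j x))\<^sup>2) \<partial>M)"
          by (rule nn_integral_cmult) measurable
        also have "\<dots> = ennreal h * (\<integral>\<^sup>+y. ennreal ((norm (if P i y then 0 else w j y))\<^sup>2) \<partial>N)"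
          unfolding a_def isometry[OF lo[OF j]] ..
        also have "\<dots> = (\<integral>\<^sup>+y. ennreal h * ennreal ((norm (if P i y then 0 else w j y))\<^sup>2) \<partial>N)"
          by (rule nn_integral_cmult[symmetric]) measurable
        also have "\<dots> = (\<integral>\<^sup>+y. ennreal (h * (if P i y then 0 else (norm (w j y))\<^sup>2)) \<partial>N)"
          using pos by (intro nn_integral_cong) (simp add: ennreal_mult)
        finally show "(\<integral>\<^sup>+x. ennreal h * ennreal ((norm (a i j x))\<^sup>2) \<partial>M) =
          (\<integral>\<^sup>+y. ennreal (h * (if P i y then 0 else (norm (w j y))\<^sup>2)) \<partial>N)" .
      qed simp
      finally show "(\<integral>\<^sup>+x. ennreal (h * (\<Sum>j<n. (norm (a i j x))\<^sup>2)) \<partial>M) =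
        (\<Sum>j<n. \<integral>\<^sup>+y. ennreal (h * (if P i y then 0 else (norm (w j y))\<^sup>2)) \<partial>N)" .
    qed
    also have "\<dots> = (\<Sum>j<n. \<Sum>i. \<integral>\<^sup>+y. ennreal (h * (if P i y then 0 else (norm (w j y))\<^sup>2)) \<partial>N)"
      by (rule suminf_sum) simp
    \<comment> \<open>Each j contributes at most 1 from the norm of v j plus the cost of level 0;
      the sum of the ones is the n of the estimate.\<close>
    also have "\<dots> \<le> (\<Sum>j<n. ennreal 1 + ennreal h * (\<integral>\<^sup>+y. ennreal ((norm (w j y))\<^sup>2) \<partial>N))"
    proof (rule sum_mono)
      fix j assume "j \<in> {..<n}"
      hence j: "j < n" by simp
      note [measurable] = w_meas[OF j] L2_fun_measurable[OF v[OF j]]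
      have "(\<Sum>i. \<integral>\<^sup>+y. ennreal (h * (if P i y then 0 else (norm (w j y))\<^sup>2)) \<partial>N) =
          (\<integral>\<^sup>+y. (\<Sum>i. ennreal (h * (if P i y then 0 else (norm (w j y))\<^sup>2))) \<partial>N)"
        by (rule nn_integral_suminf[symmetric]) measurable
      also have "\<dots> \<le> (\<integral>\<^sup>+y. ennreal ((norm (v j y))\<^sup>2) + ennreal h * ennreal ((norm (w j y))\<^sup>2) \<partial>N)"
      proof (rule nn_integral_mono)
        fix y assume y: "y \<in> space N"
        have "norm (w j y) \<le> t y * norm (v j y)" unfolding w_def t_def using onorm[OF lin[OF y]] .
        hence "(\<Sum>i. ennreal (h * (if P i y then 0 else (norm (w j y))\<^sup>2))) \<le>
            ennreal ((norm (v j y))\<^sup>2 + h * (norm (w j y))\<^sup>2)"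
          unfolding P_def using pos t0[OF y] by (intro level_count_le) auto
        thus "(\<Sum>i. ennreal (h * (if P i y then 0 else (norm (w j y))\<^sup>2))) \<le>
            ennreal ((norm (v j y))\<^sup>2) + ennreal h * ennreal ((norm (w j y))\<^sup>2)"
          using pos by (simp add: ennreal_plus ennreal_mult)
      qed
      also have "\<dots> = (\<integral>\<^sup>+y. ennreal ((norm (v j y))\<^sup>2) \<partial>N) + ennreal h * (\<integral>\<^sup>+y. ennreal ((norm (w j y))\<^sup>2) \<partial>N)"
        by (subst nn_integral_add) (auto simp: nn_integral_cmult)
      also have "(\<integral>\<^sup>+y. ennreal ((norm (v j y))\<^sup>2) \<partial>N) \<le> ennreal 1"
      proof -
        \<comment> \<open>The j-th unit coefficient vector turns the contraction property into the
          bound 1 for the norm of v j.\<close>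
        have "(\<Sum>k<n. (if k = j then 1 else 0) *\<^sub>C v k y) = v j y" for y
        proof -
          have "(\<Sum>k<n. (if k = j then 1 else 0) *\<^sub>C v k y) = (\<Sum>k<n. if k = j then v j y else 0)"
            by (intro sum.cong) (auto simp: scaleC_one)
          thus ?thesis using j by simp
        qed
        moreover have "(\<Sum>k<n. (cmod (if k = j then 1 else 0))\<^sup>2) = 1"
        proof -
          have "(\<Sum>k<n. (cmod (if k = j then 1 else 0))\<^sup>2) = (\<Sum>k<n. if k = j then 1 else 0)"
            by (intro sum.cong) auto
          thus ?thesis using j by simp
        qed
        ultimately show ?thesis using contr[of "\<lambda>k. if k = j then 1 else 0"] by simp
      qed
      finally show "(\<Sum>i. \<integral>\<^sup>+y. ennreal (h * (if P i y then 0 else (norm (w j y))\<^sup>2)) \<partial>N) \<le>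
        ennreal 1 + ennreal h * (\<integral>\<^sup>+y. ennreal ((norm (w j y))\<^sup>2) \<partial>N)" by (simp add: add_mono)
    qed
    also have "\<dots> = ennreal (real n) + ennreal h * (\<Sum>j<n. \<integral>\<^sup>+y. ennreal ((norm (w j y))\<^sup>2) \<partial>N)"
      by (simp add: sum.distrib sum_distrib_left ennreal_of_nat_eq_real_of_nat)
    also have "\<dots> \<le> ennreal (real n) + ennreal h * ennreal W"
      using W(1) by (intro add_mono mult_left_mono) (auto simp: w_def)
    also have "\<dots> = ennreal (real n + h * W)" using pos W by (simp add: ennreal_plus ennreal_mult)
    finally have 1: "(\<integral>\<^sup>+x. (\<Sum>i. ennreal (h * (\<Sum>j<n. (norm (a i j x))\<^sup>2))) \<partial>M) \<le> ennreal (real n + h * W)" .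
    have sq_meas: "(\<lambda>x. ennreal ((norm (\<Psi> (w j) x))\<^sup>2)) \<in> borel_measurable M" if "j < n" for j
      using Psi_meas[OF that] by measurable
    have "(\<integral>\<^sup>+x. ennreal (h / l * (\<Sum>j<n. (norm (\<Psi> (w j) x))\<^sup>2)) \<partial>M) =
        (\<integral>\<^sup>+x. ennreal (h / l) * (\<Sum>j<n. ennreal ((norm (\<Psi> (w j) x))\<^sup>2)) \<partial>M)"
      using pos by (intro nn_integral_cong) (simp add: ennreal_mult sum_nonneg del: times_divide_eq_left)
    also have "\<dots> = ennreal (h / l) * (\<integral>\<^sup>+x. (\<Sum>j<n. ennreal ((norm (\<Psi> (w j) x))\<^sup>2)) \<partial>M)"
      using sq_meas by (intro nn_integral_cmult borel_measurable_sum) simp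
    also have "(\<integral>\<^sup>+x. (\<Sum>j<n. ennreal ((norm (\<Psi> (w j) x))\<^sup>2)) \<partial>M) = (\<Sum>j<n. \<integral>\<^sup>+x. ennreal ((norm (\<Psi> (w j) x))\<^sup>2) \<partial>M)"
      using sq_meas by (intro nn_integral_sum) simp
    also have "(\<Sum>j<n. \<integral>\<^sup>+x. ennreal ((norm (\<Psi> (w j) x))\<^sup>2) \<partial>M) = (\<Sum>j<n. \<integral>\<^sup>+y. ennreal ((norm (w j y))\<^sup>2) \<partial>N)"
      using w' by (intro sum.cong) (auto simp: isometry)
    also have "ennreal (h / l) * \<dots> \<le> ennreal (h / l) * ennreal W"
      using W(1) by (intro mult_left_mono) (auto simp: w_def)
    also have "\<dots> = ennreal (h / l * W)" by (rule ennreal_mult[symmetric]) (use pos W in auto)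
    finally have 2: "(\<integral>\<^sup>+x. ennreal (h / l * (\<Sum>j<n. (norm (\<Psi> (w j) x))\<^sup>2)) \<partial>M) \<le> ennreal (h / l * W)" .
    have "(\<integral>\<^sup>+x. ?G x \<partial>M) = ennreal ((1 + d) / l) * (\<integral>\<^sup>+x. (\<Sum>i. ennreal (h * (\<Sum>j<n. (norm (a i j x))\<^sup>2))) \<partial>M) +
        (\<integral>\<^sup>+x. ennreal (h / l * (\<Sum>j<n. (norm (\<Psi> (w j) x))\<^sup>2)) \<partial>M)"
      by (subst nn_integral_add) (auto simp: nn_integral_cmult)
    also have "\<dots> \<le> ennreal ((1 + d) / l) * ennreal (real n + h * W) + ennreal (h / l * W)"
      using 1 2 by (intro add_mono mult_left_mono) auto
    also have "\<dots> = ennreal ((1 + d) / l * (real n + h * W) + h / l * W)"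
    proof -
      have "ennreal ((1 + d) / l * (real n + h * W) + h / l * W) =
          ennreal ((1 + d) / l * (real n + h * W)) + ennreal (h / l * W)"
        by (rule ennreal_plus) (use pos W in auto)
      also have "ennreal ((1 + d) / l * (real n + h * W)) = ennreal ((1 + d) / l) * ennreal (real n + h * W)"
        by (rule ennreal_mult) (use pos W in auto)
      finally show ?thesis ..
    qed
    finally show ?thesis .
  qed
  finally show ?thesis unfolding A_def w_def by (simp add: add_mono)
qed

text \<open>The mesh size enters \<open>estimate_mesh\<close> only through terms proportional to h.
  Their factor W is finite because the functions g v_j are square-integrable, so a small h makes the
  error at most any given e.\<close>

lemma estimate:
  fixes g :: "'y \<Rightarrow> 'g \<Rightarrow> 'g" and v :: "nat \<Rightarrow> 'y \<Rightarrow> 'g" and f :: "'x \<Rightarrow> 'h \<Rightarrow> 'h"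
  assumes f: "op_measurable M f" "\<And>x. x \<in> space M \<Longrightarrow> compact_op type_hspace type_hspace (f x)"
    and g: "op_measurable N g" "\<And>y. y \<in> space N \<Longrightarrow> bounded_op type_hspace type_hspace (g y)"
    and weak: "\<And>\<tau>. 0 < \<tau> \<Longrightarrow> ennreal (\<tau> powr q) * emeasure N {y \<in> space N. \<tau> < onorm (g y)} \<le> ennreal G"
    and G: "0 \<le> G" and q: "2 < q"
    and v: "\<And>j. j < n \<Longrightarrow> v j \<in> L2_fun N" and w: "\<And>j. j < n \<Longrightarrow> (\<lambda>y. g y (v j y)) \<in> L2_fun N"
    and contr: "\<And>c. (\<integral>\<^sup>+y. ennreal ((norm (\<Sum>j<n. c j *\<^sub>C v j y))\<^sup>2) \<partial>N) \<le> ennreal (\<Sum>j<n. (cmod (c j))\<^sup>2)"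
    and pos: "0 < l" "0 < d"
  shows "(\<integral>\<^sup>+x. (\<Sum>j<n. ennreal ((norm (f x (\<Psi> (\<lambda>y. g y (v j y)) x)))\<^sup>2)) \<partial>M) \<le>
    ennreal ((1 + d) / l * real n) +
    ennreal ((1 + 1 / d) * (C\<^sup>2 * (G * (q / (q - 2)))) * l powr (q / 2 - 1) * (2 / q)) *
      (\<integral>\<^sup>+x. trace_op type_hspace (gram_powr type_hspace type_hspace (f x) (q / 2)) \<partial>M)"
    (is "?L \<le> _ + ?R")
proof (rule ennreal_le_epsilon)
  fix e :: real assume e: "0 < e"
  define W where "W = (\<Sum>j<n. \<integral>y. (norm (g y (v j y)))\<^sup>2 \<partial>N)"
  have W0: "0 \<le> W" unfolding W_def by (intro sum_nonneg integral_nonneg_AE) auto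
  have W: "(\<Sum>j<n. \<integral>\<^sup>+y. ennreal ((norm (g y (v j y)))\<^sup>2) \<partial>N) \<le> ennreal W"
    using w by (simp add: nn_integral_norm_sq W_def sum_ennreal)
  define k where "k = ((1 + d) / l + 1 / l) * W"
  have k0: "0 \<le> k" using pos W0 by (simp add: k_def)
  define h where "h = e / (k + 1)"
  have h0: "0 < h" using e k0 by (simp add: h_def)
  have hk: "h * k \<le> e" using e k0 by (simp add: h_def pos_divide_le_eq)
  have "?L \<le> ennreal ((1 + d) / l * (real n + h * W) + h / l * W) + ?R"
    by (rule estimate_mesh[OF f g weak G q v w contr h0 pos W W0])
  also have "(1 + d) / l * (real n + h * W) + h / l * W = (1 + d) / l * real n + h * k"
    by (simp add: k_def algebra_simps add_divide_distrib)
  also have "ennreal ((1 + d) / l * real n + h * k) \<le> ennreal ((1 + d) / l * real n + e)"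
    using hk by (intro ennreal_leI) simp
  also have "\<dots> = ennreal ((1 + d) / l * real n) + ennreal e"
    using pos e by (intro ennreal_plus) auto
  finally show "?L \<le> ennreal ((1 + d) / l * real n) + ?R + ennreal e" by (simp add: add_ac)
qed

text \<open>The optimal parameters are \<open>d = 2 / (q - 2)\<close> and \<open>l = (1 + d)\<^sup>2 / \<kappa>\<^sup>2\<close>.\<close>

lemma counting_estimate:
  fixes g :: "'y \<Rightarrow> 'g \<Rightarrow> 'g" and v :: "nat \<Rightarrow> 'y \<Rightarrow> 'g" and f :: "'x \<Rightarrow> 'h \<Rightarrow> 'h"
  assumes f: "op_measurable M f" "\<And>x. x \<in> space M \<Longrightarrow> compact_op type_hspace type_hspace (f x)"
    and g: "op_measurable N g" "\<And>y. y \<in> space N \<Longrightarrow> bounded_op type_hspace type_hspace (g y)"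
    and weak: "\<And>\<tau>. 0 < \<tau> \<Longrightarrow> ennreal (\<tau> powr q) * emeasure N {y \<in> space N. \<tau> < onorm (g y)} \<le> ennreal G"
    and G: "0 \<le> G" and q: "2 < q"
    and F: "(\<integral>\<^sup>+x. trace_op type_hspace (gram_powr type_hspace type_hspace (f x) (q / 2)) \<partial>M) \<le> ennreal F" "0 \<le> F"
    and v: "\<And>j. j < n \<Longrightarrow> v j \<in> L2_fun N" and w: "\<And>j. j < n \<Longrightarrow> (\<lambda>y. g y (v j y)) \<in> L2_fun N"
    and contr: "\<And>c. (\<integral>\<^sup>+y. ennreal ((norm (\<Sum>j<n. c j *\<^sub>C v j y))\<^sup>2) \<partial>N) \<le> ennreal (\<Sum>j<n. (cmod (c j))\<^sup>2)"
    and \<kappa>: "0 < \<kappa>"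
    and large: "\<And>j. j < n \<Longrightarrow> ennreal (\<kappa>\<^sup>2) \<le> (\<integral>\<^sup>+x. ennreal ((norm (f x (\<Psi> (\<lambda>y. g y (v j y)) x)))\<^sup>2) \<partial>M)"
  shows "\<kappa> powr q * real n \<le> q / 2 * (q / (q - 2)) powr (q - 1) * C\<^sup>2 * F * G"
proof -
  \<comment> \<open>With this d, 1 + d is the factor q/(q-2) of the tail estimate, and 1 + 1/d = q/2
    cancels the 2/q that comes from averaging.\<close>
  define d where "d = 2 / (q - 2)"
  define r where "r = q / (q - 2)"
  have d: "0 < d" "1 + d = r" "1 + 1 / d = q / 2" using q by (auto simp: d_def r_def field_simps)
  have r0: "0 < r" using q by (simp add: r_def)
  \<comment> \<open>This makes the coefficient of n on the right equal to \<kappa>^2/r with r > 1, a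
    fixed fraction of the left side.\<close>
  define l where "l = r\<^sup>2 / \<kappa>\<^sup>2"
  have l: "0 < l" using r0 \<kappa> by (simp add: l_def)
  have linf: "bounded_linear (f x)" if "x \<in> space M" for x
    using f(2)[OF that] by (intro bounded_op_type_hspace_bounded_linear) (simp add: compact_op_def)
  have meas: "(\<lambda>x. ennreal ((norm (f x (\<Psi> (\<lambda>y. g y (v j y)) x)))\<^sup>2)) \<in> borel_measurable M" if "j < n" for j
    using borel_measurable_op_apply[OF f(1) linf L2_fun_measurable[OF closed[OF w[OF that]]]] by measurable
  have "ennreal (real n * \<kappa>\<^sup>2) = (\<Sum>j<n. ennreal (\<kappa>\<^sup>2))"
    by (simp add: ennreal_mult ennreal_of_nat_eq_real_of_nat)
  also have "\<dots> \<le> (\<Sum>j<n. \<integral>\<^sup>+x. ennreal ((norm (f x (\<Psi> (\<lambda>y. g y (v j y)) x)))\<^sup>2) \<partial>M)"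
    using large by (intro sum_mono) simp
  also have "\<dots> = (\<integral>\<^sup>+x. (\<Sum>j<n. ennreal ((norm (f x (\<Psi> (\<lambda>y. g y (v j y)) x)))\<^sup>2)) \<partial>M)"
    using meas by (intro nn_integral_sum[symmetric]) simp
  also have "\<dots> \<le> ennreal ((1 + d) / l * real n) +
    ennreal ((1 + 1 / d) * (C\<^sup>2 * (G * (q / (q - 2)))) * l powr (q / 2 - 1) * (2 / q)) *
      (\<integral>\<^sup>+x. trace_op type_hspace (gram_powr type_hspace type_hspace (f x) (q / 2)) \<partial>M)"
    by (rule estimate[OF f g weak G q v w contr l d(1)])
  also have "\<dots> \<le> ennreal ((1 + d) / l * real n) +
    ennreal ((1 + 1 / d) * (C\<^sup>2 * (G * (q / (q - 2)))) * l powr (q / 2 - 1) * (2 / q)) * ennreal F"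
    using F by (intro add_mono mult_left_mono) auto
  also have "\<dots> = ennreal (r / l * real n + (C\<^sup>2 * (G * r)) * l powr (q / 2 - 1) * F)"
  proof -
    have c: "(1 + 1 / d) * (C\<^sup>2 * (G * (q / (q - 2)))) * l powr (q / 2 - 1) * (2 / q) =
        C\<^sup>2 * (G * r) * l powr (q / 2 - 1)"
      using q unfolding d(3) r_def[symmetric] by simp
    have "ennreal (r / l * real n + (C\<^sup>2 * (G * r)) * l powr (q / 2 - 1) * F) =
        ennreal (r / l * real n) + ennreal ((C\<^sup>2 * (G * r)) * l powr (q / 2 - 1) * F)"
      by (rule ennreal_plus) (use G F l r0 in auto)
    also have "ennreal ((C\<^sup>2 * (G * r)) * l powr (q / 2 - 1) * F) =
        ennreal ((C\<^sup>2 * (G * r)) * l powr (q / 2 - 1)) * ennreal F"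
      by (rule ennreal_mult) (use G F l r0 in auto)
    finally show ?thesis by (simp only: c d(2))
  qed
  finally have main: "real n * \<kappa>\<^sup>2 \<le> r / l * real n + (C\<^sup>2 * (G * r)) * l powr (q / 2 - 1) * F"
    using q G F l r0 by (subst (asm) ennreal_le_iff) auto
  have rl: "r / l = \<kappa>\<^sup>2 / r" using r0 \<kappa> by (simp add: l_def power2_eq_square)
  have "l powr (q / 2 - 1) = (r / \<kappa>) powr (q - 2)"
  proof -
    have "l = (r / \<kappa>) powr 2" using r0 \<kappa> by (simp add: l_def power_divide powr_numeral)
    hence "l powr (q / 2 - 1) = (r / \<kappa>) powr (2 * (q / 2 - 1))" by (simp only: powr_powr)
    also have "2 * (q / 2 - 1) = q - 2" by simp
    finally show ?thesis .
  qed
  also have "\<dots> = r powr (q - 2) / \<kappa> powr (q - 2)" using r0 \<kappa> by (simp add: powr_divide)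
  finally have lp: "l powr (q / 2 - 1) = r powr (q - 2) / \<kappa> powr (q - 2)" .
  \<comment> \<open>After absorption the left side keeps the fraction 1 - 1/r = 2/q, whose
    reciprocal is the q/2 of the final constant.\<close>
  have "real n * \<kappa>\<^sup>2 * (1 - 1 / r) \<le> C\<^sup>2 * G * F * (r * r powr (q - 2)) / \<kappa> powr (q - 2)"
    using main by (simp add: rl lp algebra_simps)
  also have "1 - 1 / r = 2 / q" using q by (simp add: r_def field_simps)
  also have "r * r powr (q - 2) = r powr (q - 1)" using r0 powr_add[of r 1 "q - 2"] by simp
  finally have "real n * \<kappa>\<^sup>2 * (2 / q) * \<kappa> powr (q - 2) \<le> C\<^sup>2 * G * F * r powr (q - 1)"
    using \<kappa> by (simp add: pos_le_divide_eq)
  moreover have k2: "\<kappa> powr q = \<kappa>\<^sup>2 * \<kappa> powr (q - 2)"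
    using \<kappa> powr_add[of \<kappa> 2 "q - 2"] by (simp add: powr_numeral)
  hence "real n * \<kappa>\<^sup>2 * (2 / q) * \<kappa> powr (q - 2) = 2 / q * (\<kappa> powr q * real n)"
    by (simp only: k2 mult_ac)
  ultimately have "2 / q * (\<kappa> powr q * real n) \<le> C\<^sup>2 * G * F * r powr (q - 1)" by (simp only:)
  from mult_left_mono[OF this, of "q / 2"]
  have "\<kappa> powr q * real n \<le> q / 2 * (C\<^sup>2 * G * F * r powr (q - 1))" using q by simp
  also have "\<dots> = q / 2 * r powr (q - 1) * C\<^sup>2 * F * G" by (simp add: mult_ac)
  finally show ?thesis by (simp only: r_def)
qed

end

section \<open>Multiplication operators\<close>

lemma ennpowr_inverse: "0 < q \<Longrightarrow> ennpowr (ennpowr x (1 / q)) q = x"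
  by (cases x) (auto simp: ennpowr_def powr_powr)

lemma ennpowr_less_top_iff: "ennpowr x p < top \<longleftrightarrow> x < top"
  by (auto simp: ennpowr_def less_top)

lemma mult_dom_closed: "a \<in> mult_dom M f \<Longrightarrow> a \<in> hcarrier (L2 M)"
  by (simp add: mult_dom_def)

lemma mult_op_closed:
  fixes f :: "'x \<Rightarrow> 'h::{complex_hilbert_space, second_countable_topology} \<Rightarrow> 'h"
  shows "a \<in> mult_dom M f \<Longrightarrow> mult_op M f a \<in> hcarrier (L2 M)"
  by (simp add: mult_dom_def mult_op_def)

lemma L2_fun_cong_AE:
  fixes u :: "'x \<Rightarrow> 'h::{complex_hilbert_space, second_countable_topology}"
  assumes "u \<in> L2_fun M" "u' \<in> borel_measurable M" "AE x in M. u' x = u x"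
  shows "u' \<in> L2_fun M"
  using assms(1,2) by (rule L2_fun_bound[where c = 1]) (use assms(3) in \<open>auto elim: eventually_mono\<close>)

text \<open>The function is truncated and the multiplier is left unchanged, so the result stays in
  the maximal domain and the set of truncation depends only on f and R, not on u.\<close>

definition cutoff :: "('x \<Rightarrow> 'h \<Rightarrow> 'h) \<Rightarrow> nat \<Rightarrow> ('x \<Rightarrow> 'h) \<Rightarrow> 'x \<Rightarrow> 'h::real_normed_vector" where
  "cutoff f R u x = (if onorm (f x) \<le> real R then u x else 0)"

context
  fixes M :: "'x measure" and f :: "'x \<Rightarrow> 'h::{complex_hilbert_space, second_countable_topology} \<Rightarrow> 'h"
  assumes f: "op_measurable M f" "\<forall>x\<in>space M. bounded_op type_hspace type_hspace (f x)"
begin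

lemma mult_measurable: "u \<in> borel_measurable M \<Longrightarrow> (\<lambda>x. f x (u x)) \<in> borel_measurable M"
  using borel_measurable_op_apply[OF f(1) bounded_op_type_hspace_bounded_linear[OF bspec[OF f(2)]]] .

text \<open>The domain and the operator refer to a chosen representative; another one differs from
  it only on a null set, and strong measurability supplies measurability of the product.\<close>

lemma mult_class:
  assumes u: "u \<in> L2_fun M" and fu: "(\<lambda>x. f x (u x)) \<in> L2_fun M"
  shows mult_dom_class: "L2_class M u \<in> mult_dom M f"
    and mult_op_class: "mult_op M f (L2_class M u) = L2_class M (\<lambda>x. f x (u x))"
proof -
  have ae: "AE x in M. f x (L2_rep (L2_class M u) x) = f x (u x)"
    using L2_rep_class[OF u] by eventually_elim simp
  have m: "(\<lambda>x. f x (L2_rep (L2_class M u) x)) \<in> borel_measurable M"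
    using u by (intro mult_measurable L2_fun_measurable) simp
  have L: "(\<lambda>x. f x (L2_rep (L2_class M u) x)) \<in> L2_fun M"
    using fu m ae by (rule L2_fun_cong_AE)
  thus "L2_class M u \<in> mult_dom M f" using u by (simp add: mult_dom_def)
  show "mult_op M f (L2_class M u) = L2_class M (\<lambda>x. f x (u x))"
    unfolding mult_op_def using L2_class_eq_iff[OF L fu] ae by simp
qed

lemma mult_domE:
  assumes "a \<in> mult_dom M f"
  obtains u where "u \<in> L2_fun M" "(\<lambda>x. f x (u x)) \<in> L2_fun M" "a = L2_class M u"
proof (rule that)
  have a: "a \<in> hcarrier (L2 M)" using assms by (rule mult_dom_closed)
  show "L2_rep a \<in> L2_fun M" "a = L2_class M (L2_rep a)" using L2_rep[OF a] by simp_all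
  show "(\<lambda>x. f x (L2_rep a x)) \<in> L2_fun M" using assms by (simp add: mult_dom_def)
qed

lemma mult_add:
  assumes "a \<in> mult_dom M f" "b \<in> mult_dom M f"
  shows "hadd (L2 M) a b \<in> mult_dom M f \<and>
    mult_op M f (hadd (L2 M) a b) = hadd (L2 M) (mult_op M f a) (mult_op M f b)"
proof -
  obtain u where u: "u \<in> L2_fun M" "(\<lambda>x. f x (u x)) \<in> L2_fun M" "a = L2_class M u"
    using assms(1) by (rule mult_domE)
  obtain v where v: "v \<in> L2_fun M" "(\<lambda>x. f x (v x)) \<in> L2_fun M" "b = L2_class M v"
    using assms(2) by (rule mult_domE)
  have s: "(\<lambda>x. u x + v x) \<in> L2_fun M" using u v by (intro L2_fun_add)
  have fs: "(\<lambda>x. f x (u x) + f x (v x)) \<in> L2_fun M" using u v by (intro L2_fun_add)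
  have ae: "AE x in M. f x (u x + v x) = f x (u x) + f x (v x)"
    using linear_add[OF bounded_linear.linear[OF bounded_op_type_hspace_bounded_linear[OF bspec[OF f(2)]]]]
    by (intro AE_I2)
  have m: "(\<lambda>x. f x (u x + v x)) \<in> borel_measurable M"
    using s by (intro mult_measurable L2_fun_measurable)
  have L: "(\<lambda>x. f x (u x + v x)) \<in> L2_fun M" using fs m ae by (rule L2_fun_cong_AE)
  show ?thesis
    using u v mult_class[OF s L] mult_op_class[OF u(1,2)] mult_op_class[OF v(1,2)]
      L2_class_eq_iff[OF L fs] ae
    by (simp add: hadd_L2_class)
qed

lemma mult_scale:
  assumes "a \<in> mult_dom M f"
  shows "hscale (L2 M) c a \<in> mult_dom M f \<and>
    mult_op M f (hscale (L2 M) c a) = hscale (L2 M) c (mult_op M f a)"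
proof -
  obtain u where u: "u \<in> L2_fun M" "(\<lambda>x. f x (u x)) \<in> L2_fun M" "a = L2_class M u"
    using assms(1) by (rule mult_domE)
  have s: "(\<lambda>x. c *\<^sub>C u x) \<in> L2_fun M" using u by (intro L2_fun_scaleC)
  have fs: "(\<lambda>x. c *\<^sub>C f x (u x)) \<in> L2_fun M" using u by (intro L2_fun_scaleC)
  have ae: "AE x in M. f x (c *\<^sub>C u x) = c *\<^sub>C f x (u x)"
    using bounded_op_type_hspace_scaleC[OF bspec[OF f(2)]] by (intro AE_I2)
  have m: "(\<lambda>x. f x (c *\<^sub>C u x)) \<in> borel_measurable M"
    using s by (intro mult_measurable L2_fun_measurable)
  have L: "(\<lambda>x. f x (c *\<^sub>C u x)) \<in> L2_fun M" using fs m ae by (rule L2_fun_cong_AE)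
  show ?thesis
    using u mult_class[OF s L] mult_op_class[OF u(1,2)] L2_class_eq_iff[OF L fs] ae
    by (simp add: hscale_L2_class)
qed

lemma onorm_measurable: "(\<lambda>x. onorm (f x)) \<in> borel_measurable M"
  using f(1) bounded_op_type_hspace_bounded_linear[OF bspec[OF f(2)]] by (rule borel_measurable_onorm)

lemma cutoff_L2:
  assumes "u \<in> L2_fun M"
  shows "cutoff f R u \<in> L2_fun M"
proof (rule L2_fun_bound[OF assms])
  have [measurable]: "u \<in> borel_measurable M" using assms by (rule L2_fun_measurable)
  note [measurable] = onorm_measurable
  show "cutoff f R u \<in> borel_measurable M" unfolding cutoff_def[abs_def] by measurable
  show "AE x in M. norm (cutoff f R u x) \<le> 1 * norm (u x)" by (simp add: cutoff_def)
qed

lemma mult_cutoff_L2: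
  assumes "u \<in> L2_fun M"
  shows "(\<lambda>x. f x (cutoff f R u x)) \<in> L2_fun M"
proof (rule L2_fun_bound[OF assms])
  show "(\<lambda>x. f x (cutoff f R u x)) \<in> borel_measurable M"
    by (intro mult_measurable L2_fun_measurable cutoff_L2 assms)
  have "norm (f x (cutoff f R u x)) \<le> real R * norm (u x)" if x: "x \<in> space M" for x
  proof (cases "onorm (f x) \<le> real R")
    case True
    have "norm (f x (u x)) \<le> onorm (f x) * norm (u x)"
      using bounded_op_type_hspace_bounded_linear[OF bspec[OF f(2) x]] by (rule onorm)
    also have "\<dots> \<le> real R * norm (u x)" using True by (intro mult_right_mono) auto
    finally show ?thesis using True by (simp add: cutoff_def)
  next
    case False
    have "f x 0 = 0" using linear_0[OF bounded_linear.linear[OF bounded_op_type_hspace_bounded_linear[OF bspec[OF f(2) x]]]] .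
    thus ?thesis using False by (simp add: cutoff_def)
  qed
  thus "AE x in M. norm (f x (cutoff f R u x)) \<le> real R * norm (u x)" by (rule AE_I2)
qed

lemma cutoff_tendsto:
  assumes u: "u \<in> L2_fun M"
  shows "(\<lambda>R. hdist (L2 M) (L2_class M (cutoff f R u)) (L2_class M u)) \<longlonglongrightarrow> 0"
proof -
  have [measurable]: "u \<in> borel_measurable M" using u by (rule L2_fun_measurable)
  have [measurable]: "cutoff f R u \<in> borel_measurable M" for R using cutoff_L2[OF u] by (rule L2_fun_measurable)
  have "(\<lambda>R. \<integral>x. (norm (cutoff f R u x - u x))\<^sup>2 \<partial>M) \<longlonglongrightarrow> (\<integral>x. 0 \<partial>M)"
  proof (rule integral_dominated_convergence)
    show "integrable M (\<lambda>x. (norm (u x))\<^sup>2)" using u by (simp add: L2_fun_iff)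
    show "AE x in M. (\<lambda>R. (norm (cutoff f R u x - u x))\<^sup>2) \<longlonglongrightarrow> 0"
    proof (rule AE_I2)
      fix x
      have "\<forall>\<^sub>F R in sequentially. onorm (f x) \<le> real R"
        using eventually_ge_at_top[of "nat \<lceil>onorm (f x)\<rceil>"]
        by eventually_elim linarith
      hence "\<forall>\<^sub>F R in sequentially. (norm (cutoff f R u x - u x))\<^sup>2 = 0"
        by eventually_elim (simp add: cutoff_def)
      thus "(\<lambda>R. (norm (cutoff f R u x - u x))\<^sup>2) \<longlonglongrightarrow> 0" by (rule tendsto_eventually)
    qed
    show "AE x in M. norm ((norm (cutoff f R u x - u x))\<^sup>2) \<le> (norm (u x))\<^sup>2" for R
      by (simp add: cutoff_def)
  qed measurable
  hence "(\<lambda>R. sqrt (\<integral>x. (norm (cutoff f R u x - u x))\<^sup>2 \<partial>M)) \<longlonglongrightarrow> sqrt 0"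
    by (intro tendsto_real_sqrt) simp
  thus ?thesis using u cutoff_L2[OF u] by (simp add: hdist_L2_class)
qed

text \<open>Cutoffs lie in the domain, since |f| is at most R where they are nonzero, and converge
  to u by dominated convergence.\<close>

lemma mult_dom_dense: "hdense (L2 M) (mult_dom M f)"
  unfolding hdense_def
proof (intro conjI ballI allI impI)
  show "mult_dom M f \<subseteq> hcarrier (L2 M)" by (auto simp: mult_dom_def)
  fix a :: "('x \<Rightarrow> 'h) set" and e :: real assume a: "a \<in> hcarrier (L2 M)" and e: "0 < e"
  interpret hilbert "L2 M :: ('x \<Rightarrow> 'h) set hspace" by (rule hilbert_L2)
  obtain u where u: "u \<in> L2_fun M" "a = L2_class M u" using a by (rule L2_carrierE)
  obtain R where "norm (hdist (L2 M) (L2_class M (cutoff f R u)) (L2_class M u) - 0) < e"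
    using LIMSEQ_D[OF cutoff_tendsto[OF u(1)] e] by blast
  hence "hdist (L2 M) a (L2_class M (cutoff f R u)) < e"
    using dist_commute[OF L2_class_closed[OF u(1)] L2_class_closed[OF cutoff_L2[OF u(1)]]] u(2) by simp
  moreover have "L2_class M (cutoff f R u) \<in> mult_dom M f"
    using u by (intro mult_dom_class cutoff_L2 mult_cutoff_L2)
  ultimately show "\<exists>d\<in>mult_dom M f. hdist (L2 M) a d < e" by blast
qed

end

text \<open>Pythagoras on the level of functions. It serves for the untruncated family, whose
  combinations dominate those of the truncated one pointwise.\<close>

lemma orthonormal_lincomb_norm:
  fixes u :: "nat \<Rightarrow> 'y \<Rightarrow> 'g::{complex_hilbert_space, second_countable_topology}"
  assumes u: "\<And>j. j < n \<Longrightarrow> u j \<in> L2_fun N"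
    and on: "\<And>i j. \<lbrakk>i < n; j < n\<rbrakk> \<Longrightarrow> hinner (L2 N) (L2_class N (u i)) (L2_class N (u j)) = (if i = j then 1 else 0)"
  shows "(\<integral>\<^sup>+y. ennreal ((norm (\<Sum>j<n. c j *\<^sub>C u j y))\<^sup>2) \<partial>N) = ennreal (\<Sum>j<n. (cmod (c j))\<^sup>2)"
proof -
  let ?z = "\<lambda>y. \<Sum>j<n. c j *\<^sub>C u j y"
  have z: "?z \<in> L2_fun N" using u by (intro L2_fun_sum L2_fun_scaleC) simp
  have "complex_of_real (\<integral>y. (norm (?z y))\<^sup>2 \<partial>N) = (\<integral>y. complex_of_real ((norm (?z y))\<^sup>2) \<partial>N)"
    by (rule integral_of_real[symmetric]) (use z in \<open>simp add: L2_fun_iff\<close>)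
  also have "\<dots> = (\<integral>y. (\<Sum>i<n. \<Sum>j<n. cnj (c i) * (c j * cinner (u i y) (u j y))) \<partial>N)"
  proof (rule Bochner_Integration.integral_cong)
    fix y
    have "complex_of_real ((norm (?z y))\<^sup>2) = cinner (?z y) (?z y)" by (rule cinner_self[symmetric])
    also have "\<dots> = (\<Sum>i<n. cinner (c i *\<^sub>C u i y) (?z y))" by (rule cinner_sum_left)
    also have "\<dots> = (\<Sum>i<n. \<Sum>j<n. cnj (c i) * (c j * cinner (u i y) (u j y)))"
      by (simp only: cinner_sum_right cinner_scaleC_left cinner_scaleC_right sum_distrib_left mult_ac)
    finally show "complex_of_real ((norm (?z y))\<^sup>2) = (\<Sum>i<n. \<Sum>j<n. cnj (c i) * (c j * cinner (u i y) (u j y)))" .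
  qed simp
  also have "\<dots> = (\<Sum>i<n. \<integral>y. (\<Sum>j<n. cnj (c i) * (c j * cinner (u i y) (u j y))) \<partial>N)"
    by (intro Bochner_Integration.integral_sum Bochner_Integration.integrable_sum
      integrable_mult_right integrable_cinner u) auto
  also have "\<dots> = (\<Sum>i<n. \<Sum>j<n. \<integral>y. cnj (c i) * (c j * cinner (u i y) (u j y)) \<partial>N)"
    by (intro sum.cong Bochner_Integration.integral_sum integrable_mult_right integrable_cinner u) auto
  also have "\<dots> = (\<Sum>i<n. \<Sum>j<n. cnj (c i) * (c j * (\<integral>y. cinner (u i y) (u j y) \<partial>N)))"
    by (simp only: integral_mult_right_zero)
  also have "\<dots> = (\<Sum>i<n. \<Sum>j<n. if j = i then complex_of_real ((cmod (c i))\<^sup>2) else 0)"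
    using on u by (intro sum.cong) (auto simp: hinner_L2_class complex_norm_square mult.commute simp del: of_real_power)
  also have "\<dots> = complex_of_real (\<Sum>i<n. (cmod (c i))\<^sup>2)" by simp
  finally have "(\<integral>y. (norm (?z y))\<^sup>2 \<partial>N) = (\<Sum>i<n. (cmod (c i))\<^sup>2)" by (simp only: of_real_eq_iff)
  thus ?thesis using nn_integral_norm_sq[OF z] by simp
qed

text \<open>For each fixed u the inequality is closed in C, because the L_1 norm on its right side
  is finite; hence the infimum of the admissible constants is admissible.\<close>

lemma L1_Linf_norm_constant:
  assumes "L1_Linf_bounded M N \<Phi>"
  shows "L1_Linf_norm M N \<Phi> \<in> L1_Linf_constants M N \<Phi>"
proof -
  let ?S = "L1_Linf_constants M N \<Phi>"
  have ne: "?S \<noteq> {}" using assms by (simp add: L1_Linf_bounded_def)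
  have nonneg: "0 \<le> C" if "C \<in> ?S" for C using that by (simp add: L1_Linf_constants_def)
  have inf0: "0 \<le> Inf ?S" using ne nonneg by (intro cInf_greatest)
  have bdd: "bdd_below ?S" using nonneg by (intro bdd_belowI)
  have "Linf_norm N (L2_rep (\<Phi> (L2_class M u))) \<le> ennreal (Inf ?S) * L1_norm M u"
    if u: "u \<in> L2_fun M" and fin: "L1_norm M u < top" for u
  proof (rule ennreal_le_epsilon)
    fix e :: real assume e: "0 < e"
    obtain r where r: "0 \<le> r" "L1_norm M u = ennreal r" using fin by (cases "L1_norm M u") auto
    have "Inf ?S < Inf ?S + e / (r + 1)" using e r by simp
    then obtain C where C: "C \<in> ?S" "C < Inf ?S + e / (r + 1)"
      using ne bdd by (subst (asm) cInf_less_iff) auto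
    have "Linf_norm N (L2_rep (\<Phi> (L2_class M u))) \<le> ennreal C * L1_norm M u"
      using C(1) u fin by (auto simp: L1_Linf_constants_def)
    also have "\<dots> = ennreal (C * r)" using r nonneg[OF C(1)] by (simp add: ennreal_mult)
    also have "\<dots> \<le> ennreal (Inf ?S * r + e)"
    proof (rule ennreal_leI)
      have "C * r \<le> (Inf ?S + e / (r + 1)) * r" using C r by (intro mult_right_mono) auto
      also have "\<dots> = Inf ?S * r + e * (r / (r + 1))" by (simp add: algebra_simps)
      also have "e * (r / (r + 1)) \<le> e * 1" using e r by (intro mult_left_mono) auto
      finally show "C * r \<le> Inf ?S * r + e" by simp
    qed
    also have "\<dots> = ennreal (Inf ?S) * L1_norm M u + ennreal e"
      using r e inf0 by (simp add: ennreal_mult ennreal_plus)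
    finally show "Linf_norm N (L2_rep (\<Phi> (L2_class M u))) \<le> ennreal (Inf ?S) * L1_norm M u + ennreal e" .
  qed
  thus ?thesis using inf0 by (simp add: L1_Linf_norm_def L1_Linf_constants_def)
qed

section \<open>Boundedness from the dual estimate\<close>

text \<open>Duality: testing \<open>U\<close> against \<open>U / |U|\<close> on sets of finite measure where \<open>|U| > c\<close>.\<close>

lemma AE_norm_le_by_duality:
  fixes U :: "'x \<Rightarrow> 'h::{complex_hilbert_space, second_countable_topology}"
  assumes M: "sigma_finite_measure M" and U: "U \<in> L2_fun M" and c: "0 \<le> c"
    and test: "\<And>u m. \<lbrakk>u \<in> L2_fun M; L1_norm M u = ennreal m; 0 \<le> m\<rbrakk>
      \<Longrightarrow> cmod (\<integral>x. cinner (u x) (U x) \<partial>M) \<le> c * m"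
  shows "AE x in M. norm (U x) \<le> c"
proof -
  interpret sigma_finite_measure M by (rule M)
  obtain A :: "nat \<Rightarrow> 'x set" where A: "range A \<subseteq> sets M" "(\<Union>i. A i) = space M" "\<And>i. emeasure M (A i) \<noteq> \<infinity>"
    using sigma_finite by metis
  have [measurable]: "A i \<in> sets M" for i using A(1) by auto
  have [measurable]: "U \<in> borel_measurable M" using U by (rule L2_fun_measurable)
  have "AE x in M. \<forall>i. x \<in> A i \<longrightarrow> norm (U x) \<le> c"
  proof (subst AE_all_countable, rule allI)
    fix i
    \<comment> \<open>Restriction to A i makes S of finite measure, so that the bounded test
      function below is both integrable and square-integrable.\<close>
    define S where "S = {x \<in> A i. c < norm (U x)}"
    have "S = {x \<in> space M. x \<in> A i \<and> c < norm (U x)}" using A(2) by (auto simp: S_def)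
    hence S [measurable]: "S \<in> sets M" by simp
    have "emeasure M S \<le> emeasure M (A i)" by (intro emeasure_mono) (auto simp: S_def)
    hence fin: "emeasure M S < \<infinity>" using A(3)[of i] by (auto simp: less_top top.not_eq_extremum intro: le_less_trans)
    define u where "u x = (if x \<in> S then (1 / norm (U x)) *\<^sub>R U x else 0)" for x
    have U0: "norm (U x) > 0" if "x \<in> S" for x
      using that c unfolding S_def by (auto intro: le_less_trans simp del: zero_less_norm_iff)
    have nu: "norm (u x) = indicator S x" for x using U0[of x] by (auto simp: u_def)
    have [measurable]: "u \<in> borel_measurable M" unfolding u_def[abs_def] by measurable
    have "(\<integral>\<^sup>+x. ennreal ((norm (u x))\<^sup>2) \<partial>M) = (\<integral>\<^sup>+x. indicator S x \<partial>M)"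
      by (intro nn_integral_cong) (simp add: nu indicator_def)
    hence u: "u \<in> L2_fun M" using fin by (simp add: L2_fun_def)
    have "L1_norm M u = (\<integral>\<^sup>+x. indicator S x \<partial>M)"
      unfolding L1_norm_def by (intro nn_integral_cong) (simp add: nu indicator_def)
    also have "\<dots> = ennreal (measure M S)" using fin by (simp add: emeasure_eq_ennreal_measure)
    finally have L1: "L1_norm M u = ennreal (measure M S)" .
    have cU: "cinner (u x) (U x) = complex_of_real (indicator S x * norm (U x))" for x
    proof (cases "x \<in> S")
      case True
      have "cinner (u x) (U x) = complex_of_real (1 / norm (U x)) * complex_of_real ((norm (U x))\<^sup>2)"
        using True by (simp add: u_def scaleR_scaleC cinner_scaleC_left cinner_self del: of_real_power)
      also have "\<dots> = complex_of_real (norm (U x))"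
        using U0[OF True] by (simp only: of_real_mult[symmetric]) (simp add: power2_eq_square)
      finally show ?thesis using True by simp
    qed (simp add: u_def bounded_bilinear.zero_left[OF bounded_bilinear_cinner])
    have int1: "integrable M (\<lambda>x. indicator S x * norm (U x))"
      using integrable_Re[OF integrable_cinner[OF u U]] by (simp only: cU Re_complex_of_real)
    have "(\<integral>x. cinner (u x) (U x) \<partial>M) = complex_of_real (\<integral>x. indicator S x * norm (U x) \<partial>M)"
      unfolding cU using int1 by (rule integral_of_real)
    hence "(\<integral>x. indicator S x * norm (U x) \<partial>M) \<le> c * measure M S"
      using test[OF u L1] by (simp add: abs_le_iff)
    moreover have int2: "integrable M (\<lambda>x. c * indicator S x :: real)"
      using fin by (intro integrable_mult_right integrable_real_indicator) auto
    have "(\<integral>x. c * indicator S x \<partial>M) = c * measure M S" using fin by simp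
    \<comment> \<open>The integrand |U| - c is positive on S, so an integral that is not positive
      forces S to be a null set.\<close>
    ultimately have "(\<integral>x. indicator S x * norm (U x) - c * indicator S x \<partial>M) \<le> 0"
      using Bochner_Integration.integral_diff[OF int1 int2] by simp
    moreover have nonneg: "0 \<le> indicator S x * norm (U x) - c * indicator S x" for x
      by (auto simp: S_def indicator_def)
    hence "0 \<le> (\<integral>x. indicator S x * norm (U x) - c * indicator S x \<partial>M)" by simp
    ultimately have "(\<integral>x. indicator S x * norm (U x) - c * indicator S x \<partial>M) = 0" by simp
    hence "AE x in M. indicator S x * norm (U x) - c * indicator S x = 0"
      using integral_nonneg_eq_0_iff_AE[OF Bochner_Integration.integrable_diff[OF int1 int2]] nonneg by simp
    thus "AE x in M. x \<in> A i \<longrightarrow> norm (U x) \<le> c"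
      by eventually_elim (auto simp: S_def indicator_def split: if_splits)
  qed
  thus ?thesis using AE_space
  proof eventually_elim
    case (elim x)
    thus ?case using A(2) by blast
  qed
qed

text \<open>Preservation of inner products makes \<Phi>^* \<Phi> the identity. By surjectivity each
  b is some \<Phi> x, so the adjoint preserves norms as well.\<close>

lemma unitary_op_facts:
  fixes \<Phi> :: "('x \<Rightarrow> 'h::{complex_hilbert_space, second_countable_topology}) set
              \<Rightarrow> ('y \<Rightarrow> 'g::{complex_hilbert_space, second_countable_topology}) set"
  assumes U: "unitary_op (L2 M) (L2 N) \<Phi>"
  shows unitary_bounded: "bounded_op (L2 M) (L2 N) \<Phi>"
    and unitary_adjoint_norm: "\<And>b. b \<in> hcarrier (L2 N) \<Longrightarrow>
      hnorm (L2 M) (adjoint_op (L2 M) (L2 N) \<Phi> b) = hnorm (L2 N) b"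
proof -
  interpret hilbert_pair "L2 M :: ('x \<Rightarrow> 'h) set hspace" "L2 N :: ('y \<Rightarrow> 'g) set hspace"
    by (intro hilbert_pair.intro hilbert_L2)
  have lin: "linear_op (L2 M) (L2 N) \<Phi>" and surj: "\<Phi> ` hcarrier (L2 M) = hcarrier (L2 N)"
    and inner: "\<And>x y. \<lbrakk>x \<in> hcarrier (L2 M); y \<in> hcarrier (L2 M)\<rbrakk>
      \<Longrightarrow> hinner (L2 N) (\<Phi> x) (\<Phi> y) = hinner (L2 M) x y"
    using U by (auto simp: unitary_op_def)
  have nrm: "hnorm (L2 N) (\<Phi> x) = hnorm (L2 M) x" if "x \<in> hcarrier (L2 M)" for x
    using inner[OF that that] by (simp add: hnorm_def)
  show b: "bounded_op (L2 M) (L2 N) \<Phi>"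
    unfolding bounded_op_def using lin nrm by (intro conjI exI[of _ 1]) auto
  fix y :: "('y \<Rightarrow> 'g) set" assume "y \<in> hcarrier (L2 N)"
  then obtain x where x: "x \<in> hcarrier (L2 M)" "y = \<Phi> x" using surj by blast
  have "adjoint_op (L2 M) (L2 N) \<Phi> (\<Phi> x) = x"
  proof (rule E.vec_eqI)
    have Px: "\<Phi> x \<in> hcarrier (L2 N)" using lin x(1) by (rule linear_op_closed)
    show "adjoint_op (L2 M) (L2 N) \<Phi> (\<Phi> x) \<in> hcarrier (L2 M)" using b Px by (rule adjoint_closed)
    show "hinner (L2 M) z (adjoint_op (L2 M) (L2 N) \<Phi> (\<Phi> x)) = hinner (L2 M) z x"
      if "z \<in> hcarrier (L2 M)" for z
      using adjoint_inner[OF b that Px] inner[OF that x(1)] by simp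
  qed (rule x)
  thus "hnorm (L2 M) (adjoint_op (L2 M) (L2 N) \<Phi> y) = hnorm (L2 N) y" using x nrm by simp
qed

text \<open>For \<open>sup_bound\<close>, pair \<Phi>^* w with a test function u: this equals the
  pairing of w with \<Phi> u and is at most C times the product of the L_1 norms. The remaining
  axioms are the corresponding identities between classes.\<close>

lemma L2_transform_adjoint:
  fixes \<Phi> :: "('x \<Rightarrow> 'h::{complex_hilbert_space, second_countable_topology}) set
              \<Rightarrow> ('y \<Rightarrow> 'g::{complex_hilbert_space, second_countable_topology}) set"
  assumes M: "sigma_finite_measure M" and N: "sigma_finite_measure N"
    and U: "unitary_op (L2 M) (L2 N) \<Phi>" and C: "C \<in> L1_Linf_constants M N \<Phi>"
  shows "L2_transform M N C (\<lambda>w. L2_rep (adjoint_op (L2 M) (L2 N) \<Phi> (L2_class N w)))"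
proof -
  interpret hilbert_pair "L2 M :: ('x \<Rightarrow> 'h) set hspace" "L2 N :: ('y \<Rightarrow> 'g) set hspace"
    by (intro hilbert_pair.intro hilbert_L2)
  let ?A = "adjoint_op (L2 M) (L2 N) \<Phi>"
  let ?\<Psi> = "\<lambda>w. L2_rep (?A (L2_class N w))"
  note b = unitary_bounded[OF U]
  note Alin = bounded_op_linear[OF adjoint_bounded[OF b]]
  have C0: "0 \<le> C" using C by (simp add: L1_Linf_constants_def)
  have Acl: "?A (L2_class N w) \<in> hcarrier (L2 M)" if "w \<in> L2_fun N" for w
    using linear_op_closed[OF Alin L2_class_closed[OF that]] .
  have Psi: "?\<Psi> w \<in> L2_fun M" "L2_class M (?\<Psi> w) = ?A (L2_class N w)" if "w \<in> L2_fun N" for w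
    using L2_rep[OF Acl[OF that]] by simp_all
  show ?thesis
  proof
    fix w :: "'y \<Rightarrow> 'g" assume w: "w \<in> L2_fun N"
    show "?\<Psi> w \<in> L2_fun M" by (rule Psi[OF w])
    show "AE x in M. ?\<Psi> (\<lambda>y. c *\<^sub>C w y) x = c *\<^sub>C ?\<Psi> w x" for c
    proof -
      have cw: "(\<lambda>y. c *\<^sub>C w y) \<in> L2_fun N" using w by (rule L2_fun_scaleC)
      have "L2_class M (?\<Psi> (\<lambda>y. c *\<^sub>C w y)) = ?A (hscale (L2 N) c (L2_class N w))"
        by (simp only: Psi(2)[OF cw] hscale_L2_class[OF w])
      also have "\<dots> = hscale (L2 M) c (L2_class M (?\<Psi> w))"
        by (simp only: linear_op_scale[OF Alin L2_class_closed[OF w]] Psi(2)[OF w])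
      also have "\<dots> = L2_class M (\<lambda>x. c *\<^sub>C ?\<Psi> w x)" by (rule hscale_L2_class[OF Psi(1)[OF w]])
      finally show ?thesis
        using L2_class_eq_iff[OF Psi(1)[OF cw] L2_fun_scaleC[OF Psi(1)[OF w]], of c] by blast
    qed
    show "(\<integral>\<^sup>+x. ennreal ((norm (?\<Psi> w x))\<^sup>2) \<partial>M) = (\<integral>\<^sup>+y. ennreal ((norm (w y))\<^sup>2) \<partial>N)"
      unfolding hnorm_sq_L2_class[OF Psi(1)[OF w], symmetric] hnorm_sq_L2_class[OF w, symmetric] Psi(2)[OF w]
      by (simp only: unitary_adjoint_norm[OF U L2_class_closed[OF w]])
    show "AE x in M. ?\<Psi> (\<lambda>y. w y + w' y) x = ?\<Psi> w x + ?\<Psi> w' x" if w': "w' \<in> L2_fun N" for w'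
    proof -
      have s: "(\<lambda>y. w y + w' y) \<in> L2_fun N" using w w' by (rule L2_fun_add)
      have "L2_class M (?\<Psi> (\<lambda>y. w y + w' y)) = ?A (hadd (L2 N) (L2_class N w) (L2_class N w'))"
        by (simp only: Psi(2)[OF s] hadd_L2_class[OF w w'])
      also have "\<dots> = hadd (L2 M) (L2_class M (?\<Psi> w)) (L2_class M (?\<Psi> w'))"
        by (simp only: linear_op_add[OF Alin L2_class_closed[OF w] L2_class_closed[OF w']] Psi(2)[OF w] Psi(2)[OF w'])
      also have "\<dots> = L2_class M (\<lambda>x. ?\<Psi> w x + ?\<Psi> w' x)"
        by (rule hadd_L2_class[OF Psi(1)[OF w] Psi(1)[OF w']])
      finally show ?thesis
        using L2_class_eq_iff[OF Psi(1)[OF s] L2_fun_add[OF Psi(1)[OF w] Psi(1)[OF w']]] by blast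
    qed
    show "AE x in M. norm (?\<Psi> w x) \<le> C * r"
      if r: "(\<integral>\<^sup>+y. ennreal (norm (w y)) \<partial>N) \<le> ennreal r" "0 \<le> r" for r
    proof (rule AE_norm_le_by_duality[OF M Psi(1)[OF w]])
      show "0 \<le> C * r" using C0 r by simp
      fix u :: "'x \<Rightarrow> 'h" and m
      assume u: "u \<in> L2_fun M" and m: "L1_norm M u = ennreal m" "0 \<le> m"
      define v where "v = L2_rep (\<Phi> (L2_class M u))"
      have Pu: "\<Phi> (L2_class M u) \<in> hcarrier (L2 N)"
        using linear_op_closed[OF bounded_op_linear[OF b] L2_class_closed[OF u]] .
      have v: "v \<in> L2_fun N" "L2_class N v = \<Phi> (L2_class M u)" unfolding v_def using L2_rep[OF Pu] by simp_all
      have "Linf_norm N v \<le> ennreal C * ennreal m"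
        using C u m unfolding v_def by (auto simp: L1_Linf_constants_def)
      moreover have "AE y in N. ennreal (norm (v y)) \<le> Linf_norm N v"
        unfolding Linf_norm_def by (rule esssup_AE)
      ultimately have "AE y in N. ennreal (norm (v y)) \<le> ennreal (C * m)"
        using C0 m by (auto simp: ennreal_mult elim!: eventually_mono)
      hence vC: "AE y in N. norm (v y) \<le> C * m"
        using C0 m by (auto elim!: eventually_mono)
      have wi: "integrable N (\<lambda>y. norm (w y))" and wr: "(\<integral>y. norm (w y) \<partial>N) \<le> r"
      proof -
        have "(\<integral>\<^sup>+y. ennreal (norm (norm (w y))) \<partial>N) < \<infinity>" using r by (auto intro: le_less_trans)
        thus wi: "integrable N (\<lambda>y. norm (w y))"
          using L2_fun_measurable[OF w] by (intro integrableI_bounded) auto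
        have "ennreal (\<integral>y. norm (w y) \<partial>N) \<le> ennreal r"
          using r nn_integral_eq_integral[OF wi] by simp
        thus "(\<integral>y. norm (w y) \<partial>N) \<le> r" using r by simp
      qed
      have "(\<integral>x. cinner (u x) (?\<Psi> w x) \<partial>M) = hinner (L2 M) (L2_class M u) (?A (L2_class N w))"
        by (simp only: hinner_L2_class[OF u Psi(1)[OF w], symmetric] Psi(2)[OF w])
      also have "\<dots> = hinner (L2 N) (L2_class N v) (L2_class N w)"
        by (simp only: adjoint_inner[OF b L2_class_closed[OF u] L2_class_closed[OF w], symmetric] v(2))
      also have "\<dots> = (\<integral>y. cinner (v y) (w y) \<partial>N)" by (rule hinner_L2_class[OF v(1) w])
      finally have "cmod (\<integral>x. cinner (u x) (?\<Psi> w x) \<partial>M) \<le> (\<integral>y. cmod (cinner (v y) (w y)) \<partial>N)"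
        by (simp only: integral_norm_bound)
      also have "\<dots> \<le> (\<integral>y. C * m * norm (w y) \<partial>N)"
      proof (rule integral_mono_AE)
        show "integrable N (\<lambda>y. cmod (cinner (v y) (w y)))"
          using integrable_cinner[OF v(1) w] by (rule integrable_norm)
        show "integrable N (\<lambda>y. C * m * norm (w y))" using wi by (rule integrable_mult_right)
        show "AE y in N. cmod (cinner (v y) (w y)) \<le> C * m * norm (w y)"
          using vC by eventually_elim (rule order_trans[OF cmod_cinner_le mult_right_mono], auto)
      qed
      also have "\<dots> = C * m * (\<integral>y. norm (w y) \<partial>N)" by simp
      also have "\<dots> \<le> C * m * r" using wr C0 m by (intro mult_left_mono) auto
      finally show "cmod (\<integral>x. cinner (u x) (?\<Psi> w x) \<partial>M) \<le> C * r * m" by (simp add: mult_ac)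
    qed
  qed (rule sigma_finite_measure.sigma_finite_countable[OF N], rule C0)
qed

context L2_transform
begin

text \<open>The estimate for one function, with d = l = 1 and v scaled to norm below 1. It provides
  boundedness of f \<Phi>^* g on the domain of g before any bounded operator is at hand.\<close>

lemma single_bound:
  fixes g :: "'y \<Rightarrow> 'g \<Rightarrow> 'g" and v :: "'y \<Rightarrow> 'g" and f :: "'x \<Rightarrow> 'h \<Rightarrow> 'h"
  assumes f: "op_measurable M f" "\<And>x. x \<in> space M \<Longrightarrow> compact_op type_hspace type_hspace (f x)"
    and g: "op_measurable N g" "\<And>y. y \<in> space N \<Longrightarrow> bounded_op type_hspace type_hspace (g y)"
    and weak: "\<And>\<tau>. 0 < \<tau> \<Longrightarrow> ennreal (\<tau> powr q) * emeasure N {y \<in> space N. \<tau> < onorm (g y)} \<le> ennreal G"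
    and G: "0 \<le> G" and q: "2 < q"
    and F: "(\<integral>\<^sup>+x. trace_op type_hspace (gram_powr type_hspace type_hspace (f x) (q / 2)) \<partial>M) \<le> ennreal F" "0 \<le> F"
    and v: "v \<in> L2_fun N" and w: "(\<lambda>y. g y (v y)) \<in> L2_fun N"
  shows "(\<integral>\<^sup>+x. ennreal ((norm (f x (\<Psi> (\<lambda>y. g y (v y)) x)))\<^sup>2) \<partial>M) \<le>
    ennreal ((2 + 2 * (C\<^sup>2 * (G * (q / (q - 2)))) * (2 / q) * F) * (\<integral>y. (norm (v y))\<^sup>2 \<partial>N))"
    (is "?L \<le> ennreal (?B * ?I)")
proof (rule ennreal_le_epsilon)
  fix e :: real assume e: "0 < e"
  define \<beta> where "\<beta> = ?B"
  have B: "0 < \<beta>" unfolding \<beta>_def using G q F(2) by (simp add: add_pos_nonneg)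
  have I: "0 \<le> ?I" by (intro integral_nonneg_AE) auto
  \<comment> \<open>The summand e/\<beta> keeps s positive when v vanishes, and it costs exactly e
    in the end because s^2 is multiplied by \<beta>.\<close>
  define s where "s = sqrt (?I + e / \<beta>)"
  have s: "0 < s" "s\<^sup>2 = ?I + e / \<beta>" using I B e by (auto simp: s_def add_nonneg_pos)
  let ?c = "complex_of_real (1 / s)"
  have fb: "\<forall>x\<in>space M. bounded_op type_hspace type_hspace (f x)" and
    gb: "\<forall>y\<in>space N. bounded_op type_hspace type_hspace (g y)"
    using f(2) g(2) by (auto simp: compact_op_def)
  define v' where "v' y = ?c *\<^sub>C v y" for y
  have v': "v' \<in> L2_fun N" unfolding v'_def[abs_def] using v by (rule L2_fun_scaleC)
  have gv': "g y (v' y) = ?c *\<^sub>C g y (v y)" if "y \<in> space N" for y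
    unfolding v'_def using bounded_op_type_hspace_scaleC[OF g(2)[OF that]] .
  have cw: "(\<lambda>y. ?c *\<^sub>C g y (v y)) \<in> L2_fun N" using w by (rule L2_fun_scaleC)
  have w': "(\<lambda>y. g y (v' y)) \<in> L2_fun N"
    using cw mult_measurable[OF g(1) gb L2_fun_measurable[OF v']]
    by (rule L2_fun_cong_AE) (rule AE_I2, rule gv')
  have scaled: "AE x in M. \<Psi> (\<lambda>y. g y (v' y)) x = ?c *\<^sub>C \<Psi> (\<lambda>y. g y (v y)) x"
  proof -
    \<comment> \<open>Linearity of g y is known only for y in the space of N, so the two functions
      may differ elsewhere. Their difference has norm 0, and isometry makes its image vanish almost
      everywhere.\<close>
    have d: "(\<lambda>y. g y (v' y) - ?c *\<^sub>C g y (v y)) \<in> L2_fun N" using w' cw by (rule L2_fun_diff)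
    define \<delta> where "\<delta> = \<Psi> (\<lambda>y. g y (v' y) - ?c *\<^sub>C g y (v y))"
    have [measurable]: "\<delta> \<in> borel_measurable M" unfolding \<delta>_def using closed[OF d] by (rule L2_fun_measurable)
    have "(\<integral>\<^sup>+x. ennreal ((norm (\<delta> x))\<^sup>2) \<partial>M) = (\<integral>\<^sup>+y. 0 \<partial>N)"
      unfolding \<delta>_def isometry[OF d] using gv' by (intro nn_integral_cong) simp
    hence "(\<integral>\<^sup>+x. ennreal ((norm (\<delta> x))\<^sup>2) \<partial>M) = 0" by simp
    hence "AE x in M. ennreal ((norm (\<delta> x))\<^sup>2) = 0" by (subst (asm) nn_integral_0_iff_AE) auto
    hence "AE x in M. \<Psi> (\<lambda>y. g y (v' y) - ?c *\<^sub>C g y (v y)) x = 0"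
      unfolding \<delta>_def by eventually_elim simp
    moreover have "AE x in M. \<Psi> (\<lambda>y. (g y (v' y) - ?c *\<^sub>C g y (v y)) + ?c *\<^sub>C g y (v y)) x =
        \<Psi> (\<lambda>y. g y (v' y) - ?c *\<^sub>C g y (v y)) x + \<Psi> (\<lambda>y. ?c *\<^sub>C g y (v y)) x"
      using d cw by (rule add)
    ultimately show ?thesis using scale[OF w, of ?c] by eventually_elim simp
  qed
  have contr: "(\<integral>\<^sup>+y. ennreal ((norm (\<Sum>j<1. c j *\<^sub>C v' y))\<^sup>2) \<partial>N) \<le> ennreal (\<Sum>j<1. (cmod (c j))\<^sup>2)"
    for c :: "nat \<Rightarrow> complex"
  proof -
    have "(\<integral>\<^sup>+y. ennreal ((norm (\<Sum>j<1. c j *\<^sub>C v' y))\<^sup>2) \<partial>N) =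
        (\<integral>\<^sup>+y. ennreal ((cmod (c 0) / s)\<^sup>2) * ennreal ((norm (v y))\<^sup>2) \<partial>N)"
      using s(1) by (intro nn_integral_cong)
        (simp add: v'_def norm_scaleC norm_divide power_mult_distrib ennreal_mult[symmetric] power_divide)
    also have "\<dots> = ennreal ((cmod (c 0) / s)\<^sup>2) * ennreal ?I"
      using L2_fun_measurable[OF v] nn_integral_norm_sq[OF v] by (subst nn_integral_cmult) auto
    also have "\<dots> = ennreal ((cmod (c 0))\<^sup>2 * (?I / s\<^sup>2))"
      using I by (simp add: ennreal_mult[symmetric] power_divide)
    also have "\<dots> \<le> ennreal ((cmod (c 0))\<^sup>2 * 1)"
    proof (intro ennreal_leI mult_left_mono)
      have "?I \<le> s\<^sup>2" using s(2) e B by simp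
      thus "?I / s\<^sup>2 \<le> 1" using s(1) by simp
    qed simp
    finally show ?thesis by simp
  qed
  have "(\<integral>\<^sup>+x. (\<Sum>j<(1::nat). ennreal ((norm (f x (\<Psi> (\<lambda>y. g y (v' y)) x)))\<^sup>2)) \<partial>M) \<le>
    ennreal ((1 + 1) / 1 * real 1) +
    ennreal ((1 + 1 / 1) * (C\<^sup>2 * (G * (q / (q - 2)))) * 1 powr (q / 2 - 1) * (2 / q)) *
      (\<integral>\<^sup>+x. trace_op type_hspace (gram_powr type_hspace type_hspace (f x) (q / 2)) \<partial>M)"
    using v' w' contr by (intro estimate f g weak G q) auto
  also have "\<dots> \<le> ennreal ((1 + 1) / 1 * real 1) +
    ennreal ((1 + 1 / 1) * (C\<^sup>2 * (G * (q / (q - 2)))) * 1 powr (q / 2 - 1) * (2 / q)) * ennreal F"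
    using F by (intro add_mono mult_left_mono) auto
  also have "\<dots> = ennreal 2 + ennreal (2 * (C\<^sup>2 * (G * (q / (q - 2)))) * (2 / q)) * ennreal F" by simp
  also have "\<dots> = ennreal \<beta>"
  proof -
    have nn: "0 \<le> 2 * (C\<^sup>2 * (G * (q / (q - 2)))) * (2 / q)" using G q by simp
    have "ennreal \<beta> = ennreal 2 + ennreal (2 * (C\<^sup>2 * (G * (q / (q - 2)))) * (2 / q) * F)"
      unfolding \<beta>_def by (rule ennreal_plus) (use nn F(2) in auto)
    also have "ennreal (2 * (C\<^sup>2 * (G * (q / (q - 2)))) * (2 / q) * F) =
        ennreal (2 * (C\<^sup>2 * (G * (q / (q - 2)))) * (2 / q)) * ennreal F"
      using nn F(2) by (rule ennreal_mult)
    finally show ?thesis ..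
  qed
  finally have est: "(\<integral>\<^sup>+x. ennreal ((norm (f x (\<Psi> (\<lambda>y. g y (v' y)) x)))\<^sup>2) \<partial>M) \<le> ennreal \<beta>" by simp
  have "?L = (\<integral>\<^sup>+x. ennreal (s\<^sup>2) * ennreal ((norm (f x (\<Psi> (\<lambda>y. g y (v' y)) x)))\<^sup>2) \<partial>M)"
  proof (rule nn_integral_cong_AE)
    show "AE x in M. ennreal ((norm (f x (\<Psi> (\<lambda>y. g y (v y)) x)))\<^sup>2) =
        ennreal (s\<^sup>2) * ennreal ((norm (f x (\<Psi> (\<lambda>y. g y (v' y)) x)))\<^sup>2)"
      using scaled AE_space
    proof eventually_elim
      case (elim x)
      have "norm (f x (\<Psi> (\<lambda>y. g y (v' y)) x)) = norm (f x (\<Psi> (\<lambda>y. g y (v y)) x)) / s"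
        using s(1) elim bounded_op_type_hspace_scaleC[OF bspec[OF fb]] by (simp add: norm_scaleC norm_divide)
      thus ?case using s(1) by (simp add: ennreal_mult[symmetric] power_divide)
    qed
  qed
  also have "\<dots> = ennreal (s\<^sup>2) * (\<integral>\<^sup>+x. ennreal ((norm (f x (\<Psi> (\<lambda>y. g y (v' y)) x)))\<^sup>2) \<partial>M)"
    using mult_measurable[OF f(1) fb L2_fun_measurable[OF closed[OF w']]]
    by (intro nn_integral_cmult) measurable
  also have "\<dots> \<le> ennreal (s\<^sup>2) * ennreal \<beta>" using est by (rule mult_left_mono) simp
  also have "\<dots> = ennreal (\<beta> * ?I + e)"
  proof -
    have "s\<^sup>2 * \<beta> = \<beta> * ?I + e" using B by (simp add: s(2) field_simps)
    thus ?thesis using ennreal_mult[of "s\<^sup>2" \<beta>] B by simp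
  qed
  also have "\<dots> = ennreal (\<beta> * ?I) + ennreal e" by (rule ennreal_plus) (use B I e in auto)
  finally show "?L \<le> ennreal (?B * ?I) + ennreal e" unfolding \<beta>_def .
qed

end

section \<open>Cwikel's estimate\<close>

theorem theorem3p1:
  fixes M :: "'x measure" and N :: "'y measure"
    and \<Phi> :: "('x \<Rightarrow> 'h::{complex_hilbert_space, second_countable_topology}) set
              \<Rightarrow> ('y \<Rightarrow> 'g::{complex_hilbert_space, second_countable_topology}) set"
    and f :: "'x \<Rightarrow> 'h \<Rightarrow> 'h" and g :: "'y \<Rightarrow> 'g \<Rightarrow> 'g"
    and q :: real
  assumes "sigma_finite_measure M" and "sigma_finite_measure N"
    and "unitary_op (L2 M) (L2 N) \<Phi>"
    and "L1_Linf_bounded M N \<Phi>"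
    and "q > 2"
    and "f \<in> Lq_schatten q M"
    and "g \<in> weak_Lq q N"
  shows "\<exists>K. is_sandwich M N \<Phi> f g K \<and> K \<in> weak_schatten q (L2 N) (L2 M) \<and>
    ennpowr (weak_schatten_norm q (L2 N) (L2 M) K) q
      \<le> ennreal (q / 2 * (q / (q - 2)) powr (q - 1) * (L1_Linf_norm M N \<Phi>)\<^sup>2)
          * ennpowr (Lq_schatten_norm q M f) q * ennpowr (weak_Lq_norm q N g) q"
proof -
  let ?EM = "L2 M :: ('x \<Rightarrow> 'h) set hspace" and ?EN = "L2 N :: ('y \<Rightarrow> 'g) set hspace"
  interpret hilbert_pair ?EN ?EM by (intro hilbert_pair.intro hilbert_L2)
  note q = \<open>q > 2\<close> and U = \<open>unitary_op (L2 M) (L2 N) \<Phi>\<close>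
  have q0: "0 < q" using q by simp
  define C where "C = L1_Linf_norm M N \<Phi>"
  have C: "C \<in> L1_Linf_constants M N \<Phi>"
    unfolding C_def using \<open>L1_Linf_bounded M N \<Phi>\<close> by (rule L1_Linf_norm_constant)
  let ?A = "adjoint_op ?EM ?EN \<Phi>"
  define \<Psi> where "\<Psi> w = L2_rep (?A (L2_class N w))" for w
  interpret L2_transform M N C \<Psi>
    unfolding \<Psi>_def[abs_def] using assms(1-3) C by (rule L2_transform_adjoint)
  have f: "op_measurable M f" "\<And>x. x \<in> space M \<Longrightarrow> compact_op type_hspace type_hspace (f x)"
    and f_fin: "Lq_schatten_norm q M f < top"
    using \<open>f \<in> Lq_schatten q M\<close> by (auto simp: Lq_schatten_def)
  have fb: "\<forall>x\<in>space M. bounded_op type_hspace type_hspace (f x)"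
    using f(2) by (auto simp: compact_op_def)
  have g: "op_measurable N g" "\<And>y. y \<in> space N \<Longrightarrow> bounded_op type_hspace type_hspace (g y)"
    and g_fin: "weak_Lq_norm q N g < top"
    using \<open>g \<in> weak_Lq q N\<close> by (auto simp: weak_Lq_def)
  have gb: "\<forall>y\<in>space N. bounded_op type_hspace type_hspace (g y)" using g(2) by blast

  have Fq: "ennpowr (Lq_schatten_norm q M f) q =
      (\<integral>\<^sup>+x. trace_op type_hspace (gram_powr type_hspace type_hspace (f x) (q / 2)) \<partial>M)"
    by (simp only: Lq_schatten_norm_def schatten_norm_def ennpowr_inverse[OF q0])
  have "ennpowr (Lq_schatten_norm q M f) q < top" using f_fin by (simp only: ennpowr_less_top_iff)
  then obtain F where F: "0 \<le> F" "ennpowr (Lq_schatten_norm q M f) q = ennreal F"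
    by (cases "ennpowr (Lq_schatten_norm q M f) q") auto
  have F': "(\<integral>\<^sup>+x. trace_op type_hspace (gram_powr type_hspace type_hspace (f x) (q / 2)) \<partial>M) \<le> ennreal F"
    using F Fq by simp
  have Gq: "ennpowr (weak_Lq_norm q N g) q =
      (SUP \<tau>\<in>{0<..}. ennreal (\<tau> powr q) * emeasure N {y \<in> space N. onorm (g y) > \<tau>})"
    by (simp only: weak_Lq_norm_def ennpowr_inverse[OF q0])
  have "ennpowr (weak_Lq_norm q N g) q < top" using g_fin by (simp only: ennpowr_less_top_iff)
  then obtain G where G: "0 \<le> G" "ennpowr (weak_Lq_norm q N g) q = ennreal G"
    by (cases "ennpowr (weak_Lq_norm q N g) q") auto
  have weak: "ennreal (\<tau> powr q) * emeasure N {y \<in> space N. \<tau> < onorm (g y)} \<le> ennreal G"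
    if "0 < \<tau>" for \<tau>
    unfolding G(2)[symmetric] Gq using that by (intro SUP_upper) simp

  note \<Phi>b = unitary_bounded[OF U]
  have Ab: "bounded_op ?EN ?EM ?A"
    by (rule hilbert_pair.adjoint_bounded[OF hilbert_pair.intro[OF hilbert_L2 hilbert_L2] \<Phi>b])
  note Alin = bounded_op_linear[OF Ab]
  have A_class: "?A (L2_class N w) = L2_class M (\<Psi> w)" if "w \<in> L2_fun N" for w
    unfolding \<Psi>_def using L2_class_rep[OF linear_op_closed[OF Alin L2_class_closed[OF that]]] ..
  define B where "B = 2 + 2 * (C\<^sup>2 * (G * (q / (q - 2)))) * (2 / q) * F"
  have B0: "0 \<le> B" using G(1) F(1) q by (simp add: B_def)
  have single: "(\<integral>\<^sup>+x. ennreal ((norm (f x (\<Psi> (\<lambda>y. g y (v y)) x)))\<^sup>2) \<partial>M) \<le> ennreal (B * (\<integral>y. (norm (v y))\<^sup>2 \<partial>N))"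
    if "v \<in> L2_fun N" "(\<lambda>y. g y (v y)) \<in> L2_fun N" for v
    unfolding B_def by (rule single_bound) (fact f g weak G(1) q F' F(1) that)+

  \<comment> \<open>If v and g v are square-integrable, \<open>single_bound\<close> puts f \<Phi>^*
    g v in L_2 automatically. The factor f therefore imposes no further domain condition, and the
    product has the dense domain of g.\<close>
  have core: "L2_class N v \<in> sandwich_dom M N \<Phi> f g"
    "sandwich_op M N \<Phi> f g (L2_class N v) = L2_class M (\<lambda>x. f x (\<Psi> (\<lambda>y. g y (v y)) x))"
    "(\<lambda>x. f x (\<Psi> (\<lambda>y. g y (v y)) x)) \<in> L2_fun M"
    if v: "v \<in> L2_fun N" "(\<lambda>y. g y (v y)) \<in> L2_fun N" for v
  proof -
    note cl = closed[OF v(2)]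
    have m: "(\<lambda>x. f x (\<Psi> (\<lambda>y. g y (v y)) x)) \<in> borel_measurable M"
      by (rule mult_measurable[OF f(1) fb L2_fun_measurable[OF cl]])
    have "(\<integral>\<^sup>+x. ennreal ((norm (f x (\<Psi> (\<lambda>y. g y (v y)) x)))\<^sup>2) \<partial>M) < top"
      using single[OF v] by (rule le_less_trans) simp
    thus L: "(\<lambda>x. f x (\<Psi> (\<lambda>y. g y (v y)) x)) \<in> L2_fun M" using m by (simp add: L2_fun_def)
    note mg = mult_class[OF g(1) gb v]
    note mf = mult_class[OF f(1) fb cl L]
    show "L2_class N v \<in> sandwich_dom M N \<Phi> f g"
      unfolding sandwich_dom_def using mg mf A_class[OF v(2)] by simp
    show "sandwich_op M N \<Phi> f g (L2_class N v) = L2_class M (\<lambda>x. f x (\<Psi> (\<lambda>y. g y (v y)) x))"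
      unfolding sandwich_op_def using mg mf A_class[OF v(2)] by simp
  qed
  have dom_eq: "sandwich_dom M N \<Phi> f g = mult_dom N g"
  proof
    show "mult_dom N g \<subseteq> sandwich_dom M N \<Phi> f g"
    proof
      fix a assume "a \<in> mult_dom N g"
      then obtain v where "v \<in> L2_fun N" "(\<lambda>y. g y (v y)) \<in> L2_fun N" "a = L2_class N v"
        by (rule mult_domE[OF g(1) gb])
      thus "a \<in> sandwich_dom M N \<Phi> f g" using core(1) by simp
    qed
  qed (auto simp: sandwich_dom_def)
  let ?D = "mult_dom N g" and ?T = "sandwich_op M N \<Phi> f g"
  have dense: "hdense ?EN ?D" by (rule mult_dom_dense[OF g(1) gb])
  have AD: "?A (mult_op N g a) \<in> mult_dom M f" if "a \<in> ?D" for a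
    using that unfolding dom_eq[symmetric] by (simp add: sandwich_dom_def)
  have Tadd: "hadd ?EN a b \<in> ?D \<and> ?T (hadd ?EN a b) = hadd ?EM (?T a) (?T b)"
    if ab: "a \<in> ?D" "b \<in> ?D" for a b
    using mult_add[OF g(1) gb ab] mult_add[OF f(1) fb AD[OF ab(1)] AD[OF ab(2)]]
      linear_op_add[OF Alin mult_op_closed[OF ab(1)] mult_op_closed[OF ab(2)]]
    by (simp add: sandwich_op_def)
  have Tscale: "hscale ?EN c a \<in> ?D \<and> ?T (hscale ?EN c a) = hscale ?EM c (?T a)"
    if a: "a \<in> ?D" for a c
    using mult_scale[OF g(1) gb a, of c] mult_scale[OF f(1) fb AD[OF a], of c]
      linear_op_scale[OF Alin mult_op_closed[OF a], of c]
    by (simp add: sandwich_op_def)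
  have Tclosed: "?T a \<in> hcarrier ?EM" if "a \<in> ?D" for a
    unfolding sandwich_op_def using AD[OF that] by (rule mult_op_closed)
  have Tbound: "hnorm ?EM (?T a) \<le> sqrt B * hnorm ?EN a" if a: "a \<in> ?D" for a
  proof -
    obtain v where v: "v \<in> L2_fun N" "(\<lambda>y. g y (v y)) \<in> L2_fun N" "a = L2_class N v"
      using a by (rule mult_domE[OF g(1) gb])
    have "ennreal ((hnorm ?EM (?T a))\<^sup>2) = (\<integral>\<^sup>+x. ennreal ((norm (f x (\<Psi> (\<lambda>y. g y (v y)) x)))\<^sup>2) \<partial>M)"
      by (simp only: v(3) core(2)[OF v(1,2)] hnorm_sq_L2_class[OF core(3)[OF v(1,2)]])
    also have "\<dots> \<le> ennreal (B * (\<integral>y. (norm (v y))\<^sup>2 \<partial>N))" by (rule single[OF v(1,2)])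
    also have "(\<integral>y. (norm (v y))\<^sup>2 \<partial>N) = (hnorm ?EN a)\<^sup>2"
      by (simp add: v(3) hnorm_L2_class[OF v(1)])
    finally have "(hnorm ?EM (?T a))\<^sup>2 \<le> B * (hnorm ?EN a)\<^sup>2" using B0 by (simp add: ennreal_le_iff)
    also have "\<dots> = (sqrt B * hnorm ?EN a)\<^sup>2" using B0 by (simp add: power_mult_distrib)
    finally show ?thesis
      by (rule power2_le_imp_le) (use B0 v(1,3) in \<open>simp add: hnorm_L2_class\<close>)
  qed
  have "\<exists>K. linear_op ?EN ?EM K \<and> (\<forall>a\<in>hcarrier ?EN. hnorm ?EM (K a) \<le> sqrt B * hnorm ?EN a) \<and>
      (\<forall>a\<in>?D. K a = ?T a)"
    by (rule bounded_extension) (fact dense Tadd Tscale Tclosed Tbound real_sqrt_ge_zero[OF B0])+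
  then obtain K where K: "linear_op ?EN ?EM K"
    "\<forall>a\<in>hcarrier ?EN. hnorm ?EM (K a) \<le> sqrt B * hnorm ?EN a" "\<forall>a\<in>?D. K a = ?T a"
    by blast
  have Kb: "bounded_op ?EN ?EM K" using K(1,2) by (auto simp: bounded_op_def)
  have sandwich: "is_sandwich M N \<Phi> f g K"
    using dense Kb K(3) by (simp add: is_sandwich_def dom_eq)

  define \<Lambda> where "\<Lambda> = q / 2 * (q / (q - 2)) powr (q - 1) * C\<^sup>2 * F * G"
  have \<Lambda>0: "0 \<le> \<Lambda>" using q F(1) G(1) by (simp add: \<Lambda>_def)
  \<comment> \<open>The bound for orthonormal families on which K exceeds \<kappa>; it feeds both
    the compactness criterion and the eigenvalue count.\<close>
  have count: "\<kappa> powr q * real (card S) \<le> \<Lambda>"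
    if \<kappa>: "0 < \<kappa>" and S: "finite S" "orthonormal ?EN S" and large: "\<And>a. a \<in> S \<Longrightarrow> \<kappa> < hnorm ?EM (K a)"
    for S \<kappa>
  proof -
    define n where "n = card S"
    obtain e where e: "bij_betw e {..<n} S"
      using ex_bij_betw_nat_finite[OF S(1)] by (auto simp: n_def atLeast0LessThan)
    have eS: "e j \<in> S" if "j < n" for j using bij_betwE[OF e] that by blast
    have eE: "e j \<in> hcarrier ?EN" if "j < n" for j using orthonormal_carrier[OF S(2) eS[OF that]] .
    define u where "u j = L2_rep (e j)" for j
    have u: "u j \<in> L2_fun N" "L2_class N (u j) = e j" if "j < n" for j
      unfolding u_def using L2_rep[OF eE[OF that]] by simp_all
    have cu: "cutoff g R (u j) \<in> L2_fun N" "(\<lambda>y. g y (cutoff g R (u j) y)) \<in> L2_fun N" if "j < n" for j R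
      using cutoff_L2[OF g(1) gb u(1)[OF that]] mult_cutoff_L2[OF g(1) gb u(1)[OF that]] by simp_all
    have "\<forall>\<^sub>F R in sequentially. \<kappa> < hnorm ?EM (K (L2_class N (cutoff g R (u j))))" if j: "j < n" for j
    \<comment> \<open>Outside the domain of g, K is only the extension and no formula for it is
      available. Truncated representatives lie in the domain, and continuity of K preserves the
      strict inequality for large R; as j ranges over a finite set, a common R exists.\<close>
    proof (rule order_tendstoD(1))
      show "\<kappa> < hnorm ?EM (K (e j))" using large eS[OF j] by simp
      have d: "(\<lambda>R. hdist ?EN (L2_class N (cutoff g R (u j))) (e j)) \<longlonglongrightarrow> 0"
        using cutoff_tendsto[OF g(1) gb u(1)[OF j]] by (simp only: u(2)[OF j])
      have c: "L2_class N (cutoff g R (u j)) \<in> hcarrier ?EN" for R using cu(1)[OF j] by simp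
      show "(\<lambda>R. hnorm ?EM (K (L2_class N (cutoff g R (u j))))) \<longlonglongrightarrow> hnorm ?EM (K (e j))"
        by (rule F.tendsto_norm[OF linear_op_closed[OF K(1) c] linear_op_closed[OF K(1) eE[OF j]]
          tendsto_bounded_op[OF Kb c eE[OF j] d]])
    qed
    hence "\<forall>\<^sub>F R in sequentially. \<forall>j\<in>{..<n}. \<kappa> < hnorm ?EM (K (L2_class N (cutoff g R (u j))))"
      by (intro eventually_ball_finite) auto
    then obtain R where R: "\<And>j. j < n \<Longrightarrow> \<kappa> < hnorm ?EM (K (L2_class N (cutoff g R (u j))))"
      unfolding eventually_sequentially by auto
    define v where "v j = cutoff g R (u j)" for j
    have v: "v j \<in> L2_fun N" "(\<lambda>y. g y (v j y)) \<in> L2_fun N" if "j < n" for j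
      unfolding v_def using cu[OF that] by auto
    have "\<kappa> powr q * real n \<le> q / 2 * (q / (q - 2)) powr (q - 1) * C\<^sup>2 * F * G"
    proof (rule counting_estimate)
      fix c :: "nat \<Rightarrow> complex"
      have on: "hinner ?EN (L2_class N (u i)) (L2_class N (u j)) = (if i = j then 1 else 0)"
        if "i < n" "j < n" for i j
        using S(2) eS[OF that(1)] eS[OF that(2)] bij_betw_imp_inj_on[OF e] that
        by (auto simp: u(2) orthonormal_def inj_on_def)
      have "(\<integral>\<^sup>+y. ennreal ((norm (\<Sum>j<n. c j *\<^sub>C v j y))\<^sup>2) \<partial>N) \<le>
          (\<integral>\<^sup>+y. ennreal ((norm (\<Sum>j<n. c j *\<^sub>C u j y))\<^sup>2) \<partial>N)"
      \<comment> \<open>All members are truncated on the same set, so a combination of the v j is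
        that of the u j times an indicator function. The contraction property survives although
        orthonormality may not.\<close>
      proof (intro nn_integral_mono ennreal_leI power_mono)
        show "norm (\<Sum>j<n. c j *\<^sub>C v j y) \<le> norm (\<Sum>j<n. c j *\<^sub>C u j y)" for y
          by (cases "onorm (g y) \<le> real R") (simp_all add: v_def cutoff_def)
      qed simp
      also have "\<dots> = ennreal (\<Sum>j<n. (cmod (c j))\<^sup>2)"
        using u(1) on by (rule orthonormal_lincomb_norm)
      finally show "(\<integral>\<^sup>+y. ennreal ((norm (\<Sum>j<n. c j *\<^sub>C v j y))\<^sup>2) \<partial>N) \<le> ennreal (\<Sum>j<n. (cmod (c j))\<^sup>2)" .
    next
      fix j assume j: "j < n"
      have "K (L2_class N (v j)) = ?T (L2_class N (v j))"
        using K(3) core(1)[OF v[OF j]] by (simp add: dom_eq)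
      hence "(\<integral>\<^sup>+x. ennreal ((norm (f x (\<Psi> (\<lambda>y. g y (v j y)) x)))\<^sup>2) \<partial>M) =
          ennreal ((hnorm ?EM (K (L2_class N (v j))))\<^sup>2)"
        by (simp only: core(2)[OF v[OF j]] hnorm_sq_L2_class[OF core(3)[OF v[OF j]]])
      moreover have "\<kappa>\<^sup>2 \<le> (hnorm ?EM (K (L2_class N (v j))))\<^sup>2"
        using R[OF j] \<kappa> by (intro power_mono) (auto simp: v_def)
      ultimately show "ennreal (\<kappa>\<^sup>2) \<le> (\<integral>\<^sup>+x. ennreal ((norm (f x (\<Psi> (\<lambda>y. g y (v j y)) x)))\<^sup>2) \<partial>M)"
        by (simp only: ennreal_leI)
    qed (fact f g weak G(1) q F' F(1) v \<kappa>)+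
    thus ?thesis by (simp only: \<Lambda>_def n_def)
  qed
  have card_le: "real (card S) \<le> \<Lambda> / \<kappa> powr q"
    if "0 < \<kappa>" "finite S" "orthonormal ?EN S" "\<And>a. a \<in> S \<Longrightarrow> \<kappa> < hnorm ?EM (K a)" for S \<kappa>
    using count[OF that] that(1) by (simp add: pos_le_divide_eq mult.commute)
  have compact: "compact_op ?EN ?EM K"
  proof (rule compact_op_criterion[OF Kb])
    fix \<epsilon> :: real assume \<epsilon>: "0 < \<epsilon>"
    have "card S \<le> nat \<lfloor>\<Lambda> / \<epsilon> powr q\<rfloor>"
      if "finite S" "orthonormal ?EN S" "\<forall>a\<in>S. \<epsilon> < hnorm ?EM (K a)" for S
      using card_le[OF \<epsilon> that(1,2)] that(3) by (intro le_nat_floor) auto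
    thus "\<exists>n. \<forall>S. finite S \<and> orthonormal ?EN S \<and> (\<forall>a\<in>S. \<epsilon> < hnorm ?EM (K a)) \<longrightarrow> card S \<le> n"
      by blast
  qed
  have "ennpowr (weak_schatten_norm q ?EN ?EM K) q =
      (SUP \<kappa>\<in>{0<..}. ennreal (\<kappa> powr q) * eigenvalue_count ?EN \<kappa> (gram_powr ?EN ?EM K (1 / 2)))"
    by (simp only: weak_schatten_norm_def ennpowr_inverse[OF q0])
  also have "\<dots> \<le> ennreal \<Lambda>"
  proof (rule SUP_least)
    fix \<kappa> :: real assume "\<kappa> \<in> {0<..}"
    hence \<kappa>: "0 < \<kappa>" by simp
    have "eigenvalue_count ?EN \<kappa> (gram_powr ?EN ?EM K (1 / 2)) \<le> ennreal (\<Lambda> / \<kappa> powr q)"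
      using compact \<kappa> by (rule eigenvalue_count_le) (intro ennreal_leI card_le[OF \<kappa>])
    hence "ennreal (\<kappa> powr q) * eigenvalue_count ?EN \<kappa> (gram_powr ?EN ?EM K (1 / 2)) \<le>
        ennreal (\<kappa> powr q) * ennreal (\<Lambda> / \<kappa> powr q)" by (rule mult_left_mono) simp
    also have "\<dots> = ennreal \<Lambda>" using \<kappa> \<Lambda>0 by (simp add: ennreal_mult[symmetric])
    finally show "ennreal (\<kappa> powr q) * eigenvalue_count ?EN \<kappa> (gram_powr ?EN ?EM K (1 / 2)) \<le> ennreal \<Lambda>" .
  qed
  finally have bound: "ennpowr (weak_schatten_norm q ?EN ?EM K) q \<le> ennreal \<Lambda>" .
  have "ennpowr (weak_schatten_norm q ?EN ?EM K) q < top" using bound by (rule le_less_trans) simp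
  hence "K \<in> weak_schatten q ?EN ?EM"
    using compact by (simp add: weak_schatten_def ennpowr_less_top_iff)
  moreover have "ennreal (q / 2 * (q / (q - 2)) powr (q - 1) * (L1_Linf_norm M N \<Phi>)\<^sup>2)
      * ennpowr (Lq_schatten_norm q M f) q * ennpowr (weak_Lq_norm q N g) q = ennreal \<Lambda>"
  proof -
    have k: "0 \<le> q / 2 * (q / (q - 2)) powr (q - 1) * C\<^sup>2" using q by simp
    show ?thesis
      unfolding F(2) G(2) C_def[symmetric] \<Lambda>_def
      by (simp only: ennreal_mult[OF mult_nonneg_nonneg[OF k F(1)] G(1)] ennreal_mult[OF k F(1)])
  qed
  ultimately show ?thesis using sandwich bound by metis
qed

end
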